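(* Let $p\colon\mathbb{R}^n\to[1,\infty]$ be a measurable function with $p^-:=\operatorname{ess\,inf}_{y\in\mathbb{R}^n}p(y)>1$ and such that $\frac1p$ is globally log-H\"older continuous. Then $f$ belongs to the Sobolev space with variable exponent $W^{1,p(\cdot)}(\mathbb{R}^n)$ if and only if $f\in L^{p(\cdot)}(\mathbb{R}^n)$ and there exists a non-negative function $g\in L^{p(\cdot)}(\mathbb{R}^n)$ such that the inequality $$|f(x)-f(y)|\le|x-y|\,(g(x)+g(y))$$ holds for a.e. $x,y\in\mathbb{R}^n$, i.e. for all $x,y\in\mathbb{R}^n\setminus S$ with some set $S$ of Lebesgue measure zero.
   Context: A function $\alpha\colon\mathbb{R}^n\to\mathbb{R}$ is globally log-H\"older continuous if there exist $c_1,c_2>0$ and $\alpha_\infty\in\mathbb{R}$ such that $|\alpha(x)-\alpha(y)|\le\frac{c_1}{\log(e+1/|x-y|)}$ for all $x,y\in\mathbb{R}^n$ and $|\alpha(x)-\alpha_\infty|\le\frac{c_2}{\log(e+|x|)}$ for all $x\in\mathbb{R}^n$. Here $\frac1\infty:=0$. $L^{p(\cdot)}(\mathbb{R}^n)$ is the space of measurable $f$ with $\|f\|=\inf\{\lambda>0:\int_{\mathbb{R}^n}\varphi_{p(x)}(|f(x)|/\lambda)\,dx\le1\}<\infty$, where $\varphi_p(t)=t^p$ for $p<\infty$, and $\varphi_\infty(t)=0$ for $t\le1$, $\varphi_\infty(t)=\infty$ for $t>1$. $W^{1,p(\cdot)}(\mathbb{R}^n)$ is the space of functions $f\in L^{p(\cdot)}(\mathbb{R}^n)$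 having a weak gradient $\nabla f$ with $|\nabla f|\in L^{p(\cdot)}(\mathbb{R}^n)$. *)

theory Defs
  imports "HOL-Analysis.Analysis"
begin

text \<open>
  At \<open>x = y\<close> the first inequality is trivial: its left-hand side is \<open>0\<close> and, since
  \<open>1 / 0 = 0\<close> in HOL, its right-hand side is \<open>c1\<close>.
\<close>
definition globally_log_holder :: "('a::euclidean_space \<Rightarrow> real) \<Rightarrow> bool" where
  "globally_log_holder \<alpha> \<longleftrightarrow>
     (\<exists>c1>0. \<exists>c2>0. \<exists>\<alpha>_inf::real.
        (\<forall>x y. \<bar>\<alpha> x - \<alpha> y\<bar> \<le> c1 / ln (exp 1 + 1 / norm (x - y))) \<and>
        (\<forall>x. \<bar>\<alpha> x - \<alpha>_inf\<bar> \<le> c2 / ln (exp 1 + norm x)))"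

definition ess_inf :: "'a measure \<Rightarrow> ('a \<Rightarrow> 'b::complete_linorder) \<Rightarrow> 'b" where
  "ess_inf M f = Sup {a. AE x in M. a \<le> f x}"

text \<open>The argument \<open>t\<close> is only ever non-negative.\<close>
definition phi :: "ennreal \<Rightarrow> real \<Rightarrow> ennreal" where
  "phi q t = (if q = \<infinity> then (if t \<le> 1 then 0 else \<infinity>) else ennreal (t powr enn2real q))"

text \<open>The infimum is taken in \<open>[0, \<infinity>]\<close>, so that it is \<open>\<infinity>\<close> when no \<open>c\<close> is admissible.\<close>
definition Lp_var_norm ::
    "('a::euclidean_space \<Rightarrow> ennreal) \<Rightarrow> ('a \<Rightarrow> real) \<Rightarrow> ennreal" where
  "Lp_var_norm p f =
     Inf {ennreal c | c. c > 0 \<and> (\<integral>\<^sup>+x. phi (p x) (\<bar>f x\<bar> / c) \<partial>lebesgue) \<le> 1}"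

definition Lp_var :: "('a::euclidean_space \<Rightarrow> ennreal) \<Rightarrow> ('a \<Rightarrow> real) set" where
  "Lp_var p = {f. f \<in> borel_measurable lebesgue \<and> Lp_var_norm p f < \<infinity>}"

primrec C_k :: "nat \<Rightarrow> ('a::euclidean_space \<Rightarrow> real) \<Rightarrow> bool" where
  "C_k 0 u \<longleftrightarrow> continuous_on UNIV u"
| "C_k (Suc k) u \<longleftrightarrow>
     u differentiable_on UNIV \<and> (\<forall>b\<in>Basis. C_k k (\<lambda>x. frechet_derivative u (at x) b))"

definition test_function :: "('a::euclidean_space \<Rightarrow> real) \<Rightarrow> bool" where
  "test_function u \<longleftrightarrow> (\<forall>k. C_k k u) \<and> compact (closure {x. u x \<noteq> 0})"

text \<open>\<open>L^1_loc\<close>; \<open>absolutely_integrable_on\<close> is Lebesgue integrability on the given set.\<close>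
definition locally_integrable :: "('a::euclidean_space \<Rightarrow> 'b::euclidean_space) \<Rightarrow> bool" where
  "locally_integrable h \<longleftrightarrow> (\<forall>K. compact K \<longrightarrow> h absolutely_integrable_on K)"

definition weak_gradient ::
    "('a::euclidean_space \<Rightarrow> real) \<Rightarrow> ('a \<Rightarrow> 'a) \<Rightarrow> bool" where
  "weak_gradient f G \<longleftrightarrow>
     locally_integrable f \<and> locally_integrable G \<and>
     (\<forall>u. test_function u \<longrightarrow> (\<forall>b\<in>Basis.
        (\<integral>x. f x * frechet_derivative u (at x) b \<partial>lebesgue) =
        - (\<integral>x. (G x \<bullet> b) * u x \<partial>lebesgue)))"

definition W1p_var :: "('a::euclidean_space \<Rightarrow> ennreal) \<Rightarrow> ('a \<Rightarrow> real) set" where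
  "W1p_var p = {f \<in> Lp_var p. \<exists>G. weak_gradient f G \<and> (\<lambda>x. norm (G x)) \<in> Lp_var p}"

end

theory Submission
  imports Defs
begin

text \<open>
  Write \<open>\<alpha> = 1 / p\<close>, a continuous function with values in \<open>[0, 1]\<close>, and let \<open>M\<close> be the maximal function
  that takes the supremum of the averages over the balls of radius \<open>(1/2)^k \<le> 1\<close> centred at the
  point.

  If \<open>f\<close> has a weak gradient \<open>G\<close>, then \<open>g = C * (M \<bar>G\<bar> + \<bar>f\<bar>)\<close> works. A mollification of \<open>f\<close> is the
  integral of \<open>f\<close> against a product of one-dimensional bumps. When the centre and the scale of
  such a product are changed in one coordinate at a time, each change is a partial derivative of a
  test function, so the definition of the weak gradient bounds the change of the mollification by
  the integral of \<open>\<bar>G\<bar>\<close> over a ball (\<open>mollifier_difference\<close>). Halving the scale again and again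
  leads from a mollification of \<open>f\<close> to \<open>f\<close> itself at every Lebesgue point, and one further change
  leads from \<open>x\<close> to \<open>y\<close>; this gives the inequality for points at a small distance
  (\<open>weak_gradient_pointwise_estimate\<close>). At larger distances \<open>\<bar>f x\<bar> + \<bar>f y\<bar>\<close> is enough, which is why
  \<open>M\<close> can do with small balls.

  It remains to see that \<open>M\<close> preserves the variable exponent space. Choose \<open>a > 1\<close> with
  \<open>a * \<alpha> \<le> 1\<close>, which is possible because the essential infimum of \<open>p\<close> exceeds \<open>1\<close>. For a function \<open>F\<close>
  of modular at most \<open>1\<close>, set \<open>\<Psi> y = F y powr (1 / (a * \<alpha> y))\<close>, and \<open>0\<close> where \<open>\<alpha> y = 0\<close>.
  Then \<open>\<Psi>\<close> lies in the ordinary space \<open>L^a\<close>, and log-Hoelder continuity gives the pointwise bound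
  \<open>M F x \<le> 2 * C * (M \<Psi> x + decay x) powr (a * \<alpha> x)\<close>, where \<open>decay\<close> is a fixed integrable weight. So
  the modular of a multiple of \<open>M F\<close> is controlled by the integral of \<open>(M \<Psi> + decay)^a\<close>, and this is
  finite because \<open>M\<close> is bounded on \<open>L^a\<close> (\<open>dyadic_maximal_modular\<close>).

  Conversely, assume the inequality with some \<open>g\<close>. The difference quotients of \<open>f\<close> in the direction
  \<open>b\<close> are bounded by \<open>g x + g (x + t b)\<close>, hence they are asymptotically, in \<open>L^1\<close> on bounded
  sets, of the form \<open>2 * g * w\<close> with \<open>\<bar>w\<bar> \<le> 1\<close>. Suitable means of the \<open>w\<close> converge almost everywhere
  (\<open>bounded_sequence_weak_limit\<close>), and \<open>2 * g\<close> times the limit is the weak partial derivative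
  (\<open>weak_partial_derivative_exists\<close>). It is bounded by \<open>2 * g\<close>, so it lies in the space of \<open>g\<close>.
\<close>

section \<open>Smooth kernels with compact support\<close>

lemma C_k_continuous: "C_k k u \<Longrightarrow> continuous_on UNIV u"
  by (cases k) (auto intro: differentiable_imp_continuous_on)

lemma C_k_measurable: "C_k k u \<Longrightarrow> u \<in> borel_measurable borel"
  by (intro borel_measurable_continuous_onI C_k_continuous)

lemma C_k_Suc_D: "C_k (Suc k) u \<Longrightarrow> C_k k u"
proof (induction k arbitrary: u)
  case 0
  then show ?case by (auto intro: differentiable_imp_continuous_on)
next
  case (Suc k)
  have "u differentiable_on UNIV" using Suc.prems by simp
  moreover have "C_k k (\<lambda>x. frechet_derivative u (at x) b)" if "b \<in> Basis" for b
    using Suc.prems that by (intro Suc.IH) auto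
  ultimately show ?case by simp
qed

lemma C_k_Suc_I:
  assumes "\<And>x. (u has_derivative D x) (at x)" "\<And>b. b \<in> Basis \<Longrightarrow> C_k k (\<lambda>x. D x b)"
  shows "C_k (Suc k) u"
proof -
  have "frechet_derivative u (at x) = D x" for x
    using assms(1) frechet_derivative_at by metis
  moreover have "u differentiable_on UNIV"
    using assms(1) unfolding differentiable_on_def differentiable_def by auto
  ultimately show ?thesis using assms(2) by simp
qed

lemma C_k_Suc_has_derivative:
  "C_k (Suc k) u \<Longrightarrow> (u has_derivative frechet_derivative u (at x)) (at x)"
  by (auto simp: differentiable_on_def frechet_derivative_works)

lemma C_k_has_real_derivative:
  fixes \<phi> :: "real \<Rightarrow> real"
  assumes "C_k (Suc k) \<phi>"
  shows "(\<phi> has_real_derivative frechet_derivative \<phi> (at t) 1) (at t)"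
proof -
  have d: "(\<phi> has_derivative frechet_derivative \<phi> (at t)) (at t)"
    by (rule C_k_Suc_has_derivative[OF assms])
  obtain y where y: "(\<phi> has_real_derivative y) (at t)"
    using d differentiable_def real_differentiable_def has_real_derivative by blast
  have "frechet_derivative \<phi> (at t) = (\<lambda>h. y * h)"
    using y frechet_derivative_at unfolding has_field_derivative_def by metis
  then show ?thesis using y by simp
qed

lemma C_k_const [simp]: "C_k k (\<lambda>x. c)"
  by (induction k arbitrary: c) (auto intro!: C_k_Suc_I[where D="\<lambda>_ _. 0"] simp del: C_k.simps(2))

lemma C_k_add: "C_k k u \<Longrightarrow> C_k k v \<Longrightarrow> C_k k (\<lambda>x. u x + v x)"
proof (induction k arbitrary: u v)
  case 0 then show ?case by (auto intro!: continuous_intros)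
next
  case (Suc k)
  have u: "C_k k (\<lambda>x. frechet_derivative u (at x) b)" 
   and v: "C_k k (\<lambda>x. frechet_derivative v (at x) b)" if "b \<in> Basis" for b
    using Suc.prems that by auto
  show ?case
    by (rule C_k_Suc_I[OF has_derivative_add[OF C_k_Suc_has_derivative[OF Suc.prems(1)]
          C_k_Suc_has_derivative[OF Suc.prems(2)]]]) (intro Suc.IH u v)
qed

lemma C_k_mult: "C_k k u \<Longrightarrow> C_k k v \<Longrightarrow> C_k k (\<lambda>x. u x * v x)"
proof (induction k arbitrary: u v)
  case 0 then show ?case by (auto intro!: continuous_intros)
next
  case (Suc k)
  have u: "C_k k (\<lambda>x. frechet_derivative u (at x) b)" 
   and v: "C_k k (\<lambda>x. frechet_derivative v (at x) b)" if "b \<in> Basis" for b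
    using Suc.prems that by auto
  show ?case
    by (rule C_k_Suc_I[OF has_derivative_mult[OF C_k_Suc_has_derivative[OF Suc.prems(1)]
          C_k_Suc_has_derivative[OF Suc.prems(2)]]])
      (intro C_k_add Suc.IH u v C_k_Suc_D[OF Suc.prems(1)] C_k_Suc_D[OF Suc.prems(2)])
qed

lemma C_k_inverse: "C_k k u \<Longrightarrow> (\<And>x. u x \<noteq> 0) \<Longrightarrow> C_k k (\<lambda>x. inverse (u x))"
proof (induction k)
  case 0 then show ?case by (auto intro!: continuous_intros)
next
  case (Suc k)
  have u: "C_k k (\<lambda>x. frechet_derivative u (at x) b)" if "b \<in> Basis" for b
    using Suc.prems that by auto
  have i: "C_k k (\<lambda>x. inverse (u x))" using C_k_Suc_D Suc by blast
  have "C_k k (\<lambda>x. (-1) * (inverse (u x) * frechet_derivative u (at x) b * inverse (u x)))"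
    if "b \<in> Basis" for b
    by (intro C_k_mult C_k_const i u that)
  then show ?case
    by (intro C_k_Suc_I[OF Deriv.has_derivative_inverse[OF Suc.prems(2) C_k_Suc_has_derivative[OF Suc.prems(1)]]]) auto
qed

lemma C_k_prod:
  "(\<And>i. i \<in> I \<Longrightarrow> C_k k (f i)) \<Longrightarrow> C_k k (\<lambda>x. \<Prod>i\<in>I. f i x)"
  by (induction I rule: infinite_finite_induct) (auto intro: C_k_mult)

lemma C_k_compose_affine:
  fixes \<phi> :: "real \<Rightarrow> real" and b :: "'a::euclidean_space"
  shows "C_k k \<phi> \<Longrightarrow> C_k k (\<lambda>x. \<phi> (c * (x \<bullet> b) + d))"
proof (induction k arbitrary: \<phi>)
  case 0 then show ?case
    by (auto intro!: continuous_on_compose2[of UNIV \<phi>] continuous_intros)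
next
  case (Suc k)
  have 1: "C_k k (\<lambda>t. frechet_derivative \<phi> (at t) 1)" using Suc.prems by simp
  have d: "((\<lambda>x. \<phi> (c * (x \<bullet> b) + d)) has_derivative
      (\<lambda>h. frechet_derivative \<phi> (at (c * (x \<bullet> b) + d)) (c * (h \<bullet> b)))) (at x)" for x
    by (rule has_derivative_compose[OF _ C_k_Suc_has_derivative[OF Suc.prems]])
       (auto intro!: derivative_eq_intros)
  have e: "frechet_derivative \<phi> (at t) y = y * frechet_derivative \<phi> (at t) 1" for t y
  proof -
    have "linear (frechet_derivative \<phi> (at t))"
      using C_k_Suc_has_derivative[OF Suc.prems] has_derivative_linear by blast
    then show ?thesis using linear_scale[of _ y 1] by fastforce
  qed
  show ?case
    by (rule C_k_Suc_I[OF d]) (subst e, intro C_k_mult C_k_const Suc.IH 1)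
qed

text \<open>
  All derivatives of \<open>exp (- 1 / t)\<close> are combinations of these functions with constant
  coefficients; having the whole family makes its smoothness a simple induction.
\<close>
definition exp_flat :: "nat \<Rightarrow> real \<Rightarrow> real" where
  "exp_flat k t = (if t > 0 then inverse t ^ k * exp (- inverse t) else 0)"

lemma exp_flat_tendsto: "(exp_flat k \<longlongrightarrow> 0) (at 0)"
proof -
  have "((\<lambda>x::real. x ^ k / exp x) \<longlongrightarrow> 0) at_top" by (rule tendsto_power_div_exp_0)
  then have "((\<lambda>t::real. inverse t ^ k / exp (inverse t)) \<longlongrightarrow> 0) (at_right 0)"
    by (rule filterlim_compose) (rule filterlim_inverse_at_top_right)
  then have r: "(exp_flat k \<longlongrightarrow> 0) (at_right 0)"
    by (rule Lim_transform_eventually)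
       (auto simp: exp_flat_def eventually_at_right_less exp_minus field_simps intro: eventually_mono[OF eventually_at_right_less])
  have l: "(exp_flat k \<longlongrightarrow> 0) (at_left 0)"
    by (rule tendsto_eventually) (auto simp: exp_flat_def eventually_at_filter)
  show ?thesis using l r filterlim_split_at by blast
qed

text \<open>
  At \<open>0\<close> the difference quotient of one member of the family is the next member, which tends to \<open>0\<close>.
\<close>
lemma exp_flat_deriv: "(exp_flat k has_real_derivative exp_flat (k + 2) t - real k * exp_flat (k + 1) t) (at t)"
proof -
  consider "t > 0" | "t < 0" | "t = 0" by linarith
  then show ?thesis
  proof cases
    case 1
    have "((\<lambda>t. inverse t ^ k * exp (- inverse t)) has_real_derivative
        real k * (inverse t ^ (k - 1) * - (inverse t ^ 2)) * exp (- inverse t)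
        + exp (- inverse t) * inverse t ^ 2 * inverse t ^ k) (at t)"
      using 1 by (auto simp: power2_eq_square intro!: derivative_eq_intros)
    also have "real k * (inverse t ^ (k - 1) * - (inverse t ^ 2)) * exp (- inverse t)
        + exp (- inverse t) * inverse t ^ 2 * inverse t ^ k = exp_flat (k + 2) t - real k * exp_flat (k + 1) t"
      using 1 by (cases k) (simp_all add: exp_flat_def power2_eq_square)
    finally have "((\<lambda>t. inverse t ^ k * exp (- inverse t)) has_real_derivative
        exp_flat (k + 2) t - real k * exp_flat (k + 1) t) (at t)" .
    then show ?thesis
      by (rule has_field_derivative_transform_within_open[where S="{0<..}"]) (use 1 in \<open>auto simp: exp_flat_def\<close>)
  next
    case 2
    have "((\<lambda>t. 0) has_real_derivative exp_flat (k + 2) t - real k * exp_flat (k + 1) t) (at t)"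
      using 2 by (auto simp: exp_flat_def)
    then show ?thesis
      by (rule has_field_derivative_transform_within_open[where S="{..<0}"]) (use 2 in \<open>auto simp: exp_flat_def\<close>)
  next
    case 3
    have "((\<lambda>h. exp_flat (Suc k) h) \<longlongrightarrow> 0) (at 0)" by (rule exp_flat_tendsto)
    then have "((\<lambda>h. (exp_flat k (0 + h) - exp_flat k 0) / h) \<longlongrightarrow> 0) (at 0)"
      by (rule Lim_transform_eventually) (auto simp: exp_flat_def divide_inverse)
    then show ?thesis using 3 by (simp add: DERIV_def exp_flat_def)
  qed
qed

lemma C_k_exp_flat: "C_k j (exp_flat k)"
proof (induction j arbitrary: k)
  case 0
  show ?case by (auto intro!: continuous_at_imp_continuous_on DERIV_isCont[OF exp_flat_deriv])
next
  case (Suc j)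
  have "C_k j (\<lambda>x. exp_flat (k + 2) x + (- real k) * exp_flat (k + 1) x)"
    by (intro C_k_add C_k_mult C_k_const Suc)
  then show ?case
    by (intro C_k_Suc_I[OF exp_flat_deriv[unfolded has_field_derivative_def]]) simp
qed

text \<open>
  A smooth transition from \<open>0\<close> on the left of \<open>-1\<close> to \<open>1\<close> on the right of \<open>1\<close>. Starting from
  the antiderivative and taking the bump as its derivative has two benefits: the bump has integral
  \<open>1\<close>, and the difference of two rescaled bumps is the derivative of an explicit function with
  compact support.
\<close>
definition smooth_step :: "real \<Rightarrow> real" where
  "smooth_step t = exp_flat 0 (1 + t) * inverse (exp_flat 0 (1 + t) + exp_flat 0 (1 - t))"

definition bump :: "real \<Rightarrow> real" where
  "bump t = frechet_derivative smooth_step (at t) 1"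

lemma exp_flat_nonneg: "exp_flat 0 t \<ge> 0" by (simp add: exp_flat_def)

lemma exp_flat_sum_pos: "exp_flat 0 (1 + t) + exp_flat 0 (1 - t) > 0"
  unfolding exp_flat_def by (cases "1 + t > 0"; cases "1 - t > 0") (auto intro: add_pos_pos)

lemma smooth_step_0: "t \<le> -1 \<Longrightarrow> smooth_step t = 0" by (simp add: smooth_step_def exp_flat_def)
lemma smooth_step_1: "t \<ge> 1 \<Longrightarrow> smooth_step t = 1" by (simp add: smooth_step_def exp_flat_def)
lemma smooth_step_bounds: "0 \<le> smooth_step t" "smooth_step t \<le> 1"
  using exp_flat_sum_pos[of t] exp_flat_nonneg[of "1 + t"] exp_flat_nonneg[of "1 - t"]
  by (simp_all add: smooth_step_def divide_inverse[symmetric] divide_le_eq_1 zero_le_divide_iff)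

lemma C_k_smooth_step: "C_k k smooth_step"
proof -
  have 1: "C_k k (\<lambda>t. exp_flat 0 (1 + t))" using C_k_compose_affine[OF C_k_exp_flat, of _ _ 1 "1::real" 1] by (simp add: add.commute)
  have 2: "C_k k (\<lambda>t. exp_flat 0 (1 - t))" using C_k_compose_affine[OF C_k_exp_flat, of _ _ "-1" "1::real" 1] by simp
  have "C_k k (\<lambda>t. exp_flat 0 (1 + t) * inverse (exp_flat 0 (1 + t) + exp_flat 0 (1 - t)))"
    using exp_flat_sum_pos by (intro C_k_mult C_k_inverse C_k_add 1 2) (metis less_irrefl)
  then show ?thesis unfolding smooth_step_def[abs_def] .
qed

lemma C_k_bump: "C_k k bump"
  using C_k_smooth_step[of "Suc k"] by (simp add: bump_def[abs_def])

lemma smooth_step_deriv: "(smooth_step has_real_derivative bump t) (at t)"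
  using C_k_has_real_derivative[OF C_k_smooth_step] by (simp add: bump_def)

lemma bump_0: assumes "\<bar>t\<bar> > 1" shows "bump t = 0"
proof -
  have "(smooth_step has_real_derivative 0) (at t)"
  proof (cases "t > 1")
    case True
    have "((\<lambda>_. 1) has_real_derivative 0) (at t)" by simp
    then show ?thesis
      by (rule has_field_derivative_transform_within_open[where S="{1<..}"]) (use True in \<open>auto simp: smooth_step_1\<close>)
  next
    case False
    have "((\<lambda>_. 0) has_real_derivative 0) (at t)" by simp
    then show ?thesis
      by (rule has_field_derivative_transform_within_open[where S="{..<-1}"]) (use assms False in \<open>auto simp: smooth_step_0\<close>)
  qed
  then show ?thesis by (rule DERIV_unique[OF smooth_step_deriv])
qed

lemma bump_bounded: "\<exists>L\<ge>1. \<forall>t. \<bar>bump t\<bar> \<le> L"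
proof -
  have "compact (bump ` {-1..1})"
    using C_k_continuous[OF C_k_bump] by (intro compact_continuous_image) (auto intro: continuous_on_subset)
  then obtain B where B: "\<forall>x\<in>bump ` {-1..1}. \<bar>x\<bar> \<le> B"
    using compact_imp_bounded bounded_real by metis
  have "\<bar>bump t\<bar> \<le> max B 1" for t
  proof (cases "\<bar>t\<bar> > 1")
    case False
    then have "bump t \<in> bump ` {-1..1}" by (intro imageI) auto
    then show ?thesis using B by (meson max.coboundedI1)
  qed (simp add: bump_0)
  then show ?thesis by (intro exI[of _ "max B 1"]) auto
qed

text \<open>
  Products of one-dimensional functions are the only test functions that have to be constructed.
\<close>
lemma test_function_prod:
  fixes \<kappa> :: "'a::euclidean_space \<Rightarrow> real \<Rightarrow> real"
  assumes sm: "\<And>b k. b \<in> Basis \<Longrightarrow> C_k k (\<kappa> b)"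
    and supp: "\<And>b t. b \<in> Basis \<Longrightarrow> \<bar>t\<bar> > R \<Longrightarrow> \<kappa> b t = 0"
  shows "test_function (\<lambda>z. \<Prod>b\<in>Basis. \<kappa> b (z \<bullet> b))"
proof -
  have "C_k k (\<lambda>z. \<kappa> b (z \<bullet> b))" if "b \<in> Basis" for b :: 'a and k
    using C_k_compose_affine[OF sm[OF that], of k 1 b 0] by simp
  then have 1: "C_k k (\<lambda>z::'a. \<Prod>b\<in>Basis. \<kappa> b (z \<bullet> b))" for k
    by (intro C_k_prod)
  have "{z::'a. (\<Prod>b\<in>Basis. \<kappa> b (z \<bullet> b)) \<noteq> 0} \<subseteq> cbox (- R *\<^sub>R One) (R *\<^sub>R One)"
  proof
    fix z :: 'a assume "z \<in> {z. (\<Prod>b\<in>Basis. \<kappa> b (z \<bullet> b)) \<noteq> 0}"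
    then have "\<forall>b\<in>Basis. \<kappa> b (z \<bullet> b) \<noteq> 0" by auto
    then have "\<forall>b\<in>Basis. \<bar>z \<bullet> b\<bar> \<le> R" using supp not_le_imp_less by blast
    then show "z \<in> cbox (- R *\<^sub>R One) (R *\<^sub>R One)" by (auto simp: mem_box abs_le_iff)
  qed
  then have "compact (closure {z::'a. (\<Prod>b\<in>Basis. \<kappa> b (z \<bullet> b)) \<noteq> 0})"
    using bounded_subset[OF bounded_cbox] by (simp add: compact_closure)
  with 1 show ?thesis by (simp add: test_function_def)
qed

lemma frechet_derivative_prod_coordinates:
  fixes \<kappa> :: "'a::euclidean_space \<Rightarrow> real \<Rightarrow> real"
  assumes d: "\<And>b t. b \<in> Basis \<Longrightarrow> (\<kappa> b has_real_derivative \<kappa>' b t) (at t)" and i: "i \<in> Basis"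
  shows "frechet_derivative (\<lambda>z. \<Prod>b\<in>Basis. \<kappa> b (z \<bullet> b)) (at z) i =
    \<kappa>' i (z \<bullet> i) * (\<Prod>b\<in>Basis - {i}. \<kappa> b (z \<bullet> b))"
proof -
  have "((\<lambda>z. \<kappa> b (z \<bullet> b)) has_derivative (\<lambda>h. \<kappa>' b (z \<bullet> b) * (h \<bullet> b))) (at z)" if "b \<in> Basis" for b
    by (rule has_derivative_compose[OF _ d[OF that, unfolded has_field_derivative_def]])
       (auto intro!: derivative_eq_intros)
  then have "((\<lambda>z. \<Prod>b\<in>Basis. \<kappa> b (z \<bullet> b)) has_derivative
     (\<lambda>h. \<Sum>b\<in>Basis. \<kappa>' b (z \<bullet> b) * (h \<bullet> b) * (\<Prod>c\<in>Basis - {b}. \<kappa> c (z \<bullet> c)))) (at z)"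
    by (rule has_derivative_prod)
  from fun_cong[OF frechet_derivative_at[OF this, symmetric], of i] have "frechet_derivative (\<lambda>z. \<Prod>b\<in>Basis. \<kappa> b (z \<bullet> b)) (at z) i =
     (\<Sum>b\<in>Basis. \<kappa>' b (z \<bullet> b) * (i \<bullet> b) * (\<Prod>c\<in>Basis - {b}. \<kappa> c (z \<bullet> c)))"
    .
  also have "\<dots> = (\<Sum>b\<in>Basis. if b = i then \<kappa>' i (z \<bullet> i) * (\<Prod>c\<in>Basis - {i}. \<kappa> c (z \<bullet> c)) else 0)"
    using i by (intro sum.cong) (auto simp: inner_Basis)
  finally show ?thesis using i by simp
qed

section \<open>Maximal function and Lebesgue points\<close>

text \<open>
  Squeeze the set between a closed and an open set of almost the same measure, and interpolate
  between them with an Urysohn function.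
\<close>
lemma indicator_continuous_approx:
  fixes A :: "'a::euclidean_space set"
  assumes A: "A \<in> sets lborel" "emeasure lborel A < \<infinity>" and "e > 0"
  shows "\<exists>h. continuous_on UNIV h \<and> integrable lborel h \<and>
    (\<integral>\<^sup>+x. ennreal \<bar>indicator A x - h x\<bar> \<partial>lborel) < ennreal e"
proof -
  have AL: "A \<in> sets lebesgue" using A by simp
  obtain U where U: "open U" "A \<subseteq> U" "emeasure lebesgue (U - A) < ennreal (e/2)"
    using sets_lebesgue_outer_open[OF AL, of "e/2"] \<open>e > 0\<close> by (metis half_gt_zero)
  obtain K where K: "closed K" "K \<subseteq> A" "emeasure lebesgue (A - K) < ennreal (e/2)"
    using sets_lebesgue_inner_closed[OF AL, of "e/2"] \<open>e > 0\<close> by (metis half_gt_zero)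
  have sets [measurable]: "A \<in> sets borel" "U \<in> sets borel" "K \<in> sets borel" using A U K by auto
  have "closed (- U)" "(- U) \<inter> K = {}" using U K by auto
  with K(1) obtain h :: "'a \<Rightarrow> real" where h: "continuous_on UNIV h" "\<And>x. h x \<in> closed_segment 0 1"
    "\<And>x. x \<in> - U \<Longrightarrow> h x = 0" "\<And>x. x \<in> K \<Longrightarrow> h x = 1"
    using Urysohn[of "- U" K 0 "1::real"] by metis
  have [measurable]: "h \<in> borel_measurable borel"
    using h(1) by (rule borel_measurable_continuous_onI)
  have h01: "0 \<le> h x" "h x \<le> 1" for x using h(2)[of x] by (auto simp: closed_segment_eq_real_ivl)
  have "(\<integral>\<^sup>+x. ennreal \<bar>indicator A x - h x\<bar> \<partial>lborel)
      \<le> (\<integral>\<^sup>+x. indicator (U - A) x + indicator (A - K) x \<partial>lborel)"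
  proof (rule nn_integral_mono)
    fix x
    show "ennreal \<bar>indicator A x - h x\<bar> \<le> indicator (U - A) x + indicator (A - K) x"
      using h01[of x] h(3)[of x] h(4)[of x] U(2) K(2)
      by (cases "x \<in> U"; cases "x \<in> A"; cases "x \<in> K") (auto simp: ennreal_le_1)
  qed
  also have "\<dots> = emeasure lborel (U - A) + emeasure lborel (A - K)"
    by (subst nn_integral_add) auto
  also have "\<dots> < ennreal (e/2) + ennreal (e/2)"
    using U(3) K(3) by (intro add_strict_mono) auto
  also have "\<dots> = ennreal e" using \<open>e > 0\<close> by (simp flip: ennreal_plus)
  finally have small: "(\<integral>\<^sup>+x. ennreal \<bar>indicator A x - h x\<bar> \<partial>lborel) < ennreal e" .
  have "integrable lborel (\<lambda>x. indicator A x :: real)" using A by simp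
  moreover have "integrable lborel (\<lambda>x. indicator A x - h x)"
    using small by (intro integrableI_bounded) (auto intro: less_trans)
  ultimately have "integrable lborel (\<lambda>x. indicator A x - (indicator A x - h x))"
    by (rule Bochner_Integration.integrable_diff)
  then show ?thesis using h(1) small by (auto intro!: exI[of _ h])
qed

text \<open>
  Density of continuous functions in \<open>L^1\<close>. The property passes to linear combinations and to dominated
  limits, so indicator functions suffice.
\<close>
lemma integrable_continuous_approx:
  fixes f :: "'a::euclidean_space \<Rightarrow> real"
  assumes "integrable lborel f" "e > 0"
  shows "\<exists>h. continuous_on UNIV h \<and> integrable lborel h \<and>
    (\<integral>\<^sup>+x. ennreal \<bar>f x - h x\<bar> \<partial>lborel) < ennreal e"
  using assms
proof (induction arbitrary: e rule: integrable_induct)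
  case (base A c)
  obtain h where h: "continuous_on UNIV h" "integrable lborel h"
    "(\<integral>\<^sup>+x. ennreal \<bar>indicator A x - h x\<bar> \<partial>lborel) < ennreal (e / (\<bar>c\<bar> + 1))"
    using indicator_continuous_approx[OF base(1,2), of "e / (\<bar>c\<bar> + 1)"] base(3)
    by (metis abs_ge_zero add_nonneg_pos divide_pos_pos zero_less_one)
  have [measurable]: "h \<in> borel_measurable borel" "A \<in> sets borel" using h base by auto
  have "(\<integral>\<^sup>+x. ennreal \<bar>indicator A x *\<^sub>R c - c * h x\<bar> \<partial>lborel)
      = (\<integral>\<^sup>+x. ennreal \<bar>c\<bar> * ennreal \<bar>indicator A x - h x\<bar> \<partial>lborel)"
    by (intro nn_integral_cong) (simp add: ennreal_mult[symmetric] abs_mult[symmetric] algebra_simps)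
  also have "\<dots> = ennreal \<bar>c\<bar> * (\<integral>\<^sup>+x. ennreal \<bar>indicator A x - h x\<bar> \<partial>lborel)"
    by (rule nn_integral_cmult) auto
  also have "\<dots> \<le> ennreal \<bar>c\<bar> * ennreal (e / (\<bar>c\<bar> + 1))"
    using h(3) by (intro mult_left_mono) auto
  also have "\<dots> = ennreal (\<bar>c\<bar> * (e / (\<bar>c\<bar> + 1)))" using base(3) by (intro ennreal_mult'[symmetric]) auto
  also have "\<dots> < ennreal e"
    using base(3) by (intro ennreal_lessI) (auto simp: field_simps)
  finally show ?case using h(1,2)
    by (intro exI[of _ "\<lambda>x. c * h x"]) (auto intro!: continuous_intros)
next
  case (add f g)
  obtain h where h: "continuous_on UNIV h" "integrable lborel h"
    "(\<integral>\<^sup>+x. ennreal \<bar>f x - h x\<bar> \<partial>lborel) < ennreal (e/2)"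
    using add.IH(1)[of "e/2"] add.prems by auto
  obtain k where k: "continuous_on UNIV k" "integrable lborel k"
    "(\<integral>\<^sup>+x. ennreal \<bar>g x - k x\<bar> \<partial>lborel) < ennreal (e/2)"
    using add.IH(2)[of "e/2"] add.prems by auto
  have [measurable]: "h \<in> borel_measurable borel" "k \<in> borel_measurable borel"
    "f \<in> borel_measurable borel" "g \<in> borel_measurable borel"
    using h k add.hyps by auto
  have "(\<integral>\<^sup>+x. ennreal \<bar>(f x + g x) - (h x + k x)\<bar> \<partial>lborel)
     \<le> (\<integral>\<^sup>+x. ennreal \<bar>f x - h x\<bar> + ennreal \<bar>g x - k x\<bar> \<partial>lborel)"
    by (intro nn_integral_mono) (auto simp flip: ennreal_plus intro!: ennreal_leI)
  also have "\<dots> = (\<integral>\<^sup>+x. ennreal \<bar>f x - h x\<bar> \<partial>lborel) + (\<integral>\<^sup>+x. ennreal \<bar>g x - k x\<bar> \<partial>lborel)"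
    by (rule nn_integral_add) auto
  also have "\<dots> < ennreal (e/2) + ennreal (e/2)" by (intro add_strict_mono h k)
  also have "\<dots> = ennreal e" using add.prems by (simp flip: ennreal_plus)
  finally show ?case using h(1,2) k(1,2)
    by (intro exI[of _ "\<lambda>x. h x + k x"]) (auto intro!: continuous_intros)
next
  case (lim f s)
  have [measurable]: "f \<in> borel_measurable borel" "s i \<in> borel_measurable borel" for i
    using lim.hyps(1)[of i] lim.hyps(4) by auto
  have "(\<lambda>i. (\<integral>\<^sup>+x. norm (f x - s i x) \<partial>lborel)) \<longlonglongrightarrow> 0"
  proof (rule nn_integral_dominated_convergence_norm)
    show "(\<integral>\<^sup>+x. ennreal (2 * norm (f x)) \<partial>lborel) < \<infinity>"
      using lim.hyps(4) by (auto simp: integrable_iff_bounded ennreal_mult' nn_integral_cmult ennreal_mult_less_top)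
  qed (use lim.hyps in auto)
  then have "eventually (\<lambda>i. (\<integral>\<^sup>+x. norm (f x - s i x) \<partial>lborel) < ennreal (e/2)) sequentially"
    using lim.prems by (intro order_tendstoD) auto
  then obtain i where i: "(\<integral>\<^sup>+x. norm (f x - s i x) \<partial>lborel) < ennreal (e/2)"
    using eventually_happens by force
  obtain h where h: "continuous_on UNIV h" "integrable lborel h"
    "(\<integral>\<^sup>+x. ennreal \<bar>s i x - h x\<bar> \<partial>lborel) < ennreal (e/2)"
    using lim.IH[of "e/2" i] lim.prems by auto
  have [measurable]: "h \<in> borel_measurable borel" using h by auto
  have "(\<integral>\<^sup>+x. ennreal \<bar>f x - h x\<bar> \<partial>lborel)
     \<le> (\<integral>\<^sup>+x. ennreal (norm (f x - s i x)) + ennreal \<bar>s i x - h x\<bar> \<partial>lborel)"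
    by (intro nn_integral_mono) (auto simp flip: ennreal_plus intro!: ennreal_leI)
  also have "\<dots> = (\<integral>\<^sup>+x. norm (f x - s i x) \<partial>lborel) + (\<integral>\<^sup>+x. ennreal \<bar>s i x - h x\<bar> \<partial>lborel)"
    by (rule nn_integral_add) auto
  also have "\<dots> < ennreal (e/2) + ennreal (e/2)" by (intro add_strict_mono h i)
  also have "\<dots> = ennreal e" using lim.prems by (simp flip: ennreal_plus)
  finally show ?case using h(1,2) by blast
qed

definition dyadic_average :: "('a::euclidean_space \<Rightarrow> ennreal) \<Rightarrow> nat \<Rightarrow> 'a \<Rightarrow> ennreal" where
  "dyadic_average F k x =
     (\<integral>\<^sup>+y. F y * indicator (ball x ((1/2)^k)) y \<partial>lborel) / emeasure lborel (ball x ((1/2)^k))"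

text \<open>
  The radii \<open>(1/2)^k\<close> are at most \<open>1\<close>: for distant points the Sobolev function itself provides the
  bound, and within distance \<open>1\<close> of \<open>x\<close> both log-Hoelder conditions control the exponent in terms of
  \<open>x\<close>. They are countably many, so that the supremum is measurable.
\<close>
definition dyadic_maximal :: "('a::euclidean_space \<Rightarrow> ennreal) \<Rightarrow> 'a \<Rightarrow> ennreal" where
  "dyadic_maximal F x = (SUP k. dyadic_average F k x)"

abbreviation dyadic_oscillation :: "('a::euclidean_space \<Rightarrow> real) \<Rightarrow> nat \<Rightarrow> 'a \<Rightarrow> ennreal" where
  "dyadic_oscillation f k x \<equiv> dyadic_average (\<lambda>y. ennreal \<bar>f y - f x\<bar>) k x"

lemma emeasure_ball_pos_finite:
  fixes x :: "'a::euclidean_space"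
  assumes "r > 0"
  shows "emeasure lborel (ball x r) \<noteq> 0" "emeasure lborel (ball x r) \<noteq> \<infinity>"
proof -
  have "unit_ball_vol (real DIM('a)) > 0" by simp
  then show "emeasure lborel (ball x r) \<noteq> 0" "emeasure lborel (ball x r) \<noteq> \<infinity>"
    using assms by (simp_all add: emeasure_ball less_imp_neq[symmetric])
qed

lemma ball_in_borel [measurable]: "ball (x :: 'a::euclidean_space) r \<in> sets borel"
  by simp

lemma dyadic_average_measurable [measurable]:
  assumes [measurable]: "F \<in> borel_measurable borel"
  shows "dyadic_average F k \<in> borel_measurable borel"
proof -
  have e: "emeasure lborel (ball x ((1/2)^k)) = emeasure lborel (ball (0::'a) ((1/2)^k))" for x :: 'a
    by (simp add: emeasure_ball)
  have i: "indicator (ball x ((1/2)^k)) y = (indicator {p. dist (fst p) (snd p) < (1/2)^k} (x, y) :: ennreal)"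
    for x y :: 'a by (auto split: split_indicator)
  have [measurable]: "{p. dist (fst p) (snd p) < (1/2)^k} \<in> sets (borel \<Otimes>\<^sub>M lborel :: ('a \<times> 'a) measure)"
  proof -
    have "open {p :: 'a \<times> 'a. dist (fst p) (snd p) < (1/2)^k}"
      by (intro open_Collect_less continuous_intros)
    then have "{p :: 'a \<times> 'a. dist (fst p) (snd p) < (1/2)^k} \<in> sets borel" by simp
    also have "sets borel = sets (borel \<Otimes>\<^sub>M lborel :: ('a \<times> 'a) measure)"
      unfolding borel_prod[symmetric] by (intro sets_pair_measure_cong) auto
    finally show ?thesis .
  qed
  have "(\<lambda>x. (\<integral>\<^sup>+y. F y * indicator {p. dist (fst p) (snd p) < (1/2)^k} (x, y) \<partial>lborel)) \<in> borel_measurable borel"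
    by (rule lborel.borel_measurable_nn_integral) measurable
  then have "(\<lambda>x. (\<integral>\<^sup>+y. F y * indicator (ball x ((1/2)^k)) y \<partial>lborel)
      / emeasure lborel (ball (0::'a) ((1/2)^k))) \<in> borel_measurable borel"
    unfolding i by (rule borel_measurable_divide_ennreal) simp
  then show ?thesis unfolding dyadic_average_def[abs_def] by (subst e)
qed

lemma dyadic_maximal_measurable [measurable]:
  assumes [measurable]: "F \<in> borel_measurable borel"
  shows "dyadic_maximal F \<in> borel_measurable borel"
  unfolding dyadic_maximal_def[abs_def] by measurable

lemma dyadic_average_mono: "(\<And>y. F y \<le> G y) \<Longrightarrow> dyadic_average F k x \<le> dyadic_average G k x"
  unfolding dyadic_average_def
  by (intro divide_right_mono_ennreal nn_integral_mono mult_right_mono) auto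

lemma dyadic_average_add:
  assumes [measurable]: "F \<in> borel_measurable borel" "G \<in> borel_measurable borel"
  shows "dyadic_average (\<lambda>y. F y + G y) k x = dyadic_average F k x + dyadic_average G k x"
proof -
  have "(\<integral>\<^sup>+y. F y * indicator (ball x ((1/2)^k)) y + G y * indicator (ball x ((1/2)^k)) y \<partial>lborel)
    = (\<integral>\<^sup>+y. F y * indicator (ball x ((1/2)^k)) y \<partial>lborel) + (\<integral>\<^sup>+y. G y * indicator (ball x ((1/2)^k)) y \<partial>lborel)"
    by (rule nn_integral_add) measurable
  then show ?thesis
    unfolding dyadic_average_def distrib_right by (simp add: add_divide_distrib_ennreal)
qed

lemma dyadic_average_cmult:
  assumes [measurable]: "F \<in> borel_measurable borel"
  shows "dyadic_average (\<lambda>y. c * F y) k x = c * dyadic_average F k x"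
proof -
  have "(\<integral>\<^sup>+y. c * (F y * indicator (ball x ((1/2)^k)) y) \<partial>lborel)
    = c * (\<integral>\<^sup>+y. F y * indicator (ball x ((1/2)^k)) y \<partial>lborel)"
    by (rule nn_integral_cmult) measurable
  then show ?thesis
    unfolding dyadic_average_def mult.assoc by (simp add: ennreal_times_divide)
qed

lemma dyadic_average_const: "dyadic_average (\<lambda>y. c) k x = c"
  using emeasure_ball_pos_finite[of "(1/2)^k" x]
  by (simp add: dyadic_average_def nn_integral_cmult_indicator ennreal_mult_divide_eq)

lemma dyadic_average_le_maximal: "dyadic_average F k x \<le> dyadic_maximal F x"
  unfolding dyadic_maximal_def by (rule SUP_upper) simp

lemma dyadic_average_cong:
  assumes "\<And>y. y \<in> ball x 1 \<Longrightarrow> F y = G y"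
  shows "dyadic_average F k x = dyadic_average G k x"
proof -
  have "ball x ((1/2)^k) \<subseteq> ball x 1" by (intro subset_ball) (simp add: power_le_one)
  then show ?thesis unfolding dyadic_average_def
    using assms by (intro arg_cong2[where f="(/)"] nn_integral_cong refl) (auto split: split_indicator)
qed

text \<open>
  Each point of the level set is the centre of a ball on which the average of \<open>F\<close> exceeds \<open>t\<close>.
  Vitali's covering lemma selects disjoint balls whose fivefold enlargements still cover the set;
  the volumes of the selected balls add up to at most the integral of \<open>F\<close> over \<open>t\<close>.
\<close>
lemma dyadic_maximal_weak_type:
  fixes F :: "'a::euclidean_space \<Rightarrow> ennreal"
  assumes [measurable]: "F \<in> borel_measurable borel" and "t > 0"
  shows "emeasure lborel {x. ennreal t < dyadic_maximal F x} \<le> ennreal (5 ^ DIM('a) / t) * (\<integral>\<^sup>+y. F y \<partial>lborel)"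
proof -
  define E where "E = {x. ennreal t < dyadic_maximal F x}"
  have E [measurable]: "E \<in> sets borel" unfolding E_def by measurable
  have "\<forall>x\<in>E. \<exists>k. ennreal t < dyadic_average F k x"
    by (auto simp: E_def dyadic_maximal_def less_SUP_iff)
  then obtain K where K: "\<And>x. x \<in> E \<Longrightarrow> ennreal t < dyadic_average F (K x) x" by metis
  define r :: "'a \<Rightarrow> real" where "r x = (1/2) ^ K x" for x
  have r: "0 < r x" "r x \<le> 1" for x by (auto simp: r_def power_le_one)
  obtain C where C: "countable C" "C \<subseteq> E" "pairwise (\<lambda>i j. disjnt (ball i (r i)) (ball j (r j))) C"
     "E \<subseteq> (\<Union>i\<in>C. ball i (5 * r i))"
  proof (rule Vitali_covering_lemma_balls[of E "\<lambda>x. x" r E 1])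
    show "E \<subseteq> (\<Union>i\<in>E. ball i (r i))" using r(1) by auto
  qed (use r that in auto)
  let ?D = "density lborel F"
  have one: "emeasure lborel (ball i (5 * r i)) \<le> ennreal (5 ^ DIM('a) / t) * emeasure ?D (ball i (r i))"
    if "i \<in> C" for i
  proof -
    let ?v = "emeasure lborel (ball i (r i))"
    have v: "?v \<noteq> 0" "?v \<noteq> \<infinity>" using emeasure_ball_pos_finite[OF r(1)] by auto
    have "ennreal t * ?v \<le> (emeasure ?D (ball i (r i)) / ?v) * ?v"
      using K[of i] C(2) that
      by (intro mult_right_mono) (auto simp: dyadic_average_def emeasure_density r_def)
    also have "\<dots> = emeasure ?D (ball i (r i))"
      using v by (simp add: ennreal_divide_times ennreal_divide_self less_top)
    finally have a: "ennreal t * ?v \<le> emeasure ?D (ball i (r i))" .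
    have "emeasure lborel (ball i (5 * r i)) = ennreal (5 ^ DIM('a)) * ?v"
      using r(1)[of i] by (simp add: emeasure_ball power_mult_distrib ennreal_mult'[symmetric] mult_ac)
    also have "\<dots> = ennreal (5 ^ DIM('a) / t) * (ennreal t * ?v)"
      using \<open>t > 0\<close> by (simp add: mult.assoc[symmetric] ennreal_mult'[symmetric])
    also have "\<dots> \<le> ennreal (5 ^ DIM('a) / t) * emeasure ?D (ball i (r i))"
      using a by (intro mult_left_mono) auto
    finally show ?thesis .
  qed
  have "emeasure lborel E \<le> (\<integral>\<^sup>+x. (\<integral>\<^sup>+i. indicator (ball i (5 * r i)) x \<partial>count_space C) \<partial>lborel)"
  proof -
    have "emeasure lborel E = (\<integral>\<^sup>+x. indicator E x \<partial>lborel)" by simp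
    also have "\<dots> \<le> (\<integral>\<^sup>+x. (\<integral>\<^sup>+i. indicator (ball i (5 * r i)) x \<partial>count_space C) \<partial>lborel)"
    proof (rule nn_integral_mono)
      fix x
      show "(indicator E x :: ennreal) \<le> (\<integral>\<^sup>+i. indicator (ball i (5 * r i)) x \<partial>count_space C)"
      proof (cases "x \<in> E")
        case True
        then obtain i where i: "i \<in> C" "x \<in> ball i (5 * r i)" using C(4) by auto
        have "1 = (indicator (ball i (5 * r i)) x :: ennreal)" using i by simp
        also have "\<dots> \<le> (\<integral>\<^sup>+i. indicator (ball i (5 * r i)) x \<partial>count_space C)"
          using i(1) by (rule nn_integral_ge_point)
        finally show ?thesis using True by simp
      qed simp
    qed
    finally show ?thesis .
  qed
  also have "\<dots> = (\<integral>\<^sup>+i. (\<integral>\<^sup>+x. indicator (ball i (5 * r i)) x \<partial>lborel) \<partial>count_space C)"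
    by (rule nn_integral_count_space_nn_integral) (use C(1) in auto)
  also have "\<dots> = (\<integral>\<^sup>+i. emeasure lborel (ball i (5 * r i)) \<partial>count_space C)" by simp
  also have "\<dots> \<le> (\<integral>\<^sup>+i. ennreal (5 ^ DIM('a) / t) * emeasure ?D (ball i (r i)) \<partial>count_space C)"
    using one by (intro nn_integral_mono) auto
  also have "\<dots> = ennreal (5 ^ DIM('a) / t) * (\<integral>\<^sup>+i. emeasure ?D (ball i (r i)) \<partial>count_space C)"
    by (rule nn_integral_cmult) auto
  also have "(\<integral>\<^sup>+i. emeasure ?D (ball i (r i)) \<partial>count_space C) = emeasure ?D (\<Union>i\<in>C. ball i (r i))"
    using C(1,3) by (intro emeasure_UN_countable[symmetric])
      (auto simp: disjoint_family_on_def pairwise_def disjnt_def)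
  also have "\<dots> \<le> emeasure ?D UNIV" by (intro emeasure_mono) auto
  also have "\<dots> = (\<integral>\<^sup>+y. F y \<partial>lborel)" by (simp add: emeasure_density)
  finally show ?thesis unfolding E_def by (simp add: mult_left_mono)
qed

text \<open>
  The values of \<open>F\<close> up to \<open>t\<close> contribute at most \<open>t\<close> to any average, so only the larger values can
  push an average from \<open>t\<close> up to \<open>2 * t\<close>.
\<close>
lemma dyadic_maximal_weak_type_truncated:
  fixes F :: "'a::euclidean_space \<Rightarrow> ennreal"
  assumes [measurable]: "F \<in> borel_measurable borel" and "t > 0"
  shows "emeasure lborel {x. ennreal (2 * t) < dyadic_maximal F x} \<le>
    ennreal (5 ^ DIM('a) / t) * (\<integral>\<^sup>+y. F y * indicator {y. ennreal t < F y} y \<partial>lborel)"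
proof -
  define F1 where "F1 y = F y * indicator {y. ennreal t < F y} y" for y
  have [measurable]: "F1 \<in> borel_measurable borel" unfolding F1_def[abs_def] by measurable
  have "dyadic_average F k x \<le> dyadic_average F1 k x + ennreal t" for k x
  proof -
    have "dyadic_average F k x \<le> dyadic_average (\<lambda>y. F1 y + ennreal t) k x"
      by (intro dyadic_average_mono) (auto simp: F1_def split: split_indicator)
    then show ?thesis by (simp add: dyadic_average_add dyadic_average_const)
  qed
  then have "dyadic_average F k x \<le> dyadic_maximal F1 x + ennreal t" for k x
    using dyadic_average_le_maximal[of F1 k x] by (meson add_right_mono order_trans)
  then have le: "dyadic_maximal F x \<le> dyadic_maximal F1 x + ennreal t" for x
    unfolding dyadic_maximal_def[of F] by (intro SUP_least)
  have "{x. ennreal (2 * t) < dyadic_maximal F x} \<subseteq> {x. ennreal t < dyadic_maximal F1 x}"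
  proof safe
    fix x assume "ennreal (2 * t) < dyadic_maximal F x"
    then have "ennreal t + ennreal t < dyadic_maximal F1 x + ennreal t"
      using le[of x] \<open>t > 0\<close> by (simp flip: ennreal_plus) 
    then show "ennreal t < dyadic_maximal F1 x"
      by (metis add_right_mono leD leI)
  qed
  then have "emeasure lborel {x. ennreal (2 * t) < dyadic_maximal F x} \<le> emeasure lborel {x. ennreal t < dyadic_maximal F1 x}"
    by (intro emeasure_mono) auto
  also have "\<dots> \<le> ennreal (5 ^ DIM('a) / t) * (\<integral>\<^sup>+y. F1 y \<partial>lborel)"
    using \<open>t > 0\<close> by (intro dyadic_maximal_weak_type) auto
  finally show ?thesis by (simp add: F1_def)
qed

lemma ennreal_over_Suc_tendsto: "(\<lambda>n. ennreal (c / real (Suc n))) \<longlonglongrightarrow> 0"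
  using tendsto_ennrealI[OF lim_const_over_n[THEN LIMSEQ_Suc, of c]] by simp

lemma tendsto_0_if_ennreal_abs:
  assumes "((\<lambda>n. ennreal \<bar>X n\<bar>) \<longlongrightarrow> 0) F" shows "(X \<longlongrightarrow> 0) F"
proof -
  have "((\<lambda>n. \<bar>X n\<bar>) \<longlongrightarrow> 0) F"
    by (rule tendsto_ennrealD) (use assms in auto)
  then show ?thesis by (rule tendsto_rabs_zero_cancel)
qed

lemma nn_integral_powr_interval:
  assumes "c > 0" "t \<ge> 0"
  shows "(\<integral>\<^sup>+l. ennreal (c * l powr (c - 1)) * indicator {0<..<t} l \<partial>lborel) = ennreal (t powr c)"
proof -
  have "((\<lambda>l. c * l powr (c - 1)) has_integral c * (t powr (c - 1 + 1) / (c - 1 + 1))) {0..t}"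
    using assms by (intro has_integral_mult_right has_integral_powr_from_0) auto
  then have "((\<lambda>l. c * l powr (c - 1)) has_integral t powr c) {0..t}"
    using assms by simp
  then have "((\<lambda>l. c * l powr (c - 1)) has_integral t powr c) (box 0 t)"
    unfolding has_integral_open_interval by simp
  then show ?thesis
    using assms by (subst nn_integral_has_integral_lebesgue') (auto simp: box_real)
qed

text \<open>
  Marcinkiewicz interpolation: write the \<open>a\<close>-th power as an integral over the levels \<open>l\<close>, apply the
  truncated weak type bound at each level, and interchange the integrals again. The inner integral
  of \<open>l powr (a - 2)\<close> up to \<open>F y\<close> converges at \<open>0\<close> because \<open>a > 1\<close>.
\<close>
lemma dyadic_maximal_strong_type:
  fixes F :: "'a::euclidean_space \<Rightarrow> real"
  assumes [measurable]: "F \<in> borel_measurable borel" and pos: "\<And>y. F y \<ge> 0" and "a > 1"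
  shows "(\<integral>\<^sup>+x. ennreal ((enn2real (dyadic_maximal (\<lambda>y. ennreal (F y)) x) / 2) powr a) \<partial>lborel)
    \<le> ennreal (5 ^ DIM('a) * (a / (a - 1))) * (\<integral>\<^sup>+x. ennreal (F x powr a) \<partial>lborel)"
proof -
  define G where "G x = enn2real (dyadic_maximal (\<lambda>y. ennreal (F y)) x) / 2" for x
  define N where "N = (5::real) ^ DIM('a)"
  have N: "N > 0" by (simp add: N_def)
  have [measurable]: "G \<in> borel_measurable borel" unfolding G_def[abs_def] by measurable
  have G0: "G x \<ge> 0" for x by (simp add: G_def)
  let ?u = "\<lambda>l x. ennreal (a * l powr (a - 1)) * (if 0 < l \<and> l < G x then 1 else 0)"
  let ?v = "\<lambda>l y. ennreal (N * a * l powr (a - 2)) * ennreal (F y) * (if 0 < l \<and> l < F y then 1 else 0)"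
  let ?F = "\<lambda>l. \<integral>\<^sup>+y. ennreal (F y) * indicator {y. ennreal l < ennreal (F y)} y \<partial>lborel" and ?M = "dyadic_maximal (\<lambda>y. ennreal (F y))"
  have "(\<integral>\<^sup>+x. ennreal (G x powr a) \<partial>lborel) =
      (\<integral>\<^sup>+x. (\<integral>\<^sup>+l. ennreal (a * l powr (a - 1)) * indicator {0<..<G x} l \<partial>lborel) \<partial>lborel)"
    using \<open>a > 1\<close> G0 by (subst nn_integral_powr_interval) auto
  also have "\<dots> = (\<integral>\<^sup>+x. (\<integral>\<^sup>+l. ?u l x \<partial>lborel) \<partial>lborel)"
    by (intro nn_integral_cong) (auto split: split_indicator)
  also have "\<dots> = (\<integral>\<^sup>+l. (\<integral>\<^sup>+x. ?u l x \<partial>lborel) \<partial>lborel)"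
    by (rule lborel_pair.Fubini') measurable
  also have "\<dots> \<le> (\<integral>\<^sup>+l. (\<integral>\<^sup>+y. ?v l y \<partial>lborel) \<partial>lborel)"
  proof (rule nn_integral_mono)
    fix l :: real
    show "(\<integral>\<^sup>+x. ?u l x \<partial>lborel)
      \<le> (\<integral>\<^sup>+y. ?v l y \<partial>lborel)"
    proof (cases "l > 0")
      case True
      have "(\<integral>\<^sup>+x. ?u l x \<partial>lborel)
        = ennreal (a * l powr (a - 1)) * (\<integral>\<^sup>+x. indicator {x. l < G x} x \<partial>lborel)"
        using True by (subst nn_integral_cmult[symmetric]) (auto intro!: nn_integral_cong split: split_indicator)
      also have "(\<integral>\<^sup>+x. indicator {x. l < G x} x \<partial>lborel) = emeasure lborel {x. l < G x}" by simp
      also have "\<dots> \<le> emeasure lborel {x. ennreal (2 * l) < ?M x}"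
      proof (intro emeasure_mono subsetI)
        fix x assume "x \<in> {x. l < G x}"
        then have "2 * l < enn2real (?M x)" by (simp add: G_def)
        then have "ennreal (2 * l) < ?M x"
          using True by (cases "?M x") (auto simp: ennreal_lessI)
        then show "x \<in> {x. ennreal (2 * l) < ?M x}" by simp
      qed measurable
      also have "\<dots> \<le> ennreal (N / l) * ?F l"
        unfolding N_def using True by (intro dyadic_maximal_weak_type_truncated) auto
      also have "ennreal (a * l powr (a - 1)) * \<dots> = (ennreal (a * l powr (a - 1)) * ennreal (N / l)) * ?F l"
        by (simp add: mult.assoc)
      also have "ennreal (a * l powr (a - 1)) * ennreal (N / l) = ennreal (N * a * l powr (a - 2))"
      proof -
        have "l powr (a - 1) = l powr (a - 2) * l" using True powr_add[of l "a - 2" 1] by simp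
        then show ?thesis using True N \<open>a > 1\<close> by (simp add: ennreal_mult'[symmetric])
      qed
      also have "ennreal (N * a * l powr (a - 2)) * ?F l
        = (\<integral>\<^sup>+y. ?v l y \<partial>lborel)"
        using True pos by (subst nn_integral_cmult[symmetric])
          (auto intro!: nn_integral_cong split: split_indicator simp: ennreal_less_iff mult.assoc)
      finally show ?thesis by (simp add: mult_left_mono)
    qed simp
  qed
  also have "\<dots> = (\<integral>\<^sup>+y. (\<integral>\<^sup>+l. ?v l y \<partial>lborel) \<partial>lborel)"
    by (rule lborel_pair.Fubini'[symmetric]) measurable
  also have "\<dots> = (\<integral>\<^sup>+y. ennreal (N * (a / (a - 1))) * ennreal (F y powr a) \<partial>lborel)"
  proof (rule nn_integral_cong)
    fix y
    have "(\<integral>\<^sup>+l. ?v l y \<partial>lborel)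
      = (\<integral>\<^sup>+l. ennreal (N * (a / (a - 1)) * F y) * (ennreal ((a - 1) * l powr ((a - 1) - 1)) * indicator {0<..<F y} l) \<partial>lborel)"
    proof (rule nn_integral_cong)
      fix l :: real
      have "N * (a / (a - 1)) * F y * ((a - 1) * l powr ((a - 1) - 1)) = N * a * l powr (a - 2) * F y"
        using \<open>a > 1\<close> by simp
      then show "?v l y
        = ennreal (N * (a / (a - 1)) * F y) * (ennreal ((a - 1) * l powr ((a - 1) - 1)) * indicator {0<..<F y} l)"
        using \<open>a > 1\<close> N pos[of y] by (auto simp: ennreal_mult'[symmetric] ennreal_mult''[symmetric] split: split_indicator)
    qed
    also have "\<dots> = ennreal (N * (a / (a - 1)) * F y) * ennreal (F y powr (a - 1))"
    proof -
      have "(\<integral>\<^sup>+l. ennreal ((a - 1) * l powr ((a - 1) - 1)) * indicator {0<..<F y} l \<partial>lborel)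
        = ennreal (F y powr (a - 1))"
        using \<open>a > 1\<close> pos by (intro nn_integral_powr_interval) auto
      then show ?thesis by (subst nn_integral_cmult) auto
    qed
    also have "\<dots> = ennreal (N * (a / (a - 1)) * (F y * F y powr (a - 1)))"
      using \<open>a > 1\<close> N pos[of y] by (simp add: ennreal_mult'[symmetric] ennreal_mult''[symmetric] mult.assoc)
    also have "F y * F y powr (a - 1) = F y powr a"
      using pos[of y] powr_add[of "F y" 1 "a - 1"] by (cases "F y = 0") auto
    also have "ennreal (N * (a / (a - 1)) * F y powr a) = ennreal (N * (a / (a - 1))) * ennreal (F y powr a)"
      using \<open>a > 1\<close> N by (intro ennreal_mult') auto
    finally show "(\<integral>\<^sup>+l. ?v l y \<partial>lborel)
      = ennreal (N * (a / (a - 1))) * ennreal (F y powr a)" .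
  qed
  also have "\<dots> = ennreal (N * (a / (a - 1))) * (\<integral>\<^sup>+y. ennreal (F y powr a) \<partial>lborel)"
    by (rule nn_integral_cmult) measurable
  finally show ?thesis by (simp add: G_def N_def)
qed

text \<open>
  For \<open>t \<ge> 1\<close> the part of \<open>F\<close> above \<open>t\<close> is dominated by its \<open>a\<close>-th power, so the weak type bound
  makes the measure of the level sets vanish as \<open>t\<close> grows.
\<close>
lemma dyadic_maximal_finite_AE:
  fixes F :: "'a::euclidean_space \<Rightarrow> real"
  assumes [measurable]: "F \<in> borel_measurable borel" and pos: "\<And>y. F y \<ge> 0" and "a \<ge> 1"
    and fin: "(\<integral>\<^sup>+x. ennreal (F x powr a) \<partial>lborel) < \<infinity>"
  shows "AE x in lborel. dyadic_maximal (\<lambda>y. ennreal (F y)) x < \<infinity>"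
proof -
  let ?M = "dyadic_maximal (\<lambda>y. ennreal (F y))"
  define I where "I = enn2real (\<integral>\<^sup>+x. ennreal (F x powr a) \<partial>lborel)"
  have I: "(\<integral>\<^sup>+x. ennreal (F x powr a) \<partial>lborel) = ennreal I" "I \<ge> 0" using fin by (auto simp: I_def)
  have b: "emeasure lborel {x. ?M x = \<infinity>} \<le> ennreal (5 ^ DIM('a) * I / t)" if "t \<ge> 1" for t
  proof -
    have "emeasure lborel {x. ?M x = \<infinity>} \<le> emeasure lborel {x. ennreal (2 * t) < ?M x}"
      by (intro emeasure_mono) auto
    also have "\<dots> \<le> ennreal (5 ^ DIM('a) / t) * (\<integral>\<^sup>+y. ennreal (F y) * indicator {y. ennreal t < ennreal (F y)} y \<partial>lborel)"
      using that by (intro dyadic_maximal_weak_type_truncated) auto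
    also have "\<dots> \<le> ennreal (5 ^ DIM('a) / t) * (\<integral>\<^sup>+x. ennreal (F x powr a) \<partial>lborel)"
    proof (intro mult_left_mono nn_integral_mono)
      fix y
      show "ennreal (F y) * indicator {y. ennreal t < ennreal (F y)} y \<le> ennreal (F y powr a)"
      proof (cases "ennreal t < ennreal (F y)")
        case True
        then have "1 \<le> F y" using that pos[of y] by (simp add: ennreal_less_iff)
        then have "F y powr 1 \<le> F y powr a" using \<open>a \<ge> 1\<close> by (intro powr_mono) auto
        then show ?thesis using pos[of y] by (auto split: split_indicator intro: ennreal_leI)
      qed simp
    qed simp
    also have "\<dots> = ennreal (5 ^ DIM('a) * I / t)"
      using that I by (simp add: ennreal_mult'[symmetric])
    finally show ?thesis .
  qed
  have "emeasure lborel {x. ?M x = \<infinity>} \<le> 0"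
    using ennreal_over_Suc_tendsto by (rule LIMSEQ_le_const) (use b[of "real (Suc _)"] in auto)
  then have "{x. ?M x = \<infinity>} \<in> null_sets lborel" by (intro null_setsI) auto
  then show ?thesis by (rule AE_I') (auto simp: less_top[symmetric])
qed

text \<open>
  For a continuous function the oscillation tends to \<open>0\<close> everywhere. The error of a continuous
  approximation \<open>h\<close> is controlled, outside a set of small measure, by the maximal function of
  \<open>\<bar>f - h\<bar>\<close> and by \<open>\<bar>f - h\<bar>\<close> itself.
\<close>
lemma dyadic_lebesgue_points_integrable:
  fixes f :: "'a::euclidean_space \<Rightarrow> real"
  assumes int: "integrable lborel f"
  shows "AE x in lborel. (\<lambda>k. dyadic_oscillation f k x) \<longlonglongrightarrow> 0"
proof -
  have [measurable]: "f \<in> borel_measurable borel" using int by auto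
  let ?A = "\<lambda>x k. dyadic_oscillation f k x"
  have small: "AE x in lborel. eventually (\<lambda>k. ?A x k \<le> ennreal (3 * e)) sequentially" if epos: "e > 0" for e
  proof -
    have "\<forall>m. \<exists>h. continuous_on UNIV h \<and> integrable lborel h \<and>
      (\<integral>\<^sup>+x. ennreal \<bar>f x - h x\<bar> \<partial>lborel) < ennreal (1 / real (Suc m))"
      using integrable_continuous_approx[OF int] by (simp del: of_nat_Suc)
    then obtain h where h: "\<And>m. continuous_on UNIV (h m)" "\<And>m. integrable lborel (h m)"
      "\<And>m. (\<integral>\<^sup>+x. ennreal \<bar>f x - h m x\<bar> \<partial>lborel) < ennreal (1 / real (Suc m))" by metis
    have [measurable]: "h m \<in> borel_measurable borel" for m using h(2)[of m] by auto
    \<comment> \<open>Outside this set of small measure the oscillation of \<open>f\<close> is eventually that of \<open>h m\<close> up to \<open>2 * e\<close>.\<close>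
    define B where "B m = {x. ennreal e < dyadic_maximal (\<lambda>y. ennreal \<bar>f y - h m y\<bar>) x}
      \<union> {x. e \<le> \<bar>f x - h m x\<bar>}" for m
    have [measurable]: "B m \<in> sets borel" for m unfolding B_def by measurable
    define c where "c = 5 ^ DIM('a) / e + 1 / e"
    have c: "c \<ge> 0" using that by (simp add: c_def)
    have "emeasure lborel (B m) \<le> ennreal (c / real (Suc m))" for m
    proof -
      let ?I = "\<integral>\<^sup>+x. ennreal \<bar>f x - h m x\<bar> \<partial>lborel"
      have "emeasure lborel {x. e \<le> \<bar>f x - h m x\<bar>}
        = emeasure lborel ({x \<in> UNIV. 1 \<le> ennreal (1 / e) * ennreal \<bar>f x - h m x\<bar>})"
        using that by (intro arg_cong2[where f=emeasure] refl Collect_cong)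
          (auto simp: ennreal_mult'[symmetric] ennreal_le_iff[of _ 1] ennreal_1[symmetric] field_simps simp del: ennreal_1)
      also have "\<dots> \<le> ennreal (1 / e) * (\<integral>\<^sup>+x. ennreal \<bar>f x - h m x\<bar> * indicator UNIV x \<partial>lborel)"
        by (rule nn_integral_Markov_inequality) auto
      finally have 2: "emeasure lborel {x. e \<le> \<bar>f x - h m x\<bar>} \<le> ennreal (1 / e) * ?I" by simp
      have "emeasure lborel (B m) \<le> emeasure lborel {x. ennreal e < dyadic_maximal (\<lambda>y. ennreal \<bar>f y - h m y\<bar>) x}
        + emeasure lborel {x. e \<le> \<bar>f x - h m x\<bar>}"
        unfolding B_def by (intro emeasure_subadditive) auto
      also have "\<dots> \<le> ennreal (5 ^ DIM('a) / e) * ?I + ennreal (1 / e) * ?I"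
        using that by (intro add_mono 2 dyadic_maximal_weak_type) auto
      also have "\<dots> = ennreal c * ?I" using that by (simp add: c_def ennreal_plus distrib_right)
      also have "\<dots> \<le> ennreal c * ennreal (1 / real (Suc m))"
        using h(3)[of m] by (intro mult_left_mono) auto
      finally show ?thesis using c by (simp add: ennreal_mult'[symmetric])
    qed
    moreover have "emeasure lborel (\<Inter>m. B m) \<le> emeasure lborel (B m)" for m by (intro emeasure_mono) auto
    ultimately have le: "emeasure lborel (\<Inter>m. B m) \<le> ennreal (c / real (Suc m))" for m
      using order_trans by blast
    have "emeasure lborel (\<Inter>m. B m) \<le> 0"
      using ennreal_over_Suc_tendsto[of c] by (rule LIMSEQ_le_const) (use le in auto)
    then have null: "(\<Inter>m. B m) \<in> null_sets lborel" by (intro null_setsI) auto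
    show ?thesis
    proof (rule AE_I'[OF null], safe)
      fix x m assume neg: "\<not> eventually (\<lambda>k. ?A x k \<le> ennreal (3 * e)) sequentially"
      show "x \<in> B m"
      proof (rule ccontr)
        assume "x \<notin> B m"
        then have x: "dyadic_maximal (\<lambda>y. ennreal \<bar>f y - h m y\<bar>) x \<le> ennreal e" "\<bar>f x - h m x\<bar> \<le> e"
          by (auto simp: B_def)
        have "isCont (h m) x" using h(1)[of m] by (simp add: continuous_on_eq_continuous_at)
        then obtain d where d: "d > 0" "\<And>y. dist y x < d \<Longrightarrow> dist (h m y) (h m x) < e"
          using epos unfolding continuous_at_eps_delta by blast
        have "(\<lambda>k. (1/2::real)^k) \<longlonglongrightarrow> 0" by (intro LIMSEQ_realpow_zero) auto
        then have "eventually (\<lambda>k. (1/2::real)^k < d) sequentially" using d(1) by (rule order_tendstoD)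
        then have "eventually (\<lambda>k. ?A x k \<le> ennreal (3 * e)) sequentially"
        proof (rule eventually_mono)
          fix k assume k: "(1/2::real)^k < d"
          have "?A x k \<le> dyadic_average (\<lambda>y. ennreal \<bar>f y - h m y\<bar> + (ennreal \<bar>h m y - h m x\<bar> + ennreal e)) k x"
          proof (rule dyadic_average_mono)
            fix y
            have "\<bar>f y - f x\<bar> \<le> \<bar>f y - h m y\<bar> + (\<bar>h m y - h m x\<bar> + e)" using x(2) by linarith
            then show "ennreal \<bar>f y - f x\<bar> \<le> ennreal \<bar>f y - h m y\<bar> + (ennreal \<bar>h m y - h m x\<bar> + ennreal e)"
              using that by (simp flip: ennreal_plus add: ennreal_leI)
          qed
          also have "\<dots> = dyadic_average (\<lambda>y. ennreal \<bar>f y - h m y\<bar>) k x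
            + (dyadic_average (\<lambda>y. ennreal \<bar>h m y - h m x\<bar>) k x + ennreal e)"
            by (subst dyadic_average_add, measurable)+ (simp add: dyadic_average_const)
          also have "dyadic_average (\<lambda>y. ennreal \<bar>h m y - h m x\<bar>) k x \<le> ennreal e"
          proof -
            have "dyadic_average (\<lambda>y. ennreal \<bar>h m y - h m x\<bar>) k x \<le> dyadic_average (\<lambda>y. ennreal e) k x"
              unfolding dyadic_average_def
            proof (intro divide_right_mono_ennreal nn_integral_mono)
              fix y
              show "ennreal \<bar>h m y - h m x\<bar> * indicator (ball x ((1/2)^k)) y \<le> ennreal e * indicator (ball x ((1/2)^k)) y"
                using d(2)[of y] k by (auto split: split_indicator simp: dist_real_def dist_commute intro!: ennreal_leI)
            qed
            then show ?thesis by (simp add: dyadic_average_const)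
          qed
          also have "dyadic_average (\<lambda>y. ennreal \<bar>f y - h m y\<bar>) k x \<le> ennreal e"
            using dyadic_average_le_maximal x(1) by (rule order_trans)
          finally have "?A x k \<le> ennreal e + (ennreal e + ennreal e)" by (simp add: add_mono)
          also have "\<dots> = ennreal (3 * e)" using that by (simp flip: ennreal_plus)
          finally show "?A x k \<le> ennreal (3 * e)" .
        qed
        with neg show False by simp
      qed
    qed
  qed
  have "AE x in lborel. \<forall>j::nat. eventually (\<lambda>k. ?A x k \<le> ennreal (3 * (1 / real (Suc j)))) sequentially"
    unfolding AE_all_countable by (intro allI small) simp
  then show ?thesis
  proof (rule AE_mp[OF _ AE_I2], intro impI)
    fix x assume x: "\<forall>j::nat. eventually (\<lambda>k. ?A x k \<le> ennreal (3 * (1 / real (Suc j)))) sequentially"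
    show "?A x \<longlonglongrightarrow> 0"
    proof (rule order_tendstoI)
      fix u :: ennreal assume "0 < u"
      have "eventually (\<lambda>m. ennreal (3 / real (Suc m)) < u) sequentially"
        using ennreal_over_Suc_tendsto \<open>0 < u\<close> by (rule order_tendstoD)
      then obtain j where j: "ennreal (3 / real (Suc j)) < u"
        using eventually_happens by force
      have "eventually (\<lambda>k. ?A x k \<le> ennreal (3 * (1 / real (Suc j)))) sequentially" using x by blast
      then show "eventually (\<lambda>k. ?A x k < u) sequentially"
        by (rule eventually_mono) (use j in auto)
    qed simp
  qed
qed

text \<open>
  All balls in question have radius at most \<open>1\<close>, hence \<open>f\<close> may be cut off outside a large ball.
\<close>
lemma dyadic_lebesgue_points:
  fixes f :: "'a::euclidean_space \<Rightarrow> real"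
  assumes int: "\<And>R. integrable lborel (\<lambda>x. indicator (ball 0 R) x * f x)"
  shows "AE x in lborel. (\<lambda>k. dyadic_oscillation f k x) \<longlonglongrightarrow> 0"
proof -
  let ?f = "\<lambda>n x. indicator (ball 0 (real n)) x * f x"
  have "AE x in lborel. \<forall>n. (\<lambda>k. dyadic_average (\<lambda>y. ennreal \<bar>?f n y - ?f n x\<bar>) k x) \<longlonglongrightarrow> 0"
    unfolding AE_all_countable using dyadic_lebesgue_points_integrable[OF int] by blast
  then show ?thesis
  proof (rule AE_mp[OF _ AE_I2], intro impI)
    fix x assume x: "\<forall>n. (\<lambda>k. dyadic_average (\<lambda>y. ennreal \<bar>?f n y - ?f n x\<bar>) k x) \<longlonglongrightarrow> 0"
    obtain n where n: "norm x + 1 < real n" using reals_Archimedean2 by blast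
    have "dyadic_average (\<lambda>y. ennreal \<bar>?f n y - ?f n x\<bar>) k x = dyadic_oscillation f k x" for k
    proof (rule dyadic_average_cong)
      fix y assume "y \<in> ball x 1"
      then have "norm y < real n" "norm x < real n"
        using n norm_triangle_sub[of y x] by (auto simp: dist_norm norm_minus_commute)
      then show "ennreal \<bar>?f n y - ?f n x\<bar> = ennreal \<bar>f y - f x\<bar>" by simp
    qed
    then show "(\<lambda>k. dyadic_oscillation f k x) \<longlonglongrightarrow> 0"
      using x[rule_format, of n] by presburger
  qed
qed

lemma dyadic_maximal_cmult:
  assumes [measurable]: "F \<in> borel_measurable borel"
  shows "dyadic_maximal (\<lambda>y. c * F y) x = c * dyadic_maximal F x"
  unfolding dyadic_maximal_def dyadic_average_cmult[OF assms] by (rule SUP_mult_left_ennreal[symmetric])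

section \<open>The maximal function under a log-Hoelder continuous exponent\<close>

text \<open>
  The function \<open>phi p\<close> in terms of the reciprocal exponent \<open>s = 1 / p\<close>. The regularity assumption
  concerns \<open>1 / p\<close>, and the case \<open>p = \<infinity>\<close> becomes the ordinary real number \<open>s = 0\<close>.
\<close>
definition phi_recip :: "real \<Rightarrow> real \<Rightarrow> ennreal" where
  "phi_recip s t = (if s = 0 then (if t \<le> 1 then 0 else \<infinity>) else ennreal (t powr (1 / s)))"

lemma phi_eq_phi_recip:
  assumes "1 \<le> p" shows "phi p t = phi_recip (enn2real (1 / p)) t"
proof (cases p)
  case (real r)
  then have "r \<ge> 1" using assms by (simp flip: ennreal_1)
  moreover have "1 / p = ennreal (1 / r)"
    using real \<open>r \<ge> 1\<close> by (simp add: divide_ennreal[symmetric])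
  ultimately show ?thesis using real by (simp add: phi_def phi_recip_def)
qed (simp add: phi_def phi_recip_def)

lemma phi_recip_mono: "0 \<le> s \<Longrightarrow> 0 \<le> t \<Longrightarrow> t \<le> t' \<Longrightarrow> phi_recip s t \<le> phi_recip s t'"
  by (auto simp: phi_recip_def intro!: ennreal_leI powr_mono2)

lemma phi_recip_measurable [measurable (raw)]:
  assumes [measurable]: "s \<in> borel_measurable M" "f \<in> borel_measurable M"
  shows "(\<lambda>x. phi_recip (s x) (f x)) \<in> borel_measurable M"
  unfolding phi_recip_def by measurable

lemma phi_recip_divide_le:
  assumes "0 \<le> s" "s \<le> 1" "0 \<le> t" "1 \<le> c"
  shows "phi_recip s (t / c) \<le> ennreal (1 / c) * phi_recip s t"
proof (cases "s = 0")
  case True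
  then show ?thesis using assms
    by (cases "t \<le> 1") (auto simp: phi_recip_def ennreal_mult_top divide_le_eq)
next
  case False
  then have "1 \<le> 1 / s" using assms by simp
  then have "c powr 1 \<le> c powr (1 / s)" using assms by (intro powr_mono) auto
  then have "t powr (1 / s) / c powr (1 / s) \<le> t powr (1 / s) / c"
    using assms by (intro divide_left_mono) auto
  then have "(t / c) powr (1 / s) \<le> 1 / c * t powr (1 / s)"
    using assms by (simp add: powr_divide)
  then show ?thesis using False assms
    by (simp add: phi_recip_def ennreal_mult[symmetric] ennreal_leI)
qed

text \<open>
  If \<open>t\<close> exceeds \<open>l\<close>, then \<open>t / l \<le> (t / l) powr (1 / s)\<close> since \<open>1 / s \<ge> 1\<close>, and
  \<open>l powr (1 / s) \<ge> B\<close> by the choice of \<open>l\<close>. For \<open>s = 0\<close> the condition says \<open>l \<ge> 1\<close>, and values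
  above \<open>1\<close> have infinite modular.
\<close>
lemma phi_recip_level_bound:
  assumes "0 \<le> s" "s \<le> 1" "0 \<le> t" "0 < l" "0 < B" "B powr s \<le> l"
  shows "ennreal t \<le> ennreal l + ennreal (l / B) * phi_recip s t"
proof (cases "t \<le> l")
  case True
  then show ?thesis by (metis ennreal_leI add_increasing2 zero_le)
next
  case False
  show ?thesis
  proof (cases "s = 0")
    case True
    then show ?thesis using assms False by (simp add: phi_recip_def ennreal_mult_top)
  next
    case s: False
    then have s1: "1 \<le> 1 / s" using assms by simp
    have "(t / l) powr 1 \<le> (t / l) powr (1 / s)" using s1 False assms by (intro powr_mono) auto
    then have 1: "t \<le> l * (t powr (1 / s) / l powr (1 / s))"
      using assms False by (simp add: powr_divide field_simps)
    have "(B powr s) powr (1 / s) \<le> l powr (1 / s)" using assms by (intro powr_mono2) auto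
    then have "B \<le> l powr (1 / s)" using s assms by (simp add: powr_powr)
    then have "t powr (1 / s) / l powr (1 / s) \<le> t powr (1 / s) / B"
      using assms by (intro divide_left_mono) auto
    then have "t \<le> l * (t powr (1 / s) / B)" using 1 assms by (meson mult_left_mono order_trans less_imp_le)
    then have "ennreal t \<le> ennreal (l / B) * phi_recip s t"
      using s assms by (simp add: phi_recip_def ennreal_mult[symmetric] ennreal_leI)
    then show ?thesis by (simp add: add_increasing)
  qed
qed

text \<open>
  The average of the pointwise level bound, with one level \<open>l\<close> for the whole ball. This replaces
  Jensen's inequality, for which the exponent would have to be constant on the ball.
\<close>
lemma dyadic_average_le_of_modular:
  fixes F s :: "'a::euclidean_space \<Rightarrow> real"
  assumes [measurable]: "F \<in> borel_measurable borel" "s \<in> borel_measurable borel"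
    and F: "\<And>y. 0 \<le> F y" and s: "\<And>y. 0 \<le> s y" "\<And>y. s y \<le> 1"
    and A: "dyadic_average (\<lambda>y. phi_recip (s y) (F y)) k x \<le> ennreal B" and "0 < B" "0 < l"
    and l: "\<And>y. y \<in> ball x ((1/2)^k) \<Longrightarrow> B powr s y \<le> l"
  shows "dyadic_average (\<lambda>y. ennreal (F y)) k x \<le> ennreal (2 * l)"
proof -
  have "dyadic_average (\<lambda>y. ennreal (F y)) k x
    \<le> dyadic_average (\<lambda>y. ennreal l + ennreal (l / B) * phi_recip (s y) (F y)) k x"
    unfolding dyadic_average_def
  proof (intro divide_right_mono_ennreal nn_integral_mono)
    fix y
    show "ennreal (F y) * indicator (ball x ((1/2)^k)) y
      \<le> (ennreal l + ennreal (l / B) * phi_recip (s y) (F y)) * indicator (ball x ((1/2)^k)) y"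
      using phi_recip_level_bound[OF s F \<open>0 < l\<close> \<open>0 < B\<close> l[of y], of y] by (auto split: split_indicator)
  qed
  also have "\<dots> = ennreal l + ennreal (l / B) * dyadic_average (\<lambda>y. phi_recip (s y) (F y)) k x"
    by (subst dyadic_average_add, measurable, subst dyadic_average_cmult, measurable)
       (simp add: dyadic_average_const)
  also have "\<dots> \<le> ennreal l + ennreal (l / B) * ennreal B"
    using A by (intro add_left_mono mult_left_mono) auto
  also have "\<dots> = ennreal (2 * l)"
    using \<open>0 < B\<close> \<open>0 < l\<close> by (simp add: ennreal_mult[symmetric] flip: ennreal_plus)
  finally show ?thesis .
qed

text \<open>
  The exponent makes the function integrable, while polynomial decay keeps \<open>- ln (decay x)\<close>
  below a multiple of \<open>ln (exp 1 + norm x)\<close>.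
\<close>
definition decay :: "'a::euclidean_space \<Rightarrow> real" where
  "decay x = 1 / (1 + norm x) ^ (DIM('a) + 2)"

lemma decay_bounds: "0 < decay x" "decay x \<le> 1"
proof -
  have "1 + norm x > 0" by (simp add: add_pos_nonneg)
  then show "0 < decay x" by (simp add: decay_def)
  have "1 \<le> (1 + norm x) ^ (DIM('a) + 2)" by (rule one_le_power) simp
  then show "decay x \<le> 1" unfolding decay_def by (subst divide_le_eq_1) auto
qed

lemma decay_measurable [measurable]: "decay \<in> borel_measurable borel"
  unfolding decay_def[abs_def] by measurable

text \<open>
  Sum over the shells \<open>j \<le> norm x < j + 1\<close>: the volume of a ball of radius \<open>j + 1\<close> against the
  decay leaves the terms \<open>1 / (j + 1)^2\<close>.
\<close>
lemma decay_integrable: "(\<integral>\<^sup>+x. ennreal (decay x) \<partial>(lborel :: 'a::euclidean_space measure)) < \<infinity>"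
proof -
  define n where "n = DIM('a)"
  define w where "w = unit_ball_vol (real n)"
  have w: "w \<ge> 0" by (simp add: w_def)
  have "(\<integral>\<^sup>+x. ennreal (decay x) \<partial>(lborel :: 'a measure))
    \<le> (\<integral>\<^sup>+x. (\<Sum>j. ennreal (1 / (1 + real j) ^ (n + 2)) * indicator (ball 0 (1 + real j)) x) \<partial>(lborel :: 'a measure))"
  proof (rule nn_integral_mono)
    fix x :: 'a
    define j where "j = nat \<lfloor>norm x\<rfloor>"
    have j: "real j \<le> norm x" "norm x < 1 + real j" unfolding j_def by (simp, simp) linarith
    define f where "f j = ennreal (1 / (1 + real j) ^ (n + 2)) * indicator (ball 0 (1 + real j)) x" for j
    have "(1 + real j) ^ (n + 2) \<le> (1 + norm x) ^ (n + 2)" using j by (intro power_mono) auto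
    then have "decay x \<le> 1 / (1 + real j) ^ (n + 2)"
      unfolding decay_def n_def by (intro divide_left_mono) (auto simp: add_pos_nonneg)
    then have "ennreal (decay x) \<le> f j" using j by (auto simp: ennreal_leI f_def)
    also have "\<dots> = (\<Sum>i\<in>{j}. f i)" by simp
    also have "\<dots> \<le> (\<Sum>i. f i)" by (rule sum_le_suminf) auto
    finally show "ennreal (decay x) \<le> (\<Sum>j. ennreal (1 / (1 + real j) ^ (n + 2)) * indicator (ball 0 (1 + real j)) x)"
      unfolding f_def .
  qed
  also have "\<dots> = (\<Sum>j. \<integral>\<^sup>+x. ennreal (1 / (1 + real j) ^ (n + 2)) * indicator (ball 0 (1 + real j)) x \<partial>(lborel :: 'a measure))"
    by (rule nn_integral_suminf) measurable
  also have "\<dots> = (\<Sum>j. ennreal (w * (1 / (1 + real j) ^ 2)))"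
  proof (rule suminf_cong)
    fix j
    have "(\<integral>\<^sup>+x. ennreal (1 / (1 + real j) ^ (n + 2)) * indicator (ball 0 (1 + real j)) x \<partial>(lborel :: 'a measure))
      = ennreal (1 / (1 + real j) ^ (n + 2)) * ennreal (w * (1 + real j) ^ n)"
      by (subst nn_integral_cmult_indicator) (auto simp: emeasure_ball w_def n_def)
    also have "\<dots> = ennreal (w * (1 / (1 + real j) ^ 2))"
      using w by (simp add: ennreal_mult[symmetric] power_add power2_eq_square)
    finally show "(\<integral>\<^sup>+x. ennreal (1 / (1 + real j) ^ (n + 2)) * indicator (ball 0 (1 + real j)) x \<partial>(lborel :: 'a measure))
      = ennreal (w * (1 / (1 + real j) ^ 2))" .
  qed
  also have "\<dots> < \<infinity>"
  proof -
    have "summable (\<lambda>j. 1 / (1 + real j) ^ 2)"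
      using inverse_squares_sums[THEN sums_summable] by (simp add: add.commute)
    then have "summable (\<lambda>j. w * (1 / (1 + real j) ^ 2))" by (rule summable_mult)
    then show ?thesis using w by (subst suminf_ennreal2) auto
  qed
  finally show ?thesis .
qed

text \<open>
  The weight in the decay condition at infinity hardly changes over distances up to \<open>1\<close>.
\<close>
lemma log_holder_far:
  assumes "norm (x - y) \<le> 1"
  shows "ln (exp 1 + norm x) \<le> 2 * ln (exp 1 + norm y)"
proof -
  have e: "exp 1 \<ge> (2::real)" using exp_ge_add_one_self[of "1::real"] by simp
  have pos: "exp 1 + norm x > 0" "exp 1 + norm y > 0" by (simp_all add: add_pos_nonneg)
  have "norm x \<le> norm y + 1" using assms norm_triangle_sub[of x y] by linarith
  moreover have "exp 1 * exp 1 \<ge> (2::real) * exp 1" using e by (intro mult_right_mono) auto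
  moreover have "exp 1 * norm y \<ge> 2 * norm y" using e by (intro mult_right_mono) auto
  ultimately have "exp 1 + norm x \<le> exp 1 * exp 1 + 2 * (exp 1 * norm y) + norm y * norm y"
    using e by (smt (verit) norm_ge_zero mult_nonneg_nonneg)
  also have "\<dots> = (exp 1 + norm y) ^ 2" by (simp add: power2_eq_square algebra_simps)
  finally have "ln (exp 1 + norm x) \<le> ln ((exp 1 + norm y) ^ 2)"
    using pos by (subst ln_le_cancel_iff) auto
  then show ?thesis using pos by (simp add: ln_realpow)
qed

text \<open>
  The bound amounts to \<open>\<bar>ln B\<bar> * \<bar>\<alpha> y - \<alpha> x\<bar>\<close> being bounded. For \<open>B > 1\<close> the logarithm of \<open>B\<close> is at
  most a multiple of the logarithm of the inverse radius, which the local condition compensates; for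
  \<open>B \<le> 1\<close> it is at least that of \<open>decay x\<close>, which the decay condition at infinity compensates.
\<close>
lemma log_holder_powr_bound:
  fixes \<alpha> :: "'a::euclidean_space \<Rightarrow> real"
  assumes "globally_log_holder \<alpha>" "a > 0"
  shows "\<exists>C\<ge>1. \<forall>x k B. decay x \<le> B \<longrightarrow> B \<le> 2 + 1 / measure lborel (ball (0::'a) ((1/2)^k)) \<longrightarrow>
    (\<forall>y\<in>ball x ((1/2)^k). B powr (a * \<alpha> y) \<le> C * B powr (a * \<alpha> x))"
proof -
  obtain c1 c2 ai where c: "c1 > 0" "c2 > 0"
    "\<And>x y. \<bar>\<alpha> x - \<alpha> y\<bar> \<le> c1 / ln (exp 1 + 1 / norm (x - y))"
    "\<And>x. \<bar>\<alpha> x - ai\<bar> \<le> c2 / ln (exp 1 + norm x)"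
    using assms(1) unfolding globally_log_holder_def by blast
  define n where "n = DIM('a)"
  define w where "w = unit_ball_vol (real n)"
  have w: "w > 0" by (simp add: w_def)
  define L where "L = ln (2 + 1 / w)"
  have L: "L \<ge> 0" using w by (auto simp: L_def intro!: ln_ge_zero)
  define D where "D = a * (3 * real (n + 2) * c2 + c1 * (L + real n))"
  have D: "D \<ge> a * (3 * real (n + 2) * c2)" "D \<ge> a * (c1 * (L + real n))" "D \<ge> 0"
    using c(1,2) L assms(2) by (auto simp: D_def intro!: mult_left_mono mult_nonneg_nonneg add_nonneg_nonneg)
  have lne: "ln (exp 1 + t) \<ge> 1" if "t \<ge> 0" for t :: real
    using that by (subst ln_ge_iff) (auto simp: add_pos_nonneg)
  have "B powr (a * \<alpha> y) \<le> exp D * B powr (a * \<alpha> x)"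
    if B: "decay x \<le> B" "B \<le> 2 + 1 / measure lborel (ball (0::'a) ((1/2)^k))" and y: "y \<in> ball x ((1/2)^k)"
    for x y :: 'a and k B
  proof -
    define r where "r = (1/2::real)^k"
    have r: "r > 0" "r \<le> 1" by (auto simp: r_def power_le_one)
    have B0: "B > 0" using B(1) decay_bounds(1)[of x] by linarith
    have d: "norm (x - y) < r" using y by (simp add: r_def dist_norm)
    have "\<bar>ln B\<bar> * \<bar>\<alpha> y - \<alpha> x\<bar> * a \<le> D"
    proof (cases "B \<le> 1")
      case True
      have "ln (decay x) \<le> ln B" using B(1) decay_bounds(1)[of x] B0 by simp
      moreover have "ln (decay x) = - real (n + 2) * ln (1 + norm x)"
      proof -
        have "decay x = inverse ((1 + norm x) ^ (n + 2))" by (simp add: decay_def n_def inverse_eq_divide)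
        moreover have "1 + norm x > 0" by (simp add: add_pos_nonneg)
        ultimately show ?thesis by (simp only: ln_inverse zero_less_power ln_realpow mult_minus_left)
      qed
      moreover have "ln (1 + norm x) \<le> ln (exp 1 + norm x)"
        by (subst ln_le_cancel_iff) (auto simp: add_pos_nonneg)
      ultimately have "- ln B \<le> real (n + 2) * ln (exp 1 + norm x)"
        by (smt (verit) mult_left_mono of_nat_0_le_iff mult_minus_left)
      moreover have "ln B \<le> 0" using True B0 by simp
      ultimately have 1: "\<bar>ln B\<bar> \<le> real (n + 2) * ln (exp 1 + norm x)" by simp
      have "\<bar>\<alpha> y - \<alpha> x\<bar> \<le> c2 / ln (exp 1 + norm x) + c2 / ln (exp 1 + norm y)"
        using c(4)[of x] c(4)[of y] by linarith
      also have "c2 / ln (exp 1 + norm y) \<le> 2 * c2 / ln (exp 1 + norm x)"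
      proof -
        have "ln (exp 1 + norm x) \<le> 2 * ln (exp 1 + norm y)"
          using d r by (intro log_holder_far) auto
        then show ?thesis using c(2) lne[of "norm x"] lne[of "norm y"]
          by (simp add: divide_le_eq le_divide_eq field_simps)
      qed
      finally have 2: "\<bar>\<alpha> y - \<alpha> x\<bar> \<le> 3 * c2 / ln (exp 1 + norm x)"
        by (simp add: add_divide_distrib[symmetric])
      have "\<bar>ln B\<bar> * \<bar>\<alpha> y - \<alpha> x\<bar> \<le> (real (n + 2) * ln (exp 1 + norm x)) * (3 * c2 / ln (exp 1 + norm x))"
        using 1 2 lne[of "norm x"] by (intro mult_mono) auto
      also have "\<dots> = 3 * real (n + 2) * c2" using lne[of "norm x"] by simp
      finally have "\<bar>ln B\<bar> * \<bar>\<alpha> y - \<alpha> x\<bar> * a \<le> 3 * real (n + 2) * c2 * a"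
        using assms(2) by (intro mult_right_mono) auto
      then show ?thesis using D(1) by (simp add: mult_ac)
    next
      case False
      have m: "measure lborel (ball (0::'a) ((1/2)^k)) = w * r ^ n"
        using r by (simp add: r_def content_ball w_def n_def)
      have r1: "1 \<le> (1 / r) ^ n" using r by (intro one_le_power) auto
      have "2 + 1 / (w * r ^ n) = 2 + 1 / w * (1 / r) ^ n" by (simp add: power_divide)
      also have "\<dots> \<le> (2 + 1 / w) * (1 / r) ^ n" using r1 by (simp add: distrib_right)
      finally have "B \<le> (2 + 1 / w) * (1 / r) ^ n" using B(2) m by simp
      then have "ln B \<le> ln ((2 + 1 / w) * (1 / r) ^ n)"
        using B0 by (simp add: ln_le_cancel_iff[THEN iffD2] less_le_trans[OF B0])
      also have "\<dots> = L + real n * ln (1 / r)"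
        proof -
          have "2 + 1 / w > 0" using w by (simp add: add_pos_pos)
          then show ?thesis using r by (simp add: L_def ln_mult ln_realpow)
        qed
      also have "ln (1 / r) \<le> ln (exp 1 + 1 / r)" using r by (subst ln_le_cancel_iff) (auto simp: add_pos_pos)
      also have "L \<le> L * ln (exp 1 + 1 / r)" using L lne[of "1/r"] r by (simp add: mult_le_cancel_left1)
      finally have 1: "\<bar>ln B\<bar> \<le> (L + real n) * ln (exp 1 + 1 / r)"
        using False by (simp add: distrib_right mult_left_mono)
      have 2: "\<bar>\<alpha> y - \<alpha> x\<bar> \<le> c1 / ln (exp 1 + 1 / r)"
      proof (cases "x = y")
        case True
        then show ?thesis using c(1) lne[of "1/r"] r by simp
      next
        case False
        have "\<bar>\<alpha> y - \<alpha> x\<bar> \<le> c1 / ln (exp 1 + 1 / norm (x - y))" using c(3)[of x y] by linarith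
        also have "\<dots> \<le> c1 / ln (exp 1 + 1 / r)"
        proof (intro divide_left_mono)
          have "1 / r \<le> 1 / norm (x - y)" using d r False by (intro divide_left_mono) auto
          then show "ln (exp 1 + 1 / r) \<le> ln (exp 1 + 1 / norm (x - y))"
            using r by (subst ln_le_cancel_iff) (auto simp: add_pos_nonneg)
          show "0 < ln (exp 1 + 1 / norm (x - y)) * ln (exp 1 + 1 / r)"
            using lne[of "1/r"] lne[of "1 / norm (x - y)"] r by (intro mult_pos_pos) auto
        qed (use c in auto)
        finally show ?thesis .
      qed
      have "\<bar>ln B\<bar> * \<bar>\<alpha> y - \<alpha> x\<bar> \<le> ((L + real n) * ln (exp 1 + 1 / r)) * (c1 / ln (exp 1 + 1 / r))"
        using 1 2 lne[of "1/r"] L r by (intro mult_mono) auto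
      also have "\<dots> = c1 * (L + real n)" using lne[of "1/r"] r by simp
      finally have "\<bar>ln B\<bar> * \<bar>\<alpha> y - \<alpha> x\<bar> * a \<le> c1 * (L + real n) * a"
        using assms(2) by (intro mult_right_mono) auto
      then show ?thesis using D(2) by (simp add: mult_ac)
    qed
    moreover have "ln B * (\<alpha> y - \<alpha> x) \<le> \<bar>ln B\<bar> * \<bar>\<alpha> y - \<alpha> x\<bar>"
      by (metis abs_ge_self abs_mult)
    then have "ln B * (\<alpha> y - \<alpha> x) * a \<le> \<bar>ln B\<bar> * \<bar>\<alpha> y - \<alpha> x\<bar> * a"
      using assms(2) by (intro mult_right_mono) auto
    ultimately have "a * \<alpha> y * ln B \<le> D + a * \<alpha> x * ln B" by (simp add: algebra_simps)
    then show ?thesis using B0 by (simp add: powr_def flip: exp_add)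
  qed
  then show ?thesis using D(3) by (intro exI[of _ "exp D"]) auto
qed

lemma dyadic_average_cong_AE:
  assumes "AE y in lborel. F y = G y"
  shows "dyadic_average F k x = dyadic_average G k x"
  unfolding dyadic_average_def
  by (intro arg_cong2[where f="(/)"] refl nn_integral_cong_AE) (use assms in eventually_elim, simp)

lemma globally_log_holder_continuous:
  fixes \<alpha> :: "'a::euclidean_space \<Rightarrow> real"
  assumes "globally_log_holder \<alpha>"
  shows "continuous_on UNIV \<alpha>"
proof -
  obtain c1 where c: "c1 > 0" "\<And>x y. \<bar>\<alpha> x - \<alpha> y\<bar> \<le> c1 / ln (exp 1 + 1 / norm (x - y))"
    using assms unfolding globally_log_holder_def by blast
  show ?thesis
  proof (rule continuous_at_imp_continuous_on, intro ballI)
    fix x :: 'a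
    have "filterlim (\<lambda>r::real. exp 1 + inverse r) at_top (at_right 0)"
      by (intro filterlim_tendsto_add_at_top[OF tendsto_const] filterlim_inverse_at_top_right)
    then have "filterlim (\<lambda>r::real. ln (exp 1 + inverse r)) at_top (at_right 0)"
      by (rule filterlim_compose[OF ln_at_top])
    then have "((\<lambda>r::real. c1 / ln (exp 1 + 1 / r)) \<longlongrightarrow> 0) (at_right 0)"
      unfolding inverse_eq_divide
      by (intro tendsto_divide_0[OF tendsto_const] filterlim_at_top_imp_at_infinity)
    moreover have "filterlim (\<lambda>y. norm (y - x)) (at_right 0) (at x)"
      unfolding filterlim_at
      by (auto simp: eventually_at_filter intro!: tendsto_eq_intros)
    ultimately have "((\<lambda>y. c1 / ln (exp 1 + 1 / norm (y - x))) \<longlongrightarrow> 0) (at x)"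
      by (rule filterlim_compose)
    then have "((\<lambda>y. \<alpha> y - \<alpha> x) \<longlongrightarrow> 0) (at x)"
      by (rule Lim_null_comparison[rotated]) (use c(2) in auto)
    then show "isCont \<alpha> x" by (simp add: isCont_def LIM_zero_iff)
  qed
qed

text \<open>
  Passing from \<open>\<alpha>\<close> to \<open>a * \<alpha>\<close> leaves room for a power \<open>a > 1\<close>: the pointwise comparison of averages
  is made with the exponents \<open>1 / (a * \<alpha>)\<close>, and then the maximal theorem is applied in the
  ordinary space \<open>L^a\<close>.
\<close>
lemma dyadic_maximal_modular:
  fixes \<alpha> F :: "'a::euclidean_space \<Rightarrow> real"
  assumes log_holder: "globally_log_holder \<alpha>" and "a > 1"
    and \<alpha>: "\<And>y. 0 \<le> \<alpha> y" "\<And>y. a * \<alpha> y \<le> 1"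
    and [measurable]: "F \<in> borel_measurable borel" and F: "\<And>y. 0 \<le> F y"
    and modular: "(\<integral>\<^sup>+y. phi_recip (\<alpha> y) (F y) \<partial>lborel) \<le> 1"
  shows "AE x in lborel. dyadic_maximal (\<lambda>y. ennreal (F y)) x < \<infinity>"
    and "\<exists>c>0. (\<integral>\<^sup>+x. phi_recip (\<alpha> x) (enn2real (dyadic_maximal (\<lambda>y. ennreal (F y)) x) / c) \<partial>lborel) \<le> 1"
proof -
  let ?M = "dyadic_maximal (\<lambda>y. ennreal (F y))"
  have [measurable]: "\<alpha> \<in> borel_measurable borel"
    using globally_log_holder_continuous[OF log_holder] by (rule borel_measurable_continuous_onI)
  define \<Phi> where "\<Phi> y = phi_recip (a * \<alpha> y) (F y)" for y
  define \<Psi> where "\<Psi> y = enn2real (\<Phi> y)" for y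
  have [measurable]: "\<Phi> \<in> borel_measurable borel" unfolding \<Phi>_def[abs_def] by measurable
  have [measurable]: "\<Psi> \<in> borel_measurable borel" unfolding \<Psi>_def[abs_def] by measurable
  have \<Psi>0: "\<Psi> y \<ge> 0" for y by (simp add: \<Psi>_def)
  have powr: "ennreal (\<Psi> y powr a) \<le> phi_recip (\<alpha> y) (F y)" for y
    using \<open>a > 1\<close> \<alpha>(1)[of y] by (auto simp: \<Psi>_def \<Phi>_def phi_recip_def powr_powr)
  have I: "(\<integral>\<^sup>+y. ennreal (\<Psi> y powr a) \<partial>lborel) \<le> 1"
    by (rule order_trans[OF nn_integral_mono modular]) (rule powr)
  have "AE y in lborel. phi_recip (\<alpha> y) (F y) \<noteq> \<infinity>"
    using modular by (intro nn_integral_PInf_AE) (auto simp: top_unique)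
  then have \<Phi>\<Psi>: "AE y in lborel. \<Phi> y = ennreal (\<Psi> y)"
  proof eventually_elim
    case (elim y)
    then show ?case using \<open>a > 1\<close> by (auto simp: \<Phi>_def \<Psi>_def phi_recip_def split: if_splits)
  qed
  have fin: "AE x in lborel. dyadic_maximal (\<lambda>y. ennreal (\<Psi> y)) x < \<infinity>"
    using I \<open>a > 1\<close> \<Psi>0 by (intro dyadic_maximal_finite_AE[where a=a]) (auto intro: le_less_trans)
  obtain C where C: "C \<ge> 1" "\<And>x k B y. decay x \<le> B \<Longrightarrow> B \<le> 2 + 1 / measure lborel (ball (0::'a) ((1/2)^k)) \<Longrightarrow>
    y \<in> ball x ((1/2)^k) \<Longrightarrow> B powr (a * \<alpha> y) \<le> C * B powr (a * \<alpha> x)"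
    using log_holder_powr_bound[OF log_holder, of a] \<open>a > 1\<close> by force
  define m where "m x = enn2real (dyadic_maximal (\<lambda>y. ennreal (\<Psi> y)) x)" for x
  have [measurable]: "m \<in> borel_measurable borel" unfolding m_def[abs_def] by measurable
  have m0: "m x \<ge> 0" for x by (simp add: m_def)
  have mh: "m x + decay x > 0" for x using m0[of x] decay_bounds(1)[of x] by linarith
  \<comment> \<open>The pointwise comparison. The summand \<open>decay x\<close> bounds the base of the power from below.\<close>
  have bound: "?M x \<le> ennreal (2 * (C * (m x + decay x) powr (a * \<alpha> x)))"
    if "dyadic_maximal (\<lambda>y. ennreal (\<Psi> y)) x < \<infinity>" for x
    unfolding dyadic_maximal_def[of "\<lambda>y. ennreal (F y)"]
  proof (rule SUP_least)
    fix k
    let ?V = "emeasure lborel (ball x ((1/2)^k))"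
    define v where "v = measure lborel (ball (0::'a) ((1/2)^k))"
    have v: "?V = ennreal v" "v > 0"
      by (auto simp: emeasure_ball content_ball v_def)
    define A where "A = enn2real (dyadic_average (\<lambda>y. ennreal (\<Psi> y)) k x)"
    have Am: "dyadic_average (\<lambda>y. ennreal (\<Psi> y)) k x \<le> ennreal (m x)"
      using dyadic_average_le_maximal[of "\<lambda>y. ennreal (\<Psi> y)" k x] that by (simp add: m_def less_top)
    have A: "dyadic_average (\<lambda>y. ennreal (\<Psi> y)) k x = ennreal A"
      using Am by (metis A_def ennreal_enn2real ennreal_less_top le_less_trans)
    have A0: "A \<ge> 0" by (simp add: A_def)
    have "A \<le> m x" using Am A m0 by simp
    have "(\<integral>\<^sup>+y. ennreal (\<Psi> y) * indicator (ball x ((1/2)^k)) y \<partial>lborel)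
      \<le> (\<integral>\<^sup>+y. indicator (ball x ((1/2)^k)) y + ennreal (\<Psi> y powr a) \<partial>lborel)"
    proof (rule nn_integral_mono)
      fix y
      \<comment> \<open>This replaces Hoelder's inequality: the integral of \<open>\<Psi>\<close> over the ball is at most its volume plus \<open>1\<close>.\<close>
      have "\<Psi> y \<le> 1 + \<Psi> y powr a"
      proof (cases "\<Psi> y \<le> 1")
        case False
        then have "\<Psi> y powr 1 \<le> \<Psi> y powr a" using \<open>a > 1\<close> by (intro powr_mono) auto
        then show ?thesis using False by simp
      qed (simp add: add_increasing2)
      then have "ennreal (\<Psi> y) \<le> 1 + ennreal (\<Psi> y powr a)"
        by (metis ennreal_1 ennreal_leI ennreal_plus powr_ge_zero zero_le_one)
      then show "ennreal (\<Psi> y) * indicator (ball x ((1/2)^k)) y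
        \<le> indicator (ball x ((1/2)^k)) y + ennreal (\<Psi> y powr a)"
        by (auto split: split_indicator)
    qed
    also have "\<dots> = ?V + (\<integral>\<^sup>+y. ennreal (\<Psi> y powr a) \<partial>lborel)"
      by (subst nn_integral_add) auto
    also have "\<dots> \<le> ennreal v + ennreal 1" using I v by (intro add_mono) auto
    finally have "dyadic_average (\<lambda>y. ennreal (\<Psi> y)) k x \<le> (ennreal v + ennreal 1) / ennreal v"
      unfolding dyadic_average_def v(1) by (rule divide_right_mono_ennreal)
    also have "\<dots> = ennreal (1 + 1 / v)"
      using v(2) by (subst ennreal_plus[symmetric])
        (simp_all add: divide_ennreal add_divide_distrib del: ennreal_1 ennreal_plus)
    finally have A1: "A \<le> 1 + 1 / v" using A v(2) by (simp add: ennreal_le_iff del: ennreal_plus)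
    define B where "B = A + decay x"
    have B: "decay x \<le> B" "B \<le> 2 + 1 / v" "0 < B" "B \<le> m x + decay x"
      using A0 A1 \<open>A \<le> m x\<close> decay_bounds[of x] by (auto simp: B_def)
    have "dyadic_average (\<lambda>y. ennreal (F y)) k x \<le> ennreal (2 * (C * B powr (a * \<alpha> x)))"
    proof (rule dyadic_average_le_of_modular[where s="\<lambda>y. a * \<alpha> y" and B=B])
      have "dyadic_average (\<lambda>y. phi_recip (a * \<alpha> y) (F y)) k x = dyadic_average (\<lambda>y. ennreal (\<Psi> y)) k x"
        using \<Phi>\<Psi> unfolding \<Phi>_def by (rule dyadic_average_cong_AE)
      also have "\<dots> \<le> ennreal B" using A decay_bounds(1)[of x] by (simp add: B_def ennreal_leI)
      finally show "dyadic_average (\<lambda>y. phi_recip (a * \<alpha> y) (F y)) k x \<le> ennreal B" .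
      show "B powr (a * \<alpha> y) \<le> C * B powr (a * \<alpha> x)" if "y \<in> ball x ((1/2)^k)" for y
        using C(2)[OF B(1) _ that] B(2) by (simp add: v_def)
      show "0 < C * B powr (a * \<alpha> x)" using C(1) B(3) by simp
    qed (use F \<alpha> B \<open>a > 1\<close> in auto)
    also have "\<dots> \<le> ennreal (2 * (C * (m x + decay x) powr (a * \<alpha> x)))"
      using B(3,4) C(1) \<alpha>(1)[of x] \<open>a > 1\<close> by (intro ennreal_leI mult_left_mono powr_mono2) auto
    finally show "dyadic_average (\<lambda>y. ennreal (F y)) k x \<le> ennreal (2 * (C * (m x + decay x) powr (a * \<alpha> x)))" .
  qed
  show "AE x in lborel. ?M x < \<infinity>"
    using fin by eventually_elim (metis bound ennreal_less_top infinity_ennreal_def le_less_trans)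
  have pt: "phi_recip (\<alpha> x) (enn2real (?M x) / (2 * C)) \<le> ennreal (4 powr a) * ennreal ((m x / 2) powr a) + ennreal (2 powr a) * ennreal (decay x)"
    if f: "dyadic_maximal (\<lambda>y. ennreal (\<Psi> y)) x < \<infinity>" for x
  proof -
    let ?t = "enn2real (?M x) / (2 * C)"
    have "enn2real (?M x) \<le> 2 * (C * (m x + decay x) powr (a * \<alpha> x))"
      using bound[OF f] C(1) by (intro enn2real_leI) auto
    then have t: "?t \<le> (m x + decay x) powr (a * \<alpha> x)"
      using C(1) by (simp add: divide_le_eq mult_ac)
    have "phi_recip (\<alpha> x) ?t \<le> ennreal ((m x + decay x) powr a)"
    proof (cases "\<alpha> x = 0")
      case True
      then show ?thesis using t mh[of x] by (simp add: phi_recip_def)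
    next
      case False
      have "?t powr (1 / \<alpha> x) \<le> ((m x + decay x) powr (a * \<alpha> x)) powr (1 / \<alpha> x)"
        using t C(1) \<alpha>(1)[of x] by (intro powr_mono2) auto
      also have "\<dots> = (m x + decay x) powr a" using False by (simp add: powr_powr)
      finally show ?thesis using False by (simp add: phi_recip_def ennreal_leI)
    qed
    also have "(m x + decay x) powr a \<le> 4 powr a * (m x / 2) powr a + 2 powr a * decay x"
    proof -
      have "(m x + decay x) powr a \<le> (2 * max (m x) (decay x)) powr a"
        using mh[of x] \<open>a > 1\<close> by (intro powr_mono2) auto
      also have "\<dots> \<le> (2 * m x) powr a + (2 * decay x) powr a"
        by (simp add: max_def add_increasing add_increasing2)
      also have "(2 * m x) powr a = 4 powr a * (m x / 2) powr a"
        using powr_mult[of 4 "m x / 2" a] m0[of x] by simp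
      also have "(2 * decay x) powr a \<le> 2 powr a * decay x"
      proof -
        have "decay x powr a \<le> decay x powr 1"
          using decay_bounds[of x] \<open>a > 1\<close> by (intro powr_mono') auto
        then show ?thesis using decay_bounds[of x] by (simp add: powr_mult)
      qed
      finally show ?thesis by simp
    qed
    finally show ?thesis
      using decay_bounds(1)[of x] by (simp add: ennreal_mult[symmetric] flip: ennreal_plus) (metis ennreal_leI order_trans)
  qed
  define D where "D = (\<integral>\<^sup>+x. phi_recip (\<alpha> x) (enn2real (?M x) / (2 * C)) \<partial>lborel)"
  have "D \<le> (\<integral>\<^sup>+x. ennreal (4 powr a) * ennreal ((m x / 2) powr a) + ennreal (2 powr a) * ennreal (decay x) \<partial>lborel)"
    unfolding D_def by (rule nn_integral_mono_AE, rule AE_mp[OF fin], rule AE_I2) (use pt in blast)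
  also have "\<dots> = ennreal (4 powr a) * (\<integral>\<^sup>+x. ennreal ((m x / 2) powr a) \<partial>lborel)
    + ennreal (2 powr a) * (\<integral>\<^sup>+x. ennreal (decay x) \<partial>(lborel :: 'a measure))"
    by (subst nn_integral_add, measurable, subst nn_integral_cmult, measurable, subst nn_integral_cmult, measurable)
  also have "\<dots> < \<infinity>"
  proof -
    have "(\<integral>\<^sup>+x. ennreal ((m x / 2) powr a) \<partial>lborel)
      \<le> ennreal (5 ^ DIM('a) * (a / (a - 1))) * (\<integral>\<^sup>+y. ennreal (\<Psi> y powr a) \<partial>lborel)"
      unfolding m_def using \<Psi>0 \<open>a > 1\<close> by (intro dyadic_maximal_strong_type) auto
    also have "\<dots> < \<infinity>" using I by (auto simp: ennreal_mult_less_top intro: le_less_trans)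
    finally show ?thesis using decay_integrable[where 'a='a] by (auto simp: ennreal_mult_less_top)
  qed
  finally have Dfin: "D < \<infinity>" .
  \<comment> \<open>The modular of \<open>?M / (2 * C)\<close> is finite; dividing by \<open>K\<close> as well makes it at most \<open>1\<close>.\<close>
  define K where "K = max 1 (enn2real D)"
  have K: "K \<ge> 1" "D \<le> ennreal K"
  proof -
    have "D = ennreal (enn2real D)" using Dfin by simp
    also have "\<dots> \<le> ennreal K" by (intro ennreal_leI) (simp add: K_def)
    finally show "D \<le> ennreal K" .
  qed (simp add: K_def)
  have "(\<integral>\<^sup>+x. phi_recip (\<alpha> x) (enn2real (?M x) / (2 * C * K)) \<partial>lborel)
    \<le> (\<integral>\<^sup>+x. ennreal (1 / K) * phi_recip (\<alpha> x) (enn2real (?M x) / (2 * C)) \<partial>lborel)"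
  proof (rule nn_integral_mono)
    fix x
    have "\<alpha> x \<le> 1" using \<alpha>[of x] \<open>a > 1\<close> by (smt (verit) mult_le_cancel_right1)
    then show "phi_recip (\<alpha> x) (enn2real (?M x) / (2 * C * K)) \<le> ennreal (1 / K) * phi_recip (\<alpha> x) (enn2real (?M x) / (2 * C))"
      using phi_recip_divide_le[of "\<alpha> x" "enn2real (?M x) / (2 * C)" K] \<alpha>(1)[of x] K C(1) by simp
  qed
  also have "\<dots> = ennreal (1 / K) * D" unfolding D_def by (rule nn_integral_cmult) measurable
  also have "\<dots> \<le> ennreal (1 / K) * ennreal K" using K by (intro mult_left_mono) auto
  also have "\<dots> = 1" using K by (simp add: ennreal_mult[symmetric])
  finally show "\<exists>c>0. (\<integral>\<^sup>+x. phi_recip (\<alpha> x) (enn2real (?M x) / c) \<partial>lborel) \<le> 1"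
    using K C(1) by (intro exI[of _ "2 * C * K"]) auto
qed

section \<open>Mollification and the pointwise estimate\<close>

lemma integrable_local_mult:
  fixes h :: "'a::euclidean_space \<Rightarrow> 'b::euclidean_space" and u :: "'a \<Rightarrow> real"
  assumes h: "locally_integrable h" and u: "u \<in> borel_measurable lebesgue" "\<And>z. \<bar>u z\<bar> \<le> M"
    and supp: "\<And>z. z \<notin> cball w R \<Longrightarrow> u z = 0"
  shows "integrable lebesgue (\<lambda>z. u z *\<^sub>R h z)"
proof -
  have i: "integrable lebesgue (\<lambda>z. indicator (cball w R) z *\<^sub>R h z)"
    using h by (simp add: locally_integrable_def set_integrable_def)
  have e: "u z *\<^sub>R h z = u z *\<^sub>R (indicator (cball w R) z *\<^sub>R h z)" for z
    using supp[of z] by (auto split: split_indicator)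
  show ?thesis
  proof (rule Bochner_Integration.integrable_bound)
    show "integrable lebesgue (\<lambda>z. M *\<^sub>R (indicator (cball w R) z *\<^sub>R h z))"
      by (intro integrable_scaleR_right i)
    show "(\<lambda>z. u z *\<^sub>R h z) \<in> borel_measurable lebesgue"
      unfolding e by (intro borel_measurable_scaleR u borel_measurable_integrable[OF i])
    show "AE z in lebesgue. norm (u z *\<^sub>R h z) \<le> norm (M *\<^sub>R (indicator (cball w R) z *\<^sub>R h z))"
    proof (rule AE_I2)
      fix z
      have "\<bar>u z\<bar> \<le> \<bar>M\<bar>" using u(2)[of z] by linarith
      then show "norm (u z *\<^sub>R h z) \<le> norm (M *\<^sub>R (indicator (cball w R) z *\<^sub>R h z))"
        by (subst e) (auto intro: mult_right_mono split: split_indicator)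
    qed
  qed
qed

lemma locally_integrable_inner:
  fixes G :: "'a::euclidean_space \<Rightarrow> 'b::euclidean_space"
  assumes "locally_integrable G"
  shows "locally_integrable (\<lambda>z. G z \<bullet> b)"
  unfolding locally_integrable_def set_integrable_def
proof (intro allI impI)
  fix K :: "'a set" assume "compact K"
  then have "integrable lebesgue (\<lambda>z. indicator K z *\<^sub>R G z)"
    using assms by (simp add: locally_integrable_def set_integrable_def)
  then have "integrable lebesgue (\<lambda>z. (indicator K z *\<^sub>R G z) \<bullet> b)" by (rule integrable_inner_left)
  then show "integrable lebesgue (\<lambda>z. indicator K z *\<^sub>R (G z \<bullet> b))" by simp
qed

text \<open>
  The bump of mass \<open>1\<close> with support in \<open>[x - r, x + r]\<close>.
\<close>
definition bump1 :: "real \<Rightarrow> real \<Rightarrow> real \<Rightarrow> real" where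
  "bump1 x r t = bump ((t - x) / r) / r"

definition mollifier :: "'a::euclidean_space \<Rightarrow> real \<Rightarrow> 'a \<Rightarrow> real" where
  "mollifier x r z = (\<Prod>b\<in>Basis. bump1 (x \<bullet> b) r (z \<bullet> b))"

lemma C_k_bump1: "C_k k (bump1 x r)"
proof -
  have "C_k k (\<lambda>t::real. (1 / r) * bump ((1 / r) * (t \<bullet> 1) + (- x / r)))"
    by (intro C_k_mult C_k_const C_k_compose_affine C_k_bump)
  moreover have "(\<lambda>t. (1 / r) * bump ((1 / r) * (t \<bullet> 1) + (- x / r))) = bump1 x r"
    by (auto simp: bump1_def fun_eq_iff diff_divide_distrib)
  ultimately show ?thesis by (simp add: inner_real_def)
qed

lemma bump1_0: "r > 0 \<Longrightarrow> \<bar>t - x\<bar> > r \<Longrightarrow> bump1 x r t = 0"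
  by (simp add: bump1_def bump_0 abs_divide)

lemma C_k_smooth_step_affine: "C_k k (\<lambda>t. smooth_step ((t - x) / r))"
  using C_k_compose_affine[OF C_k_smooth_step, of k "1 / r" "1::real" "- x / r"]
  by (simp add: diff_divide_distrib)

lemma smooth_step_affine_deriv: "((\<lambda>t. smooth_step ((t - x) / r)) has_real_derivative bump1 x r t) (at t)"
proof -
  have "((\<lambda>t. (t - x) / r) has_real_derivative 1 / r) (at t)"
    by (cases "r = 0") (auto intro!: derivative_eq_intros)
  from DERIV_chain'[OF this smooth_step_deriv] show ?thesis by (simp add: bump1_def)
qed

lemma bump1_integral:
  assumes "r > 0"
  shows "integrable lborel (bump1 x r)" "(\<integral>t. bump1 x r t \<partial>lborel) = 1"
proof -
  have e: "(\<lambda>t. indicator {x - r..x + r} t *\<^sub>R bump1 x r t) = bump1 x r"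
    using bump1_0[OF assms, of _ x] by (force simp: fun_eq_iff indicator_def abs_le_iff)
  have "continuous_on {x - r..x + r} (bump1 x r)"
    using C_k_continuous[OF C_k_bump1] continuous_on_subset by blast
  moreover have "((\<lambda>t. smooth_step ((t - x) / r)) has_vector_derivative bump1 x r t) (at t within {x - r..x + r})" for t
    using smooth_step_affine_deriv has_real_derivative_iff_has_vector_derivative has_vector_derivative_at_within by blast
  ultimately have "has_bochner_integral lborel (\<lambda>t. indicator {x - r..x + r} t *\<^sub>R bump1 x r t)
      (smooth_step ((x + r - x) / r) - smooth_step ((x - r - x) / r))"
    using assms by (intro has_bochner_integral_FTC_Icc) auto
  then have "has_bochner_integral lborel (bump1 x r) 1"
    using assms unfolding e by (simp add: smooth_step_0 smooth_step_1)
  then show "integrable lborel (bump1 x r)" "(\<integral>t. bump1 x r t \<partial>lborel) = 1"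
    by (auto simp: has_bochner_integral_iff)
qed

lemma mollifier_measurable [measurable]: "mollifier x r \<in> borel_measurable borel"
proof -
  have [measurable]: "bump1 c r \<in> borel_measurable borel" for c
    using C_k_bump1 by (rule C_k_measurable)
  show ?thesis unfolding mollifier_def[abs_def] by measurable
qed

text \<open>
  Lebesgue measure is a product measure and each factor has integral \<open>1\<close>.
\<close>
lemma mollifier_integral:
  assumes "r > 0" shows "(\<integral>z. mollifier x r z \<partial>lebesgue) = 1"
proof -
  have [measurable]: "bump1 c r \<in> borel_measurable borel" for c
    using C_k_bump1 by (rule C_k_measurable)
  interpret product_sigma_finite "\<lambda>_::'a. lborel :: real measure" by standard
  have "(\<integral>z. mollifier x r z \<partial>lebesgue) = (\<integral>z. mollifier x r z \<partial>lborel)"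
    by (rule integral_completion) measurable
  also have "\<dots> = (\<integral>z. mollifier x r z \<partial>distr (\<Pi>\<^sub>M b\<in>Basis. lborel) borel (\<lambda>f. \<Sum>b\<in>Basis. f b *\<^sub>R b))"
    by (subst lborel_eq) (rule refl)
  also have "\<dots> = (\<integral>f. mollifier x r (\<Sum>b\<in>Basis. f b *\<^sub>R b) \<partial>(\<Pi>\<^sub>M b\<in>Basis. lborel))"
    by (subst integral_distr) measurable
  also have "\<dots> = (\<integral>f. (\<Prod>b\<in>Basis. bump1 (x \<bullet> b) r (f b)) \<partial>(\<Pi>\<^sub>M b\<in>Basis. lborel))"
    by (simp add: mollifier_def)
  also have "\<dots> = (\<Prod>b\<in>Basis. integral\<^sup>L lborel (bump1 (x \<bullet> b) r))"
    using bump1_integral(1)[OF assms] by (intro product_integral_prod) auto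
  also have "\<dots> = 1" using bump1_integral(2)[OF assms] by simp
  finally show ?thesis .
qed

lemma sup_norm_ball:
  fixes z w :: "'a::euclidean_space" and q R :: real
  assumes "\<And>b. b \<in> Basis \<Longrightarrow> \<bar>z \<bullet> b - w \<bullet> b\<bar> \<le> q" "q * DIM('a) < R"
  shows "z \<in> ball w R"
proof -
  have "norm (z - w) \<le> (\<Sum>b\<in>Basis. \<bar>(z - w) \<bullet> b\<bar>)" by (rule norm_le_l1)
  also have "\<dots> \<le> (\<Sum>b\<in>(Basis::'a set). q)" using assms(1) by (intro sum_mono) (simp add: inner_diff_left)
  also have "\<dots> < R" using assms(2) by (simp add: mult.commute)
  finally show ?thesis by (simp add: dist_norm norm_minus_commute)
qed

text \<open>
  Replace the one-dimensional factors of the first kernel by those of the second one after the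
  other. In the coordinate \<open>i\<close> that changes, the difference of the two bumps is the derivative of the
  difference \<open>\<theta>\<close> of two smooth steps, a function with compact support. So the difference of the
  products is the partial derivative in direction \<open>i\<close> of a test function \<open>u\<close>, and the integral of
  \<open>f\<close> against it is that of \<open>G \<bullet> i\<close> against \<open>- u\<close>. Since \<open>\<bar>\<theta>\<bar> \<le> 1\<close>, only the other
  \<open>DIM('a) - 1\<close> factors contribute a power of \<open>L / \<rho>\<close>. The lemma covers changes of scale and
  translations at the same time.
\<close>
lemma mollifier_difference:
  fixes f :: "'a::euclidean_space \<Rightarrow> real" and q R :: real
  assumes wg: "weak_gradient f G" and L: "L \<ge> 1" "\<And>t. \<bar>bump t\<bar> \<le> L"
    and \<rho>: "\<rho> > 0" "\<rho> \<le> r" "\<rho> \<le> r'"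
    and q: "\<And>b. b \<in> Basis \<Longrightarrow> \<bar>x \<bullet> b - w \<bullet> b\<bar> + r \<le> q" "\<And>b. b \<in> Basis \<Longrightarrow> \<bar>x' \<bullet> b - w \<bullet> b\<bar> + r' \<le> q"
    and R: "q * DIM('a) < R"
  shows "ennreal \<bar>(\<integral>z. f z * mollifier x' r' z \<partial>lebesgue) - (\<integral>z. f z * mollifier x r z \<partial>lebesgue)\<bar>
    \<le> ennreal (DIM('a) * (L / \<rho>) ^ (DIM('a) - 1)) * (\<integral>\<^sup>+z. ennreal (norm (G z)) * indicator (ball w R) z \<partial>lebesgue)"
proof -
  have r: "r > 0" "r' > 0" using \<rho> by auto
  define I where "I = (\<integral>\<^sup>+z. ennreal (norm (G z)) * indicator (ball w R) z \<partial>lebesgue)"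
  define N where "N = (L / \<rho>) ^ (DIM('a) - 1)"
  have N: "N \<ge> 0" using L \<rho> by (simp add: N_def)
  have lif: "locally_integrable f" and liG: "locally_integrable G" using wg by (auto simp: weak_gradient_def)
  define \<kappa> where "\<kappa> S b = (if b \<in> S then bump1 (x' \<bullet> b) r' else bump1 (x \<bullet> b) r)" for S and b :: 'a
  define J where "J S = (\<integral>z. f z * (\<Prod>b\<in>Basis. \<kappa> S b (z \<bullet> b)) \<partial>lebesgue)" for S
  have \<kappa>_smooth: "C_k k (\<kappa> S b)" for k S b by (simp add: \<kappa>_def C_k_bump1)
  have [measurable]: "\<kappa> S b \<in> borel_measurable borel" for S b
    using \<kappa>_smooth by (rule C_k_measurable)
  have \<kappa>_0: "\<kappa> S b t = 0" if "b \<in> Basis" "\<bar>t - w \<bullet> b\<bar> > q" for S b t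
    using that q[of b] r by (auto simp: \<kappa>_def intro!: bump1_0)
  have \<kappa>_le: "\<bar>\<kappa> S b t\<bar> \<le> L / \<rho>" for S b t
  proof -
    have "\<bar>bump1 c s t\<bar> \<le> L / \<rho>" if "\<rho> \<le> s" for c s
      unfolding bump1_def abs_divide using that \<rho> L by (intro frac_le) auto
    then show ?thesis using \<rho> by (simp add: \<kappa>_def)
  qed
  have \<kappa>_prod_0: "(\<Prod>b\<in>Basis. \<kappa> S b (z \<bullet> b)) = 0" if "z \<notin> cball w R" for S z
  proof (rule ccontr)
    assume "(\<Prod>b\<in>Basis. \<kappa> S b (z \<bullet> b)) \<noteq> 0"
    then have "\<And>b. b \<in> Basis \<Longrightarrow> \<bar>z \<bullet> b - w \<bullet> b\<bar> \<le> q" using \<kappa>_0 by (force simp: not_less[symmetric])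
    from sup_norm_ball[OF this R] that show False by auto
  qed
  have \<kappa>_int: "integrable lebesgue (\<lambda>z. f z * (\<Prod>b\<in>Basis. \<kappa> S b (z \<bullet> b)))" for S
  proof -
    have "\<bar>\<Prod>b\<in>Basis. \<kappa> S b (z \<bullet> b)\<bar> \<le> (\<Prod>b\<in>(Basis::'a set). L / \<rho>)" for z
      unfolding abs_prod by (intro prod_mono) (auto simp: \<kappa>_le)
    then have "integrable lebesgue (\<lambda>z. (\<Prod>b\<in>Basis. \<kappa> S b (z \<bullet> b)) *\<^sub>R f z)"
      by (intro integrable_local_mult[OF lif]) (use \<kappa>_prod_0 in \<open>auto intro!: measurable_completion\<close>)
    then show ?thesis by (simp add: mult.commute)
  qed
  have one: "ennreal \<bar>J (insert i S) - J S\<bar> \<le> ennreal N * I" if i: "i \<in> Basis" "i \<notin> S" for i S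
  proof -
    \<comment> \<open>The antiderivative of the difference of the two factors in coordinate \<open>i\<close>.\<close>
    define \<theta> where "\<theta> t = smooth_step ((t - x' \<bullet> i) / r') + (-1) * smooth_step ((t - x \<bullet> i) / r)" for t
    define \<mu> where "\<mu> = (\<kappa> S)(i := \<theta>)"
    define \<mu>' where "\<mu>' b t = (if b = i then bump1 (x' \<bullet> i) r' t - bump1 (x \<bullet> i) r t else frechet_derivative (\<mu> b) (at t) 1)" for b t
    have \<theta>_smooth: "C_k k \<theta>" for k
      unfolding \<theta>_def[abs_def] by (intro C_k_add C_k_mult C_k_const C_k_smooth_step_affine)
    have \<mu>_smooth: "C_k k (\<mu> b)" for k b by (simp add: \<mu>_def \<kappa>_smooth \<theta>_smooth)
    have [measurable]: "\<mu> b \<in> borel_measurable borel" for b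
      using \<mu>_smooth by (rule C_k_measurable)
    have \<mu>_deriv: "(\<mu> b has_real_derivative \<mu>' b t) (at t)" for b t
    proof (cases "b = i")
      case True
      have "(\<theta> has_real_derivative bump1 (x' \<bullet> i) r' t + (-1) * bump1 (x \<bullet> i) r t) (at t)"
        unfolding \<theta>_def[abs_def] by (intro DERIV_add DERIV_cmult smooth_step_affine_deriv)
      then show ?thesis using True by (simp add: \<mu>_def \<mu>'_def)
    next
      case False
      then show ?thesis using C_k_has_real_derivative[OF \<mu>_smooth] by (simp add: \<mu>'_def)
    qed
    have \<theta>_0: "\<theta> t = 0" if "\<bar>t - w \<bullet> i\<bar> > q" for t
    proof (cases "t > w \<bullet> i")
      case True
      then have "(t - x' \<bullet> i) / r' \<ge> 1" "(t - x \<bullet> i) / r \<ge> 1"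
        using that q(1,2)[OF i(1)] r by (auto simp: le_divide_eq)
      then show ?thesis by (simp add: \<theta>_def smooth_step_1)
    next
      case False
      then have "(t - x' \<bullet> i) / r' \<le> -1" "(t - x \<bullet> i) / r \<le> -1"
        using that q(1,2)[OF i(1)] r by (auto simp: divide_le_eq)
      then show ?thesis by (simp add: \<theta>_def smooth_step_0)
    qed
    have \<mu>_0: "\<mu> b t = 0" if "b \<in> Basis" "\<bar>t - w \<bullet> b\<bar> > q" for b t
      using that \<theta>_0 \<kappa>_0 by (cases "b = i") (auto simp: \<mu>_def)
    define u where "u z = (\<Prod>b\<in>Basis. \<mu> b (z \<bullet> b))" for z
    have [measurable]: "u \<in> borel_measurable borel" unfolding u_def[abs_def] by measurable
    have u_test: "test_function u"
      unfolding u_def[abs_def]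
    proof (rule test_function_prod[OF \<mu>_smooth])
      fix b :: 'a and t assume b: "b \<in> Basis" "\<bar>t\<bar> > norm w + q"
      then show "\<mu> b t = 0" using Basis_le_norm[of b w] by (intro \<mu>_0) auto
    qed
    have u_0: "u z = 0" if "z \<notin> ball w R" for z
    proof (rule ccontr)
      assume "u z \<noteq> 0"
      then have "\<And>b. b \<in> Basis \<Longrightarrow> \<bar>z \<bullet> b - w \<bullet> b\<bar> \<le> q" using \<mu>_0 by (force simp: u_def not_less[symmetric])
      from sup_norm_ball[OF this R] that show False by auto
    qed
    have u_le: "\<bar>u z\<bar> \<le> N" for z
    proof -
      have "u z = \<theta> (z \<bullet> i) * (\<Prod>b\<in>Basis - {i}. \<mu> b (z \<bullet> b))"
        unfolding u_def using i(1) by (subst prod.remove[of _ i]) (auto simp: \<mu>_def)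
      also have "\<bar>\<dots>\<bar> \<le> 1 * (\<Prod>b\<in>(Basis::'a set) - {i}. L / \<rho>)"
        unfolding abs_mult abs_prod
      proof (intro mult_mono prod_mono)
        show "\<bar>\<theta> (z \<bullet> i)\<bar> \<le> 1"
          using smooth_step_bounds[of "(z \<bullet> i - x' \<bullet> i) / r'"] smooth_step_bounds[of "(z \<bullet> i - x \<bullet> i) / r"]
          unfolding \<theta>_def by linarith
      qed (auto simp: \<mu>_def \<kappa>_le intro!: prod_nonneg)
      also have "\<dots> = N" using i(1) by (simp add: N_def card_Diff_singleton)
      finally show ?thesis .
    qed
    have key: "frechet_derivative u (at z) i = (\<Prod>b\<in>Basis. \<kappa> (insert i S) b (z \<bullet> b)) - (\<Prod>b\<in>Basis. \<kappa> S b (z \<bullet> b))" for z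
    proof -
      have "frechet_derivative u (at z) i = \<mu>' i (z \<bullet> i) * (\<Prod>b\<in>Basis - {i}. \<mu> b (z \<bullet> b))"
        unfolding u_def[abs_def] by (rule frechet_derivative_prod_coordinates[OF \<mu>_deriv i(1)])
      also have "(\<Prod>b\<in>Basis - {i}. \<mu> b (z \<bullet> b)) = (\<Prod>b\<in>Basis - {i}. \<kappa> S b (z \<bullet> b))"
        by (intro prod.cong) (auto simp: \<mu>_def)
      also have "\<mu>' i (z \<bullet> i) = \<kappa> (insert i S) i (z \<bullet> i) - \<kappa> S i (z \<bullet> i)"
        using i(2) by (simp add: \<mu>'_def \<kappa>_def)
      also have "\<dots> * (\<Prod>b\<in>Basis - {i}. \<kappa> S b (z \<bullet> b))
        = \<kappa> (insert i S) i (z \<bullet> i) * (\<Prod>b\<in>Basis - {i}. \<kappa> (insert i S) b (z \<bullet> b))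
          - \<kappa> S i (z \<bullet> i) * (\<Prod>b\<in>Basis - {i}. \<kappa> S b (z \<bullet> b))"
      proof -
        have "(\<Prod>b\<in>Basis - {i}. \<kappa> S b (z \<bullet> b)) = (\<Prod>b\<in>Basis - {i}. \<kappa> (insert i S) b (z \<bullet> b))"
          by (intro prod.cong) (auto simp: \<kappa>_def)
        then show ?thesis by (simp add: left_diff_distrib)
      qed
      finally show ?thesis by (simp only: prod.remove[OF finite_Basis i(1)])
    qed
    have "J (insert i S) - J S = (\<integral>z. f z * frechet_derivative u (at z) i \<partial>lebesgue)"
      unfolding J_def key right_diff_distrib
      by (subst Bochner_Integration.integral_diff[OF \<kappa>_int \<kappa>_int]) simp
    also have "\<dots> = - (\<integral>z. (G z \<bullet> i) * u z \<partial>lebesgue)"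
      using wg u_test i(1) by (auto simp: weak_gradient_def)
    finally have e: "\<bar>J (insert i S) - J S\<bar> = norm (\<integral>z. (G z \<bullet> i) * u z \<partial>lebesgue)" by simp
    have "integrable lebesgue (\<lambda>z. u z *\<^sub>R (G z \<bullet> i))"
      by (rule integrable_local_mult[OF locally_integrable_inner[OF liG], where M=N and w=w and R=R])
         (use u_le u_0 in \<open>auto intro!: measurable_completion\<close>)
    then have "integrable lebesgue (\<lambda>z. (G z \<bullet> i) * u z)" by (simp add: mult.commute)
    from integral_norm_bound_ennreal[OF this]
    have "ennreal \<bar>J (insert i S) - J S\<bar> \<le> (\<integral>\<^sup>+z. ennreal (norm ((G z \<bullet> i) * u z)) \<partial>lebesgue)"
      unfolding e .
    also have "\<dots> \<le> (\<integral>\<^sup>+z. ennreal N * (ennreal (norm (G z)) * indicator (ball w R) z) \<partial>lebesgue)"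
    proof (rule nn_integral_mono)
      fix z
      show "ennreal (norm ((G z \<bullet> i) * u z)) \<le> ennreal N * (ennreal (norm (G z)) * indicator (ball w R) z)"
      proof (cases "z \<in> ball w R")
        case True
        have "norm ((G z \<bullet> i) * u z) \<le> norm (G z) * N"
          unfolding real_norm_def abs_mult using u_le i(1) Basis_le_norm by (intro mult_mono) auto
        then show ?thesis using True N by (simp add: ennreal_mult[symmetric] mult.commute ennreal_leI)
      qed (simp add: u_0)
    qed
    also have "\<dots> = ennreal N * I"
    proof -
      have "integrable lebesgue (\<lambda>z. indicator (cball w R) z *\<^sub>R G z)"
        using liG by (simp add: locally_integrable_def set_integrable_def)
      then have [measurable]: "(\<lambda>z. indicator (cball w R) z *\<^sub>R G z) \<in> borel_measurable lebesgue" by auto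
      have [measurable]: "ball w R \<in> sets lebesgue" by simp
      have "(\<lambda>z. ennreal (norm (indicator (cball w R) z *\<^sub>R G z)) * indicator (ball w R) z) \<in> borel_measurable lebesgue"
        by measurable
      also have "(\<lambda>z. ennreal (norm (indicator (cball w R) z *\<^sub>R G z)) * indicator (ball w R) z)
          = (\<lambda>z. ennreal (norm (G z)) * indicator (ball w R) z)"
        by (auto split: split_indicator)
      finally show ?thesis unfolding I_def by (rule nn_integral_cmult)
    qed
    finally show ?thesis .
  qed
  have "ennreal \<bar>J S - J {}\<bar> \<le> ennreal (card S * N) * I" if "finite S" "S \<subseteq> Basis" for S
    using that
  proof (induction S)
    case (insert i S)
    have "ennreal \<bar>J (insert i S) - J {}\<bar> \<le> ennreal \<bar>J (insert i S) - J S\<bar> + ennreal \<bar>J S - J {}\<bar>"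
      by (simp flip: ennreal_plus add: ennreal_leI)
    also have "\<dots> \<le> ennreal N * I + ennreal (card S * N) * I"
      using insert by (intro add_mono one) auto
    also have "\<dots> = ennreal (card (insert i S) * N) * I"
    proof -
      have "real (card (insert i S)) * N = N + card S * N" using insert by (simp add: algebra_simps)
      then show ?thesis using N by (simp add: distrib_right)
    qed
    finally show ?case .
  qed simp
  from this[of Basis] have "ennreal \<bar>J Basis - J {}\<bar> \<le> ennreal (DIM('a) * N) * I" by simp
  moreover have "J Basis = (\<integral>z. f z * mollifier x' r' z \<partial>lebesgue)"
    unfolding J_def mollifier_def by (intro Bochner_Integration.integral_cong prod.cong arg_cong2[where f="(*)"] refl) (auto simp: \<kappa>_def)
  moreover have "J {} = (\<integral>z. f z * mollifier x r z \<partial>lebesgue)"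
    unfolding J_def mollifier_def by (intro Bochner_Integration.integral_cong prod.cong arg_cong2[where f="(*)"] refl) (auto simp: \<kappa>_def)
  ultimately show ?thesis by (simp add: N_def I_def)
qed

lemma nn_integral_ball_eq_average:
  "(\<integral>\<^sup>+z. F z * indicator (ball x ((1/2)^k)) z \<partial>lborel)
    = dyadic_average F k x * emeasure lborel (ball x ((1/2)^k))"
  using emeasure_ball_pos_finite[of "(1/2)^k" x]
  by (simp add: dyadic_average_def ennreal_divide_times ennreal_divide_self less_top)

lemma mollifier_le:
  assumes "L \<ge> 1" "\<And>t. \<bar>bump t\<bar> \<le> L" "r > 0"
  shows "\<bar>mollifier (x :: 'a::euclidean_space) r z\<bar> \<le> (L / r) ^ DIM('a)"
proof -
  have "\<bar>mollifier x r z\<bar> \<le> (\<Prod>b\<in>(Basis::'a set). L / r)"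
    unfolding mollifier_def abs_prod bump1_def abs_divide
    using assms by (intro prod_mono conjI frac_le) auto
  then show ?thesis by simp
qed

lemma mollifier_0:
  fixes x z :: "'a::euclidean_space" and r R :: real
  assumes "r > 0" "r * DIM('a) < R" "z \<notin> ball x R"
  shows "mollifier x r z = 0"
proof (rule ccontr)
  assume "mollifier x r z \<noteq> 0"
  then have "\<And>b. b \<in> Basis \<Longrightarrow> \<bar>z \<bullet> b - x \<bullet> b\<bar> \<le> r"
    using bump1_0[OF assms(1)] by (force simp: mollifier_def not_less[symmetric])
  from sup_norm_ball[OF this assms(2)] assms(3) show False by simp
qed

text \<open>
  The kernel has mass \<open>1\<close>, and it is bounded by a multiple of the inverse volume of the ball of
  radius \<open>(1/2)^k\<close>, so the error is at most a multiple of the oscillation of \<open>f\<close>.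
\<close>
lemma mollifier_tendsto:
  fixes f :: "'a::euclidean_space \<Rightarrow> real" and \<delta> :: real
  assumes li: "locally_integrable f" and [measurable]: "f \<in> borel_measurable borel"
    and \<delta>: "\<delta> > 0" "\<delta> * DIM('a) < 1"
    and x: "(\<lambda>k. dyadic_oscillation f k x) \<longlonglongrightarrow> 0"
  shows "(\<lambda>k. \<integral>z. f z * mollifier x (\<delta> * (1/2)^k) z \<partial>lebesgue) \<longlonglongrightarrow> f x"
proof -
  obtain L where L: "L \<ge> 1" "\<And>t. \<bar>bump t\<bar> \<le> L" using bump_bounded by blast
  define w where "w = unit_ball_vol (real DIM('a))"
  have w: "w \<ge> 0" by (simp add: w_def)
  define c where "c = (L / \<delta>) ^ DIM('a) * w"
  have c: "c \<ge> 0" using L \<delta> w by (simp add: c_def)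
  let ?A = "\<lambda>k. dyadic_oscillation f k x"
  let ?I = "\<lambda>k. \<integral>z. f z * mollifier x (\<delta> * (1/2)^k) z \<partial>lebesgue"
  have le: "ennreal \<bar>?I k - f x\<bar> \<le> ennreal c * ?A k" for k
  proof -
    define r where "r = \<delta> * (1/2)^k"
    define h where "h = (1/2::real)^k"
    have h: "h > 0" "r = \<delta> * h" by (auto simp: h_def r_def)
    have r: "r > 0" "r * DIM('a) < h" using \<delta> h by (auto simp: mult.commute mult.left_commute)
    note le = mollifier_le[OF L r(1), of x] and zero = mollifier_0[OF r, of _ x]
    have "integrable lebesgue (\<lambda>z. mollifier x r z *\<^sub>R f z)"
      by (rule integrable_local_mult[OF li, where M="(L / r) ^ DIM('a)" and w=x and R=h])
         (use le zero in \<open>auto intro!: measurable_completion\<close>)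
    then have i1: "integrable lebesgue (\<lambda>z. f z * mollifier x r z)" by (simp add: mult.commute)
    have i2: "integrable lebesgue (mollifier x r)"
      using mollifier_integral[OF r(1), of x] not_integrable_integral_eq by fastforce
    have "?I k - f x = (\<integral>z. f z * mollifier x r z \<partial>lebesgue) - (\<integral>z. f x * mollifier x r z \<partial>lebesgue)"
      using mollifier_integral[OF r(1), of x] by (simp add: r_def)
    also have "\<dots> = (\<integral>z. f z * mollifier x r z - f x * mollifier x r z \<partial>lebesgue)"
      using i1 i2 by (intro Bochner_Integration.integral_diff[symmetric]) auto
    finally have "ennreal \<bar>?I k - f x\<bar> = ennreal (norm (\<integral>z. f z * mollifier x r z - f x * mollifier x r z \<partial>lebesgue))"
      by simp
    also have "\<dots> \<le> (\<integral>\<^sup>+z. ennreal (norm (f z * mollifier x r z - f x * mollifier x r z)) \<partial>lebesgue)"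
      using i1 i2 by (intro integral_norm_bound_ennreal) auto
    also have "\<dots> = (\<integral>\<^sup>+z. ennreal (norm (f z * mollifier x r z - f x * mollifier x r z)) \<partial>lborel)"
      by (rule nn_integral_completion)
    also have "\<dots> \<le> (\<integral>\<^sup>+z. ennreal ((L / r) ^ DIM('a)) * (ennreal \<bar>f z - f x\<bar> * indicator (ball x h) z) \<partial>lborel)"
    proof (rule nn_integral_mono)
      fix z
      show "ennreal (norm (f z * mollifier x r z - f x * mollifier x r z))
        \<le> ennreal ((L / r) ^ DIM('a)) * (ennreal \<bar>f z - f x\<bar> * indicator (ball x h) z)"
      proof (cases "z \<in> ball x h")
        case True
        have "norm (f z * mollifier x r z - f x * mollifier x r z) = \<bar>mollifier x r z\<bar> * \<bar>f z - f x\<bar>"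
          by (simp add: left_diff_distrib[symmetric] abs_mult)
        also have "\<dots> \<le> (L / r) ^ DIM('a) * \<bar>f z - f x\<bar>" by (intro mult_right_mono le) auto
        finally show ?thesis using True L r by (simp add: ennreal_mult[symmetric] ennreal_leI)
      qed (simp add: zero)
    qed
    also have "\<dots> = ennreal ((L / r) ^ DIM('a)) * (\<integral>\<^sup>+z. ennreal \<bar>f z - f x\<bar> * indicator (ball x h) z \<partial>lborel)"
      by (rule nn_integral_cmult) measurable
    also have "(\<integral>\<^sup>+z. ennreal \<bar>f z - f x\<bar> * indicator (ball x h) z \<partial>lborel) = emeasure lborel (ball x h) * ?A k"
      unfolding h_def by (subst mult.commute) (rule nn_integral_ball_eq_average)
    also have "ennreal ((L / r) ^ DIM('a)) * (emeasure lborel (ball x h) * ?A k) = ennreal c * ?A k"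
    proof -
      have "(L / r) ^ DIM('a) * (w * h ^ DIM('a)) = c"
        using h \<delta> by (simp add: c_def power_divide power_mult_distrib)
      then have "ennreal ((L / r) ^ DIM('a)) * emeasure lborel (ball x h) = ennreal c"
        using h(1) L r by (simp add: emeasure_ball ennreal_mult'[symmetric] w_def)
      then show ?thesis by (simp add: mult.assoc[symmetric])
    qed
    finally show ?thesis .
  qed
  have "(\<lambda>k. ennreal c * ?A k) \<longlonglongrightarrow> ennreal c * 0"
    by (rule ennreal_tendsto_cmult[OF _ x]) simp
  then have "(\<lambda>k. ennreal c * ?A k) \<longlonglongrightarrow> 0" by simp
  then have "(\<lambda>k. ennreal \<bar>?I k - f x\<bar>) \<longlonglongrightarrow> 0"
    by (rule tendsto_sandwich[OF _ _ tendsto_const, rotated 2]) (use le in auto)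
  then have "(\<lambda>k. ?I k - f x) \<longlonglongrightarrow> 0" by (rule tendsto_0_if_ennreal_abs)
  then show ?thesis by (rule LIM_zero_cancel)
qed

text \<open>
  At a Lebesgue point \<open>x\<close>, the mollifications at the scales \<open>\<delta> * (1/2)^k\<close> converge to \<open>f x\<close>. Each
  halving changes them by at most \<open>C1 * (1/2)^k\<close> times the maximal function, so the total change is
  a geometric series. Two points at a distance comparable to the scale have mollifications that
  differ by the same amount.
\<close>
lemma weak_gradient_pointwise_estimate:
  fixes f F :: "'a::euclidean_space \<Rightarrow> real"
  assumes wg: "weak_gradient f G" and [measurable]: "f \<in> borel_measurable borel" "F \<in> borel_measurable borel"
    and F: "AE x in lborel. norm (G x) = F x"
    and fin: "AE x in lborel. dyadic_maximal (\<lambda>y. ennreal (F y)) x < \<infinity>"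
  shows "\<exists>C>0. \<exists>S\<in>null_sets lborel. \<forall>x y. x \<notin> S \<longrightarrow> y \<notin> S \<longrightarrow>
    \<bar>f x - f y\<bar> \<le> norm (x - y) *
      (C * (enn2real (dyadic_maximal (\<lambda>y. ennreal (F y)) x) + \<bar>f x\<bar>) +
       C * (enn2real (dyadic_maximal (\<lambda>y. ennreal (F y)) y) + \<bar>f y\<bar>))"
proof -
  have li: "locally_integrable f" using wg by (simp add: weak_gradient_def)
  obtain L where L: "L \<ge> 1" "\<And>t. \<bar>bump t\<bar> \<le> L" using bump_bounded by blast
  let ?MF = "dyadic_maximal (\<lambda>y. ennreal (F y))"
  define M where "M x = enn2real (?MF x)" for x
  have M0: "M x \<ge> 0" for x by (simp add: M_def)
  define n where "n = DIM('a)"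
  have n: "n \<ge> 1" by (simp add: n_def)
  define w where "w = unit_ball_vol (real n)"
  have w: "w > 0" by (simp add: w_def)
  \<comment> \<open>Kernels of scale up to \<open>2 * \<delta> * h\<close> have their support well inside the ball of radius \<open>h\<close>.\<close>
  define \<delta> where "\<delta> = 1 / (4 * real n)"
  have \<delta>: "\<delta> > 0" "\<delta> * real n = 1/4" using n by (auto simp: \<delta>_def)
  define I where "I x k = (\<integral>z. f z * mollifier x (\<delta> * (1/2)^k) z \<partial>lebesgue)" for x k
  define C1 where "C1 = real n * (2 * L / \<delta>) ^ (n - 1) * w"
  have C1: "C1 > 0" using n L \<delta> w by (simp add: C1_def)
  have mass: "(\<integral>\<^sup>+z. ennreal (norm (G z)) * indicator (ball x ((1/2)^k)) z \<partial>lebesgue) \<le> ennreal (M x * (w * ((1/2)^k) ^ n))"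
    if "?MF x < \<infinity>" for x k
  proof -
    have "(\<integral>\<^sup>+z. ennreal (norm (G z)) * indicator (ball x ((1/2)^k)) z \<partial>lebesgue)
        = (\<integral>\<^sup>+z. ennreal (norm (G z)) * indicator (ball x ((1/2)^k)) z \<partial>lborel)"
      by (rule nn_integral_completion)
    also have "\<dots> = (\<integral>\<^sup>+z. ennreal (F z) * indicator (ball x ((1/2)^k)) z \<partial>lborel)"
      by (rule nn_integral_cong_AE) (use F in eventually_elim, simp)
    also have "\<dots> = dyadic_average (\<lambda>y. ennreal (F y)) k x * emeasure lborel (ball x ((1/2)^k))"
      by (rule nn_integral_ball_eq_average)
    also have "\<dots> \<le> ennreal (M x) * ennreal (w * ((1/2)^k) ^ n)"
    proof (intro mult_mono)
      show "dyadic_average (\<lambda>y. ennreal (F y)) k x \<le> ennreal (M x)"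
        using dyadic_average_le_maximal[of "\<lambda>y. ennreal (F y)" k x] that by (simp add: M_def less_top)
    qed (auto simp: emeasure_ball w_def n_def)
    finally show ?thesis using M0 by (simp add: ennreal_mult')
  qed
  have diff: "\<bar>(\<integral>z. f z * mollifier y s' z \<partial>lebesgue) - (\<integral>z. f z * mollifier x s z \<partial>lebesgue)\<bar> \<le> C1 * M x * (1/2)^k"
    if fx: "?MF x < \<infinity>" and s: "\<delta> * (1/2)^k / 2 \<le> s" "\<delta> * (1/2)^k / 2 \<le> s'" "s \<le> 2 * \<delta> * (1/2)^k"
      "norm (x - y) + s' \<le> 2 * \<delta> * (1/2)^k" for x y k s s'
  proof -
    define h where "h = (1/2::real)^k"
    have h: "h > 0" by (simp add: h_def)
    have "ennreal \<bar>(\<integral>z. f z * mollifier y s' z \<partial>lebesgue) - (\<integral>z. f z * mollifier x s z \<partial>lebesgue)\<bar>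
      \<le> ennreal (DIM('a) * (L / (\<delta> * h / 2)) ^ (DIM('a) - 1)) * (\<integral>\<^sup>+z. ennreal (norm (G z)) * indicator (ball x h) z \<partial>lebesgue)"
    proof (rule mollifier_difference[OF wg L, where q="2 * \<delta> * h"])
      show "\<bar>y \<bullet> b - x \<bullet> b\<bar> + s' \<le> 2 * \<delta> * h" if "b \<in> Basis" for b
        using Basis_le_norm[OF that, of "x - y"] s(4) by (simp add: inner_diff_left h_def abs_minus_commute)
      have "2 * \<delta> * h * real n = 2 * (\<delta> * real n) * h" by simp
      then show "2 * \<delta> * h * real DIM('a) < h" using \<delta> h by (simp add: n_def)
    qed (use s \<delta> h in \<open>auto simp: h_def\<close>)
    also have "\<dots> \<le> ennreal (DIM('a) * (L / (\<delta> * h / 2)) ^ (DIM('a) - 1)) * ennreal (M x * (w * h ^ n))"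
      unfolding h_def by (intro mult_left_mono mass fx) auto
    also have "\<dots> = ennreal (n * (L / (\<delta> * h / 2)) ^ (n - 1) * (M x * (w * h ^ n)))"
      using L \<delta> h unfolding n_def by (intro ennreal_mult'[symmetric]) auto
    also have "n * (L / (\<delta> * h / 2)) ^ (n - 1) * (M x * (w * h ^ n)) = C1 * M x * h"
    proof -
      obtain j where j: "n = Suc j" using n by (cases n) auto
      have "(L / (\<delta> * h / 2)) ^ j * h ^ j = (2 * L / \<delta>) ^ j"
        using h by (simp add: mult.commute[of 2] flip: power_mult_distrib)
      then have "n * (L / (\<delta> * h / 2)) ^ j * (M x * (w * (h * h ^ j)))
        = n * (2 * L / \<delta>) ^ j * w * M x * h" by (simp only: mult_ac)
      then show ?thesis unfolding C1_def by (simp add: j)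
    qed
    finally show ?thesis using C1 M0[of x] h by (simp add: h_def)
  qed
  have tele: "\<bar>I x j - f x\<bar> \<le> 2 * C1 * M x * (1/2)^j"
    if fx: "?MF x < \<infinity>" and x: "(\<lambda>k. dyadic_oscillation f k x) \<longlonglongrightarrow> 0" for x j
  proof -
    have "\<bar>I x j - I x (j + m)\<bar> \<le> 2 * C1 * M x * ((1/2)^j - (1/2)^(j + m))" for m
    proof (induction m)
      case (Suc m)
      have "\<bar>I x (Suc (j + m)) - I x (j + m)\<bar> \<le> C1 * M x * (1/2)^(j + m)"
        unfolding I_def using fx \<delta>(1) by (intro diff) auto
      then show ?case using Suc by (simp add: algebra_simps)
    qed simp
    moreover have "2 * C1 * M x * ((1/2)^j - (1/2)^(j + m)) \<le> 2 * C1 * M x * (1/2)^j" for m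
      using C1 M0[of x] by (intro mult_left_mono) auto
    ultimately have "\<bar>I x j - I x (j + m)\<bar> \<le> 2 * C1 * M x * (1/2)^j" for m
      using order_trans by blast
    moreover have "I x \<longlonglongrightarrow> f x"
      unfolding I_def[abs_def] using \<delta> x by (intro mollifier_tendsto li) (auto simp: n_def)
    then have "(\<lambda>m. I x (m + j)) \<longlonglongrightarrow> f x" by (rule LIMSEQ_ignore_initial_segment)
    then have "(\<lambda>m. \<bar>I x j - I x (j + m)\<bar>) \<longlonglongrightarrow> \<bar>I x j - f x\<bar>"
      by (intro tendsto_intros) (simp add: add.commute)
    ultimately show ?thesis by (intro LIMSEQ_le_const2) auto
  qed
  have loc: "integrable lborel (\<lambda>x. indicator (ball 0 R) x * f x)" for R
  proof -
    have "integrable lebesgue (\<lambda>x. indicator (ball 0 R) x *\<^sub>R f x)"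
      by (rule integrable_local_mult[OF li, where M=1 and w=0 and R=R])
         (auto split: split_indicator intro!: measurable_completion)
    then show ?thesis by (subst (asm) integrable_completion) auto
  qed
  have "AE x in lborel. ?MF x < \<infinity> \<and> (\<lambda>k. dyadic_oscillation f k x) \<longlonglongrightarrow> 0"
    using fin dyadic_lebesgue_points[OF loc] by eventually_elim auto
  then obtain S where S: "S \<in> null_sets lborel"
    "\<And>x. x \<notin> S \<Longrightarrow> ?MF x < \<infinity>" "\<And>x. x \<notin> S \<Longrightarrow> (\<lambda>k. dyadic_oscillation f k x) \<longlonglongrightarrow> 0"
    unfolding eventually_ae_filter by auto
  define C where "C = 6 * C1 / \<delta> + 1 / \<delta>"
  have C: "C > 0" "6 * C1 / \<delta> \<le> C" "1 / \<delta> \<le> C" using C1 \<delta> by (auto simp: C_def add_pos_pos)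
  have "\<bar>f x - f y\<bar> \<le> norm (x - y) * (C * (M x + \<bar>f x\<bar>) + C * (M y + \<bar>f y\<bar>))"
    if x: "x \<notin> S" and y: "y \<notin> S" for x y
  proof -
    consider "x = y" | "norm (x - y) \<ge> \<delta>" | "x \<noteq> y" "norm (x - y) < \<delta>" by linarith
    then show ?thesis
    proof cases
      case 2
      have "\<bar>f x - f y\<bar> \<le> 1 * (\<bar>f x\<bar> + \<bar>f y\<bar>)" by simp
      also have "\<dots> \<le> (norm (x - y) * C) * ((M x + \<bar>f x\<bar>) + (M y + \<bar>f y\<bar>))"
      proof (intro mult_mono)
        have "1 = \<delta> * (1 / \<delta>)" using \<delta> by simp
        also have "\<dots> \<le> norm (x - y) * C" using 2 C \<delta> by (intro mult_mono) auto
        finally show "1 \<le> norm (x - y) * C" .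
      qed (use M0[of x] M0[of y] C in auto)
      finally show ?thesis by (simp add: algebra_simps)
    next
      case 3
      \<comment> \<open>The scale that matches the distance: \<open>\<delta> * (1/2)^(j + 1) \<le> norm (x - y) < \<delta> * (1/2)^j\<close>.\<close>
      define k where "k = (LEAST k. \<delta> * (1/2)^k \<le> norm (x - y))"
      have "norm (x - y) / \<delta> > 0" using 3 \<delta> by simp
      then obtain k0 where "(1/2::real)^k0 < norm (x - y) / \<delta>"
        using real_arch_pow_inv[of "norm (x - y) / \<delta>" "1/2"] by auto
      then have "\<delta> * (1/2)^k0 \<le> norm (x - y)" using \<delta> by (simp add: field_simps)
      then have k: "\<delta> * (1/2)^k \<le> norm (x - y)" unfolding k_def by (rule LeastI)
      with 3 have "k \<noteq> 0" by (cases k) auto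
      then obtain j where j: "k = Suc j" by (cases k) auto
      have up: "norm (x - y) < \<delta> * (1/2)^j"
        using not_less_Least[of j "\<lambda>k. \<delta> * (1/2)^k \<le> norm (x - y)"] j k_def by (simp add: not_le)
      have h: "(1/2)^j \<le> 2 * norm (x - y) / \<delta>" using k j \<delta> by (simp add: field_simps)
      have "\<bar>I y j - I x j\<bar> \<le> C1 * M x * (1/2)^j"
        unfolding I_def using up \<delta>(1) S(2)[OF x] by (intro diff) auto
      moreover have "\<bar>I x j - f x\<bar> \<le> 2 * C1 * M x * (1/2)^j" using S x by (intro tele) auto
      moreover have "\<bar>I y j - f y\<bar> \<le> 2 * C1 * M y * (1/2)^j" using S y by (intro tele) auto
      moreover have "C1 * M y * (1/2)^j \<ge> 0" using C1 M0[of y] by simp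
      ultimately have "\<bar>f x - f y\<bar> \<le> 3 * C1 * (M x + M y) * (1/2)^j" by (simp add: algebra_simps)
      also have "\<dots> \<le> 3 * C1 * (M x + M y) * (2 * norm (x - y) / \<delta>)"
        using C1 M0[of x] M0[of y] h by (intro mult_left_mono) auto
      also have "\<dots> = norm (x - y) * ((6 * C1 / \<delta>) * (M x + M y))" by simp
      also have "\<dots> \<le> norm (x - y) * (C * ((M x + \<bar>f x\<bar>) + (M y + \<bar>f y\<bar>)))"
        using C M0[of x] M0[of y] C1 \<delta> by (intro mult_left_mono mult_mono) auto
      finally show ?thesis by (simp add: distrib_left)
    qed simp
  qed
  then show ?thesis using C(1) S(1) unfolding M_def by blast
qed

section \<open>Weak derivatives from difference quotients\<close>

text \<open>
  Midpoints are all that the parallelogram identity asks for, and their simple induction rule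
  carries over measurability, bounds and limits of integrals.
\<close>
inductive midpoint_hull :: "('a \<Rightarrow> real) set \<Rightarrow> ('a \<Rightarrow> real) \<Rightarrow> bool" for A where
  base: "w \<in> A \<Longrightarrow> midpoint_hull A w"
| midpoint: "midpoint_hull A v \<Longrightarrow> midpoint_hull A w \<Longrightarrow> midpoint_hull A (\<lambda>x. (v x + w x) / 2)"

lemma midpoint_hull_mono: "midpoint_hull A w \<Longrightarrow> A \<subseteq> B \<Longrightarrow> midpoint_hull B w"
  by (induction rule: midpoint_hull.induct) (auto intro: midpoint_hull.intros)

lemma midpoint_hull_measurable:
  "midpoint_hull A w \<Longrightarrow> (\<And>w. w \<in> A \<Longrightarrow> w \<in> borel_measurable M) \<Longrightarrow> w \<in> borel_measurable M"
  by (induction rule: midpoint_hull.induct) (auto intro!: borel_measurable_divide borel_measurable_add)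

lemma midpoint_hull_bounded:
  "midpoint_hull A w \<Longrightarrow> (\<And>w. w \<in> A \<Longrightarrow> \<bar>w x\<bar> \<le> c) \<Longrightarrow> \<bar>w x\<bar> \<le> c"
proof (induction rule: midpoint_hull.induct)
  case (midpoint v w)
  then have "\<bar>v x\<bar> \<le> c" "\<bar>w x\<bar> \<le> c" by auto
  then show ?case by (auto simp: abs_le_iff)
qed auto

text \<open>
  Both the integral against \<open>\<phi>\<close> and the property of lying in an interval are compatible with midpoints.
\<close>
lemma midpoint_hull_integral_near:
  assumes w: "midpoint_hull A w" and A: "\<And>w. w \<in> A \<Longrightarrow> w \<in> borel_measurable M"
    "\<And>w x. w \<in> A \<Longrightarrow> \<bar>w x\<bar> \<le> 1" "\<And>w. w \<in> A \<Longrightarrow> \<bar>(\<integral>x. w x * \<phi> x \<partial>M) - T\<bar> \<le> e"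
    and \<phi>: "integrable M \<phi>"
  shows "integrable M (\<lambda>x. w x * \<phi> x) \<and> \<bar>(\<integral>x. w x * \<phi> x \<partial>M) - T\<bar> \<le> e"
  using w
proof (induction rule: midpoint_hull.induct)
  case (base w)
  have "integrable M (\<lambda>x. w x * \<phi> x)"
  proof (rule Bochner_Integration.integrable_bound[OF \<phi>])
    show "AE x in M. norm (w x * \<phi> x) \<le> norm (\<phi> x)"
      using A(2)[OF base] by (auto simp: abs_mult intro!: mult_left_le_one_le)
  qed (use A(1)[OF base] \<phi> in auto)
  then show ?case using A(3)[OF base] by simp
next
  case (midpoint v w)
  have f: "(v x + w x) / 2 * \<phi> x = v x * \<phi> x / 2 + w x * \<phi> x / 2" for x
    by (simp add: distrib_right add_divide_distrib)
  have e: "(\<integral>x. (v x + w x) / 2 * \<phi> x \<partial>M) = (\<integral>x. v x * \<phi> x \<partial>M) / 2 + (\<integral>x. w x * \<phi> x \<partial>M) / 2"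
    unfolding f using midpoint by (subst Bochner_Integration.integral_add) auto
  have "integrable M (\<lambda>x. (v x + w x) / 2 * \<phi> x)" unfolding f using midpoint by auto
  then show ?case using midpoint.IH unfolding e by (auto simp: abs_le_iff)
qed

text \<open>
  Weak compactness of bounded functions, in the form of Mazur and Banach-Saks. Among the
  functions generated from the tail \<open>w n, w (n + 1), ...\<close> by midpoints choose \<open>k n\<close> with almost minimal
  norm in \<open>L^2\<close> for a finite measure with positive density \<open>\<rho>\<close>. By the parallelogram identity the
  sequence \<open>k\<close> is Cauchy in that norm, hence a subsequence converges almost everywhere. Whenever the
  integrals of \<open>w n\<close> against \<open>\<phi>\<close> converge, those of \<open>k n\<close> have the same limit, and dominated
  convergence identifies it.
\<close>
lemma (in sigma_finite_measure) bounded_sequence_weak_limit: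
  fixes w :: "nat \<Rightarrow> 'a \<Rightarrow> real"
  assumes meas: "\<And>n. w n \<in> borel_measurable M" and bdd: "\<And>n x. \<bar>w n x\<bar> \<le> 1"
  shows "\<exists>v\<in>borel_measurable M. (\<forall>x. \<bar>v x\<bar> \<le> 1) \<and>
    (\<forall>\<phi> T. integrable M \<phi> \<longrightarrow> (\<lambda>n. \<integral>x. w n x * \<phi> x \<partial>M) \<longlonglongrightarrow> T \<longrightarrow> (\<integral>x. v x * \<phi> x \<partial>M) = T)"
proof -
  obtain \<rho> :: "'a \<Rightarrow> real" where [measurable]: "\<rho> \<in> borel_measurable M" and \<rho>: "\<And>x. 0 < \<rho> x" "integrable M \<rho>"
    using obtain_positive_integrable_function by metis
  define A where "A n = w ` {n..}" for n
  define q where "q v = (\<integral>x. \<rho> x * (v x)\<^sup>2 \<partial>M)" for v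
  have A_mono: "m \<ge> n \<Longrightarrow> A m \<subseteq> A n" for m n by (auto simp: A_def)
  have hm: "v \<in> borel_measurable M" if "midpoint_hull (A n) v" for v n
    using midpoint_hull_measurable[OF that] meas by (auto simp: A_def)
  have hb: "\<bar>v x\<bar> \<le> 1" if "midpoint_hull (A n) v" for v n x
    using midpoint_hull_bounded[OF that] bdd by (auto simp: A_def)
  have int: "integrable M (\<lambda>x. \<rho> x * f x)" if [measurable]: "f \<in> borel_measurable M" and "\<And>x. \<bar>f x\<bar> \<le> c" for f c
  proof (rule Bochner_Integration.integrable_bound)
    show "integrable M (\<lambda>x. c * \<rho> x)" using \<rho> by auto
    show "AE x in M. norm (\<rho> x * f x) \<le> norm (c * \<rho> x)"
    proof (rule AE_I2)
      fix x
      have "\<bar>f x\<bar> \<le> \<bar>c\<bar>" using that(2)[of x] by linarith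
      then show "norm (\<rho> x * f x) \<le> norm (c * \<rho> x)"
        using \<rho>(1)[of x] by (simp add: abs_mult mult.commute mult_right_mono)
    qed
  qed simp
  have sq1: "\<bar>(a::real)\<^sup>2\<bar> \<le> 4" if "\<bar>a\<bar> \<le> 2" for a
    using power_mono[OF that, of 2] by simp
  have q_int: "integrable M (\<lambda>x. \<rho> x * (v x)\<^sup>2)" if "midpoint_hull (A n) v" for v n
  proof (rule int[where c=4])
    fix x
    have "\<bar>v x\<bar> \<le> 2" using hb[OF that, of x] by linarith
    then show "\<bar>(v x)\<^sup>2\<bar> \<le> 4" by (rule sq1)
  qed (use hm[OF that] in measurable)
  have q0: "q v \<ge> 0" for v
    unfolding q_def using \<rho>(1) by (intro integral_nonneg_AE AE_I2 mult_nonneg_nonneg) (auto intro: less_imp_le)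
  define Q where "Q n = q ` {v. midpoint_hull (A n) v}" for n
  have Qne: "Q n \<noteq> {}" for n unfolding Q_def using base[of "w n" "A n"] by (auto simp: A_def)
  have Qbdd: "bdd_below (Q n)" for n unfolding Q_def using q0 by (intro bdd_belowI2[where m=0]) auto
  \<comment> \<open>The infima increase with \<open>n\<close> since the hulls shrink, and they are bounded, hence they converge.\<close>
  define d where "d n = Inf (Q n)" for n
  have d_le: "d n \<le> q v" if "midpoint_hull (A n) v" for n v
    unfolding d_def using that by (intro cInf_lower Qbdd) (auto simp: Q_def)
  have d_mono: "d m \<le> d n" if "m \<le> n" for m n
    unfolding d_def
    by (rule cInf_superset_mono[OF Qne Qbdd]) (use midpoint_hull_mono[OF _ A_mono[OF that]] in \<open>auto simp: Q_def\<close>)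
  have d_bdd: "d n \<le> 4 * integral\<^sup>L M \<rho>" for n
  proof -
    have "d n \<le> q (w n)" by (intro d_le base) (auto simp: A_def)
    also have "\<dots> \<le> (\<integral>x. 4 * \<rho> x \<partial>M)"
      unfolding q_def
    proof (rule integral_mono)
      show "integrable M (\<lambda>x. \<rho> x * (w n x)\<^sup>2)" by (intro q_int[of n] base) (auto simp: A_def)
      fix x
      have "\<bar>(w n x)\<^sup>2\<bar> \<le> 4" using bdd[of n x] by (intro sq1) simp
      then show "\<rho> x * (w n x)\<^sup>2 \<le> 4 * \<rho> x" using \<rho>(1)[of x] by simp
    qed (use \<rho> in auto)
    finally show ?thesis by simp
  qed
  have "incseq d" using d_mono by (auto simp: incseq_def)
  then obtain D where D: "d \<longlonglongrightarrow> D" using d_bdd incseq_convergent by blast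
  have dD: "d n \<le> D" for n using \<open>incseq d\<close> D by (rule incseq_le)
  have "\<exists>v. midpoint_hull (A n) v \<and> q v < d n + 1 / real (Suc n)" for n
  proof -
    have "Inf (Q n) < d n + 1 / real (Suc n)" by (simp add: d_def)
    then obtain z where "z \<in> Q n" "z < d n + 1 / real (Suc n)" using cInf_lessD[OF Qne] by blast
    then show ?thesis by (auto simp: Q_def)
  qed
  then obtain k where k: "\<And>n. midpoint_hull (A n) (k n)" "\<And>n. q (k n) < d n + 1 / real (Suc n)" by metis
  have [measurable]: "k n \<in> borel_measurable M" for n using hm[OF k(1)] .
  have kb: "\<bar>k n x\<bar> \<le> 1" for n x using hb[OF k(1)] .
  define \<epsilon> where "\<epsilon> n = 2 * (D - d n) + 4 / real (Suc n)" for n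
  \<comment> \<open>The midpoint of \<open>k n\<close> and \<open>k m\<close> cannot have a norm below the infimum, so the two are close.\<close>
  have close: "(\<integral>x. \<rho> x * (k n x - k m x)\<^sup>2 \<partial>M) \<le> \<epsilon> n" if "n \<le> m" for n m
  proof -
    have km: "midpoint_hull (A n) (k m)" using k(1) A_mono[OF that] by (rule midpoint_hull_mono)
    let ?c = "\<lambda>x. (k n x + k m x) / 2"
    have c: "midpoint_hull (A n) ?c" by (intro midpoint k(1) km)
    have "(\<integral>x. \<rho> x * (k n x - k m x)\<^sup>2 \<partial>M)
      = (\<integral>x. 2 * (\<rho> x * (k n x)\<^sup>2) + 2 * (\<rho> x * (k m x)\<^sup>2) - 4 * (\<rho> x * (?c x)\<^sup>2) \<partial>M)"
      by (intro Bochner_Integration.integral_cong) (auto simp: power2_eq_square field_simps)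
    also have "\<dots> = 2 * q (k n) + 2 * q (k m) - 4 * q ?c"
      using q_int[OF k(1), of n] q_int[OF km] q_int[OF c] unfolding q_def by simp
    also have "\<dots> \<le> 2 * (d n + 1 / real (Suc n)) + 2 * (D + 1 / real (Suc n)) - 4 * d n"
    proof -
      have "1 / real (Suc m) \<le> 1 / real (Suc n)" using that by (intro divide_left_mono) auto
      moreover have "2 * x + 2 * y - 4 * z \<le> 2 * (dn + a) + 2 * (D + a) - 4 * dn"
        if "b \<le> a" "x < dn + a" "y < dm + b" "dm \<le> D" "dn \<le> z" for x y z dn dm a b :: real
        using that by (smt (verit))
      ultimately show ?thesis using k(2)[of n] k(2)[of m] dD[of m] d_le[OF c] by blast
    qed
    also have "\<dots> = \<epsilon> n" by (simp add: \<epsilon>_def algebra_simps del: of_nat_Suc)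
    finally show ?thesis .
  qed
  have "\<epsilon> \<longlonglongrightarrow> 2 * (D - D) + 0"
    unfolding \<epsilon>_def[abs_def] by (intro tendsto_intros D lim_const_over_n[THEN LIMSEQ_Suc])
  then have \<epsilon>: "\<epsilon> \<longlonglongrightarrow> 0" by simp
  define R where "R = integral\<^sup>L M \<rho>"
  have R0: "R \<ge> 0" unfolding R_def using \<rho>(1) by (intro integral_nonneg_AE) (auto intro: less_imp_le)
  have k_int: "integrable M (\<lambda>x. \<rho> x * k n x)" for n using kb by (intro int[where c=1]) auto
  have L1: "(\<integral>x. norm (\<rho> x * k n x - \<rho> x * k m x) \<partial>M) \<le> \<epsilon> (min n m) / \<delta> + \<delta> * R" if "\<delta> > 0" for n m \<delta>
  proof -
    have i: "integrable M (\<lambda>x. \<rho> x * (k n x - k m x)\<^sup>2)"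
    proof (rule int[where c=4])
      fix x have "\<bar>k n x - k m x\<bar> \<le> 2" using kb[of n x] kb[of m x] by linarith
      then show "\<bar>(k n x - k m x)\<^sup>2\<bar> \<le> 4" by (rule sq1)
    qed measurable
    have "(\<integral>x. norm (\<rho> x * k n x - \<rho> x * k m x) \<partial>M) \<le> (\<integral>x. (\<rho> x * (k n x - k m x)\<^sup>2) / \<delta> + \<delta> * \<rho> x \<partial>M)"
    proof (rule integral_mono)
      show "integrable M (\<lambda>x. norm (\<rho> x * k n x - \<rho> x * k m x))" using k_int by auto
      show "integrable M (\<lambda>x. (\<rho> x * (k n x - k m x)\<^sup>2) / \<delta> + \<delta> * \<rho> x)" using i \<rho> by auto
      fix x
      define t where "t = k n x - k m x"
      \<comment> \<open>Convergence in \<open>L^2\<close> implies convergence in \<open>L^1\<close> because \<open>\<rho>\<close> is integrable.\<close>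
      have "\<bar>t\<bar> \<le> t\<^sup>2 / \<delta> + \<delta>"
      proof (cases "\<bar>t\<bar> \<le> \<delta>")
        case True then show ?thesis using that by (simp add: add_increasing)
      next
        case False
        then have "\<bar>t\<bar> * \<delta> \<le> \<bar>t\<bar> * \<bar>t\<bar>" by (intro mult_left_mono) auto
        then have "\<bar>t\<bar> \<le> t\<^sup>2 / \<delta>" using that by (simp add: power2_eq_square le_divide_eq)
        then show ?thesis using that by simp
      qed
      then have "\<rho> x * \<bar>t\<bar> \<le> \<rho> x * (t\<^sup>2 / \<delta> + \<delta>)" using \<rho>(1)[of x] by (intro mult_left_mono) auto
      moreover have "norm (\<rho> x * k n x - \<rho> x * k m x) = \<rho> x * \<bar>t\<bar>"
        using \<rho>(1)[of x] by (simp add: t_def right_diff_distrib[symmetric] abs_mult)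
      ultimately show "norm (\<rho> x * k n x - \<rho> x * k m x) \<le> (\<rho> x * (k n x - k m x)\<^sup>2) / \<delta> + \<delta> * \<rho> x"
        by (simp add: t_def algebra_simps)
    qed
    also have "\<dots> = (\<integral>x. \<rho> x * (k n x - k m x)\<^sup>2 \<partial>M) / \<delta> + \<delta> * R"
      using i \<rho> by (simp add: R_def)
    also have "(\<integral>x. \<rho> x * (k n x - k m x)\<^sup>2 \<partial>M) \<le> \<epsilon> (min n m)"
    proof (cases "n \<le> m")
      case False
      then show ?thesis using close[of m n] by (simp add: power2_commute min_def)
    qed (use close in \<open>simp add: min_def\<close>)
    finally show ?thesis using that by (simp add: divide_right_mono)
  qed
  obtain r where r: "strict_mono r" "AE x in M. Cauchy (\<lambda>i. \<rho> x * k (r i) x)"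
  proof (rule cauchy_L1_AE_cauchy_subseq[where s="\<lambda>n x. \<rho> x * k n x" and M=M])
    fix e :: real assume "e > 0"
    define \<delta> where "\<delta> = e / (2 * (R + 1))"
    have \<delta>: "\<delta> > 0" "\<delta> * R < e / 2"
      using \<open>e > 0\<close> R0 by (auto simp: \<delta>_def field_simps)
    have "eventually (\<lambda>n. \<epsilon> n < \<delta> * (e / 2)) sequentially"
      using \<open>e > 0\<close> \<delta>(1) by (intro order_tendstoD(2)[OF \<epsilon>]) auto
    then obtain N where N: "\<And>n. n \<ge> N \<Longrightarrow> \<epsilon> n < \<delta> * (e / 2)" by (auto simp: eventually_sequentially)
    show "\<exists>N. \<forall>i\<ge>N. \<forall>j\<ge>N. (\<integral>x. norm (\<rho> x * k i x - \<rho> x * k j x) \<partial>M) < e"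
    proof (intro exI[of _ N] allI impI)
      fix i j assume "i \<ge> N" "j \<ge> N"
      then have "\<epsilon> (min i j) / \<delta> < e / 2" using N[of "min i j"] \<delta>(1) by (simp add: divide_less_eq mult.commute)
      then show "(\<integral>x. norm (\<rho> x * k i x - \<rho> x * k j x) \<partial>M) < e"
        using L1[OF \<delta>(1), of i j] \<delta>(2) by linarith
    qed
  qed (use k_int in auto)
  have conv: "AE x in M. convergent (\<lambda>i. k (r i) x)"
    using r(2)
  proof eventually_elim
    case (elim x)
    then have "convergent (\<lambda>i. \<rho> x * k (r i) x)" by (simp add: Cauchy_convergent_iff)
    then show ?case using convergent_mult_const_iff[of "\<rho> x"] \<rho>(1)[of x] by simp
  qed
  define v where "v x = (if convergent (\<lambda>i. k (r i) x) then lim (\<lambda>i. k (r i) x) else 0)" for x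
  have [measurable]: "Measurable.pred M (\<lambda>x. convergent (\<lambda>i. k (r i) x))"
    unfolding Cauchy_convergent_iff[symmetric] pred_def by (rule sets_Collect_Cauchy) measurable
  have [measurable]: "v \<in> borel_measurable M" unfolding v_def[abs_def] by measurable
  have v1: "\<bar>v x\<bar> \<le> 1" for x
  proof (cases "convergent (\<lambda>i. k (r i) x)")
    case True
    then have "(\<lambda>i. k (r i) x) \<longlonglongrightarrow> v x" by (simp add: v_def convergent_LIMSEQ_iff)
    then have "(\<lambda>i. \<bar>k (r i) x\<bar>) \<longlonglongrightarrow> \<bar>v x\<bar>" by (rule tendsto_rabs)
    then show ?thesis by (rule LIMSEQ_le_const2) (use kb in auto)
  qed (simp add: v_def)
  have "(\<integral>x. v x * \<phi> x \<partial>M) = T" if \<phi>: "integrable M \<phi>" and T: "(\<lambda>n. \<integral>x. w n x * \<phi> x \<partial>M) \<longlonglongrightarrow> T" for \<phi> T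
  proof -
    have [measurable]: "\<phi> \<in> borel_measurable M" using \<phi> by auto
    have 1: "(\<lambda>i. \<integral>x. k (r i) x * \<phi> x \<partial>M) \<longlonglongrightarrow> (\<integral>x. v x * \<phi> x \<partial>M)"
    proof (rule integral_dominated_convergence[where w="\<lambda>x. norm (\<phi> x)"])
      show "AE x in M. (\<lambda>i. k (r i) x * \<phi> x) \<longlonglongrightarrow> v x * \<phi> x"
        using conv by eventually_elim (auto simp: v_def convergent_LIMSEQ_iff intro!: tendsto_intros)
      show "AE x in M. norm (k (r i) x * \<phi> x) \<le> norm (\<phi> x)" for i
        using kb by (auto simp: abs_mult intro!: mult_left_le_one_le)
    qed (use \<phi> in auto)
    have "(\<lambda>n. \<integral>x. k n x * \<phi> x \<partial>M) \<longlonglongrightarrow> T"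
    proof (rule LIMSEQ_I)
      fix e :: real assume "e > 0"
      then have "eventually (\<lambda>n. dist (\<integral>x. w n x * \<phi> x \<partial>M) T < e / 2) sequentially"
        by (intro tendstoD[OF T]) simp
      then obtain N where N: "\<And>n. n \<ge> N \<Longrightarrow> \<bar>(\<integral>x. w n x * \<phi> x \<partial>M) - T\<bar> < e / 2"
        by (auto simp: eventually_sequentially dist_real_def)
      have "\<bar>(\<integral>x. k n x * \<phi> x \<partial>M) - T\<bar> \<le> e / 2" if "n \<ge> N" for n
        by (rule midpoint_hull_integral_near[OF k(1)[of n], THEN conjunct2])
           (use meas bdd \<phi> N that in \<open>auto simp: A_def intro: less_imp_le\<close>)
      then show "\<exists>N. \<forall>n\<ge>N. norm ((\<integral>x. k n x * \<phi> x \<partial>M) - T) < e"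
        using \<open>e > 0\<close> by (intro exI[of _ N]) (force intro: le_less_trans)
    qed
    then have "(\<lambda>i. \<integral>x. k (r i) x * \<phi> x \<partial>M) \<longlonglongrightarrow> T"
      using LIMSEQ_subseq_LIMSEQ[OF _ r(1)] by (auto simp: o_def)
    with 1 show ?thesis by (rule LIMSEQ_unique)
  qed
  then show ?thesis using v1 by (intro bexI[of _ v]) auto
qed

lemma ennreal_tendsto_0I:
  assumes "\<And>e. e > 0 \<Longrightarrow> eventually (\<lambda>n. X n \<le> ennreal e) F"
  shows "(X \<longlongrightarrow> 0) F"
proof (rule order_tendstoI)
  fix u :: ennreal assume "0 < u"
  then obtain z where z: "0 < z" "z < u" using dense by blast
  then have "z < \<infinity>" by (metis infinity_ennreal_def less_top order.strict_trans2 top_greatest)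
  then have e: "0 < enn2real z" "ennreal (enn2real z) < u"
    using z by (auto simp: enn2real_positive_iff)
  show "eventually (\<lambda>n. X n < u) F"
    using assms[OF e(1)] by (rule eventually_mono) (use e in auto)
qed simp

lemma nn_integral_translate:
  assumes [measurable]: "h \<in> borel_measurable borel"
  shows "(\<integral>\<^sup>+x. h (x + c) \<partial>lborel) = (\<integral>\<^sup>+x. h x \<partial>(lborel :: 'a::euclidean_space measure))"
proof -
  have "(\<integral>\<^sup>+x. h x \<partial>(lborel :: 'a measure)) = (\<integral>\<^sup>+x. h x \<partial>distr lborel borel ((+) c))"
    by (simp add: lborel_distr_plus)
  also have "\<dots> = (\<integral>\<^sup>+x. h (c + x) \<partial>lborel)" by (rule nn_integral_distr) measurable
  finally show ?thesis by (simp add: add.commute)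
qed

lemma integral_translate:
  fixes h :: "'a::euclidean_space \<Rightarrow> real"
  assumes [measurable]: "h \<in> borel_measurable borel"
  shows "(\<integral>x. h (x + c) \<partial>lborel) = (\<integral>x. h x \<partial>lborel)"
proof -
  have "(\<integral>x. h x \<partial>lborel) = (\<integral>x. h x \<partial>distr lborel borel ((+) c))"
    by (simp add: lborel_distr_plus)
  also have "\<dots> = (\<integral>x. h (c + x) \<partial>lborel)" by (rule integral_distr) measurable
  finally show ?thesis by (simp add: add.commute)
qed

lemma cball_in_borel [measurable]: "cball (x :: 'a::euclidean_space) r \<in> sets borel"
  by simp

lemma emeasure_cball_less_top: "emeasure lborel (cball (x :: 'a::euclidean_space) r) < top"
  using emeasure_bounded_finite[OF bounded_cball] by (simp add: less_top)

lemma locally_integrable_ball: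
  fixes f :: "'a::euclidean_space \<Rightarrow> real"
  assumes "locally_integrable f" and [measurable]: "f \<in> borel_measurable borel"
  shows "integrable lborel (\<lambda>x. indicator (cball 0 R) x * f x)"
proof -
  have "integrable lebesgue (\<lambda>x. indicator (cball 0 R) x *\<^sub>R f x)"
    using assms(1) by (simp add: locally_integrable_def set_integrable_def)
  then have "integrable lebesgue (\<lambda>x. indicator (cball 0 R) x * f x)" by simp
  moreover have "(\<lambda>x. indicator (cball 0 R) x * f x) \<in> borel_measurable lborel" by measurable
  ultimately show ?thesis by (simp add: integrable_completion)
qed

text \<open>
  Clear for a continuous function by dominated convergence; in general, approximate \<open>g\<close> by one and use
  that Lebesgue measure is invariant under translations.
\<close>
lemma translation_continuous_L1:
  fixes g :: "'a::euclidean_space \<Rightarrow> real"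
  assumes li: "locally_integrable g" and [measurable]: "g \<in> borel_measurable borel"
    and c: "c \<longlonglongrightarrow> 0" "\<And>m. norm (c m) \<le> 1"
  shows "(\<lambda>m. \<integral>\<^sup>+x. ennreal \<bar>g (x + c m) - g x\<bar> * indicator (cball 0 R) x \<partial>lborel) \<longlonglongrightarrow> 0"
proof (rule ennreal_tendsto_0I)
  fix e :: real assume e: "e > 0"
  define g1 where "g1 x = indicator (cball 0 (R + 1)) x * g x" for x
  have "integrable lborel g1" unfolding g1_def[abs_def] by (rule locally_integrable_ball[OF li]) measurable
  then obtain h where h: "continuous_on UNIV h" "(\<integral>\<^sup>+x. ennreal \<bar>g1 x - h x\<bar> \<partial>lborel) < ennreal (e / 3)"
    using integrable_continuous_approx[of g1 "e / 3"] e by auto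
  have [measurable]: "h \<in> borel_measurable borel" using h(1) by (rule borel_measurable_continuous_onI)
  have [measurable]: "g1 \<in> borel_measurable borel" unfolding g1_def[abs_def] by measurable
  have "compact (h ` cball 0 (R + 1))"
    using h(1) by (intro compact_continuous_image) (auto intro: continuous_on_subset)
  then obtain B where B: "\<And>x. x \<in> cball 0 (R + 1) \<Longrightarrow> \<bar>h x\<bar> \<le> B"
    using compact_imp_bounded bounded_real by (metis imageI)
  have in1: "x + c m \<in> cball 0 (R + 1)" "x \<in> cball 0 (R + 1)" if "x \<in> cball 0 R" for x m
    using that c(2)[of m] norm_triangle_ineq[of x "c m"] by auto
  let ?H = "\<lambda>m. \<integral>\<^sup>+x. ennreal \<bar>h (x + c m) - h x\<bar> * indicator (cball 0 R) x \<partial>lborel" and ?G = "\<integral>\<^sup>+x. ennreal \<bar>g1 x - h x\<bar> \<partial>lborel"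
  have "?H \<longlonglongrightarrow> (\<integral>\<^sup>+x. 0 \<partial>(lborel :: 'a measure))"
  proof (rule nn_integral_dominated_convergence[where w="\<lambda>x. ennreal (2 * B) * indicator (cball 0 R) x"])
    show "AE x in lborel. ennreal \<bar>h (x + c m) - h x\<bar> * indicator (cball 0 R) x \<le> ennreal (2 * B) * indicator (cball 0 R) x" for m
    proof (rule AE_I2)
      fix x
      show "ennreal \<bar>h (x + c m) - h x\<bar> * indicator (cball 0 R) x \<le> ennreal (2 * B) * indicator (cball 0 R) x"
      proof (cases "x \<in> cball 0 R")
        case True
        then have "\<bar>h (x + c m) - h x\<bar> \<le> 2 * B" using B[OF in1(1)[of x m]] B[OF in1(2)[of x]] by linarith
        then show ?thesis using True by (simp add: ennreal_leI)
      qed simp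
    qed
    show "(\<integral>\<^sup>+x. ennreal (2 * B) * indicator (cball 0 R) x \<partial>(lborel :: 'a measure)) < \<infinity>"
      by (subst nn_integral_cmult_indicator)
         (auto simp: ennreal_mult_less_top emeasure_cball_less_top)
    show "AE x in lborel. (\<lambda>m. ennreal \<bar>h (x + c m) - h x\<bar> * indicator (cball 0 R) x) \<longlonglongrightarrow> 0"
    proof (rule AE_I2)
      fix x
      have "(\<lambda>m. x + c m) \<longlonglongrightarrow> x + 0" by (intro tendsto_intros c)
      then have "(\<lambda>m. h (x + c m)) \<longlonglongrightarrow> h x"
        using h(1) by (intro continuous_on_tendsto_compose[OF h(1)]) auto
      then have "(\<lambda>m. \<bar>h (x + c m) - h x\<bar>) \<longlonglongrightarrow> \<bar>h x - h x\<bar>" by (intro tendsto_intros)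
      then have "(\<lambda>m. ennreal \<bar>h (x + c m) - h x\<bar>) \<longlonglongrightarrow> ennreal \<bar>h x - h x\<bar>" by (rule tendsto_ennrealI)
      then show "(\<lambda>m. ennreal \<bar>h (x + c m) - h x\<bar> * indicator (cball 0 R) x) \<longlonglongrightarrow> 0"
        by (cases "x \<in> cball 0 R") auto
    qed
  qed measurable
  then have "eventually (\<lambda>m. ?H m < ennreal (e / 3)) sequentially"
    using e by (intro order_tendstoD(2)) auto
  then show "eventually (\<lambda>m. (\<integral>\<^sup>+x. ennreal \<bar>g (x + c m) - g x\<bar> * indicator (cball 0 R) x \<partial>lborel) \<le> ennreal e) sequentially"
  proof (rule eventually_mono)
    fix m assume m: "?H m < ennreal (e / 3)"
    have "(\<integral>\<^sup>+x. ennreal \<bar>g (x + c m) - g x\<bar> * indicator (cball 0 R) x \<partial>lborel)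
      \<le> (\<integral>\<^sup>+x. ennreal \<bar>g1 (x + c m) - h (x + c m)\<bar> + (ennreal \<bar>h (x + c m) - h x\<bar> * indicator (cball 0 R) x + ennreal \<bar>g1 x - h x\<bar>) \<partial>lborel)"
    proof (rule nn_integral_mono)
      fix x
      show "ennreal \<bar>g (x + c m) - g x\<bar> * indicator (cball 0 R) x
        \<le> ennreal \<bar>g1 (x + c m) - h (x + c m)\<bar> + (ennreal \<bar>h (x + c m) - h x\<bar> * indicator (cball 0 R) x + ennreal \<bar>g1 x - h x\<bar>)"
      proof (cases "x \<in> cball 0 R")
        case True
        then have "g1 (x + c m) = g (x + c m)" "g1 x = g x" using in1(1)[of x m] in1(2)[of x] by (simp_all add: g1_def)
        then have "\<bar>g (x + c m) - g x\<bar> \<le> \<bar>g1 (x + c m) - h (x + c m)\<bar> + (\<bar>h (x + c m) - h x\<bar> + \<bar>g1 x - h x\<bar>)"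
          by linarith
        then have "ennreal \<bar>g (x + c m) - g x\<bar> \<le> ennreal (\<bar>g1 (x + c m) - h (x + c m)\<bar> + (\<bar>h (x + c m) - h x\<bar> + \<bar>g1 x - h x\<bar>))"
          by (rule ennreal_leI)
        then show ?thesis using True by simp
      qed simp
    qed
    also have "\<dots> = (\<integral>\<^sup>+x. ennreal \<bar>g1 (x + c m) - h (x + c m)\<bar> \<partial>lborel) +
      (?H m + ?G)"
      by (subst nn_integral_add, measurable, subst nn_integral_add, measurable)
    also have "(\<integral>\<^sup>+x. ennreal \<bar>g1 (x + c m) - h (x + c m)\<bar> \<partial>lborel) = ?G"
      by (rule nn_integral_translate[where h="\<lambda>x. ennreal \<bar>g1 x - h x\<bar>"]) measurable
    also have "\<dots> + (?H m + ?G)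
      \<le> ennreal (e / 3) + (ennreal (e / 3) + ennreal (e / 3))"
      using h(2) m by (intro add_mono) auto
    also have "\<dots> = ennreal e" using e by (simp flip: ennreal_plus)
    finally show "(\<integral>\<^sup>+x. ennreal \<bar>g (x + c m) - g x\<bar> * indicator (cball 0 R) x \<partial>lborel) \<le> ennreal e" .
  qed
qed

text \<open>
  Outside the support of \<open>u\<close> the derivative vanishes as well, so both are bounded by their maxima on
  a compact ball.
\<close>
lemma test_function_bounds:
  fixes u :: "'a::euclidean_space \<Rightarrow> real"
  assumes u: "test_function u" and b: "b \<in> Basis"
  obtains R B where "R > 0" "\<And>x. norm x > R \<Longrightarrow> u x = 0" "\<And>x. \<bar>u x\<bar> \<le> B"
    "\<And>x. \<bar>frechet_derivative u (at x) b\<bar> \<le> B" "\<And>x. norm x > R \<Longrightarrow> frechet_derivative u (at x) b = 0"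
    "continuous_on UNIV u" "continuous_on UNIV (\<lambda>x. frechet_derivative u (at x) b)"
proof -
  have "bounded {x. u x \<noteq> 0}"
    using u bounded_subset[OF compact_imp_bounded closure_subset] by (auto simp: test_function_def)
  then obtain R where R: "R > 0" "\<And>x. u x \<noteq> 0 \<Longrightarrow> norm x \<le> R" by (auto simp: bounded_pos)
  have 0: "u x = 0" if "norm x > R" for x using R(2)[of x] that by fastforce
  have C: "C_k (Suc 0) u" using u unfolding test_function_def by blast
  have d0: "frechet_derivative u (at x) b = 0" if "norm x > R" for x
  proof -
    have "((\<lambda>_. 0) has_derivative (\<lambda>_. 0 :: real)) (at x)" by simp
    then have "(u has_derivative (\<lambda>_. 0)) (at x)"
    proof (rule has_derivative_transform_within_open)
      show "open {x :: 'a. norm x > R}" by (intro open_Collect_less continuous_intros)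
    qed (use that 0 in auto)
    from fun_cong[OF frechet_derivative_at[OF this], of b] show ?thesis by simp
  qed
  have c: "continuous_on UNIV u" "continuous_on UNIV (\<lambda>x. frechet_derivative u (at x) b)"
    using C_k_continuous[OF C] C b by auto
  have "compact (u ` cball 0 R)" "compact ((\<lambda>x. frechet_derivative u (at x) b) ` cball 0 R)"
    using c by (auto intro!: compact_continuous_image intro: continuous_on_subset)
  then obtain B1 B2 where B: "\<And>x. x \<in> cball 0 R \<Longrightarrow> \<bar>u x\<bar> \<le> B1"
    "\<And>x. x \<in> cball 0 R \<Longrightarrow> \<bar>frechet_derivative u (at x) b\<bar> \<le> B2"
    using compact_imp_bounded bounded_real by (metis (no_types, lifting) imageI)
  have "B1 \<ge> 0" "B2 \<ge> 0" using B[of 0] R(1) by force+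
  then have "\<bar>u x\<bar> \<le> B1 + B2" "\<bar>frechet_derivative u (at x) b\<bar> \<le> B1 + B2" for x
    using B[of x] 0[of x] d0[of x] by (cases "norm x > R"; force)+
  then show ?thesis using that[of R "B1 + B2"] R 0 d0 c by blast
qed

text \<open>
  Let \<open>D m\<close> be the difference quotient with increment \<open>t m = 1 / (m + 1)\<close> and \<open>w m\<close> the truncation of
  \<open>D m / (2 * g)\<close> to \<open>[-1, 1]\<close>. As \<open>\<bar>D m x\<bar> \<le> g x + g (x + t m b)\<close>, the truncation costs at most
  \<open>\<bar>g (x + t m b) - g x\<bar>\<close>, which tends to \<open>0\<close> in \<open>L^1\<close> on bounded sets. Moving the
  difference quotient onto the test function \<open>u\<close> shows that the integrals of \<open>D m\<close> against \<open>u\<close>, and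
  therefore those of \<open>w m\<close> against \<open>2 * g * u\<close>, converge to minus the integral of \<open>f\<close> against the
  derivative of \<open>u\<close>. A weak limit \<open>v\<close> of the sequence \<open>w\<close> reproduces this limit.
\<close>
lemma weak_partial_derivative_exists:
  fixes f g :: "'a::euclidean_space \<Rightarrow> real"
  assumes [measurable]: "f \<in> borel_measurable borel" "g \<in> borel_measurable borel"
    and li: "locally_integrable f" "locally_integrable g" and g0: "\<And>x. 0 \<le> g x"
    and S: "S \<in> null_sets lborel"
    and le: "\<And>x y. x \<notin> S \<Longrightarrow> y \<notin> S \<Longrightarrow> \<bar>f x - f y\<bar> \<le> norm (x - y) * (g x + g y)"
    and b: "b \<in> Basis"
  shows "\<exists>v\<in>borel_measurable borel. (\<forall>x. \<bar>v x\<bar> \<le> 1) \<and>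
    (\<forall>u. test_function u \<longrightarrow>
      (\<integral>x. f x * frechet_derivative u (at x) b \<partial>lborel) = - (\<integral>x. v x * (2 * g x * u x) \<partial>lborel))"
proof -
  define t where "t m = 1 / real (Suc m)" for m
  have t: "0 < t m" "t m \<le> 1" for m by (auto simp: t_def)
  have t0: "t \<longlonglongrightarrow> 0" unfolding t_def[abs_def] by (rule lim_const_over_n[THEN LIMSEQ_Suc])
  have nb: "norm b = 1" using b by simp
  define D where "D m x = (f (x + t m *\<^sub>R b) - f x) / t m" for m x
  define w where "w m x = max (-1) (min 1 (D m x / (2 * g x)))" for m x
  have [measurable]: "D m \<in> borel_measurable borel" for m unfolding D_def[abs_def] by measurable
  have [measurable]: "w m \<in> borel_measurable borel" for m unfolding w_def[abs_def] by measurable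
  obtain v where v: "v \<in> borel_measurable lborel" "\<And>x. \<bar>v x\<bar> \<le> 1"
    "\<And>\<phi> T. integrable lborel \<phi> \<Longrightarrow> (\<lambda>n. \<integral>x. w n x * \<phi> x \<partial>lborel) \<longlonglongrightarrow> T \<Longrightarrow> (\<integral>x. v x * \<phi> x \<partial>lborel) = T"
  proof -
    have "\<bar>w n x\<bar> \<le> 1" for n x by (auto simp: w_def)
    then show ?thesis using that lborel.bounded_sequence_weak_limit[of w] by fastforce
  qed
  have AE_D: "AE x in lborel. \<bar>D m x - w m x * (2 * g x)\<bar> \<le> \<bar>g (x + t m *\<^sub>R b) - g x\<bar>" for m
  proof -
    have "AE x in lborel. x \<notin> S" using S by (rule AE_not_in)
    moreover have "AE x in lborel. x + t m *\<^sub>R b \<notin> S"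
    proof -
      have "AE x in distr lborel borel ((+) (t m *\<^sub>R b)). x \<notin> S"
        using AE_not_in[OF S] unfolding lborel_distr_plus .
      then show ?thesis using S by (subst (asm) AE_distr_iff) (auto simp: add.commute)
    qed
    ultimately show ?thesis
    proof eventually_elim
      case (elim x)
      have "\<bar>f (x + t m *\<^sub>R b) - f x\<bar> \<le> t m * (g (x + t m *\<^sub>R b) + g x)"
        using le[OF elim(2,1)] t(1)[of m] nb by simp
      then have Dle: "\<bar>D m x\<bar> \<le> g (x + t m *\<^sub>R b) + g x"
        using t(1)[of m] by (simp add: D_def divide_le_eq mult.commute)
      show ?case
      proof (cases "g x = 0")
        case True
        then show ?thesis using Dle by simp
      next
        case False
        then have gp: "2 * g x > 0" using g0[of x] by simp
        have "w m x * (2 * g x) = max (- (2 * g x)) (min (2 * g x) (D m x))"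
          using gp by (simp add: w_def max_mult_distrib_right min_mult_distrib_right)
        then show ?thesis using Dle gp by (auto simp: max_def min_def abs_le_iff)
      qed
    qed
  qed
  have "(\<integral>x. v x * (2 * g x * u x) \<partial>lborel) = - (\<integral>x. f x * frechet_derivative u (at x) b \<partial>lborel)"
    if u: "test_function u" for u
  proof (rule v(3))
    let ?du = "\<lambda>x. frechet_derivative u (at x) b"
    obtain R B where RB: "R > 0" "\<And>x. norm x > R \<Longrightarrow> u x = 0" "\<And>x. \<bar>u x\<bar> \<le> B"
      "\<And>x. \<bar>?du x\<bar> \<le> B" "\<And>x. norm x > R \<Longrightarrow> ?du x = 0"
      and cont: "continuous_on UNIV u" "continuous_on UNIV ?du"
      using test_function_bounds[OF u b] by metis
    have B0: "B \<ge> 0" using RB(3)[of 0] by linarith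
    have C: "C_k (Suc 0) u" using u unfolding test_function_def by blast
    have [measurable]: "u \<in> borel_measurable borel" "?du \<in> borel_measurable borel"
      using cont by (auto intro: borel_measurable_continuous_onI)
    have int_ind: "integrable lborel (\<lambda>x. h x * k x)"
      if h: "locally_integrable h" and [measurable]: "h \<in> borel_measurable borel" "k \<in> borel_measurable borel"
        and k: "\<And>x. \<bar>k x\<bar> \<le> K" "\<And>x. norm x > r \<Longrightarrow> k x = 0" for h k :: "'a \<Rightarrow> real" and K r
    proof -
      have "integrable lebesgue (\<lambda>x. k x *\<^sub>R h x)"
        by (rule integrable_local_mult[OF h, where M=K and w=0 and R=r])
           (use k in \<open>auto intro!: measurable_completion\<close>)
      then show ?thesis by (subst (asm) integrable_completion) (auto simp: mult.commute)
    qed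
    show gu: "integrable lborel (\<lambda>x. 2 * g x * u x)"
      using int_ind[OF li(2) _ _ RB(3,2)] by (simp add: mult.assoc)
    have d: "((\<lambda>s. u (x - s *\<^sub>R b)) has_real_derivative - ?du (x - s *\<^sub>R b)) (at s)" for x s
    proof -
      have 1: "((\<lambda>s. x - s *\<^sub>R b) has_derivative (\<lambda>h. - (h *\<^sub>R b))) (at s)"
        by (auto intro!: derivative_eq_intros)
      have lin: "linear (frechet_derivative u (at (x - s *\<^sub>R b)))"
        using C_k_Suc_has_derivative[OF C] has_derivative_linear by blast
      have "(\<lambda>h. frechet_derivative u (at (x - s *\<^sub>R b)) (- (h *\<^sub>R b))) = (*) (- ?du (x - s *\<^sub>R b))"
        using linear_scale[OF lin] linear_neg[OF lin] by (auto simp: fun_eq_iff)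
      then show ?thesis
        using has_derivative_compose[OF 1 C_k_Suc_has_derivative[OF C]] by (simp add: has_field_derivative_def)
    qed
    have ut: "\<bar>(u (x - t m *\<^sub>R b) - u x) / t m\<bar> \<le> B" for x m
    proof -
      obtain z where "u (x - t m *\<^sub>R b) - u (x - 0 *\<^sub>R b) = (t m - 0) * - ?du (x - z *\<^sub>R b)"
        using MVT2[OF t(1)[of m] d] by blast
      then show ?thesis using RB(4)[of "x - z *\<^sub>R b"] t(1)[of m] by simp
    qed
    have ut0: "(u (x - t m *\<^sub>R b) - u x) / t m = 0" if "norm x > R + 1" for x m
    proof -
      have "norm (x - t m *\<^sub>R b) > R"
        using norm_triangle_ineq2[of x "t m *\<^sub>R b"] that t[of m] nb by simp
      then show ?thesis using RB(2) that by simp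
    qed
    have lim: "(\<lambda>m. (u (x - t m *\<^sub>R b) - u x) / t m) \<longlonglongrightarrow> - ?du x" for x
    proof -
      have "((\<lambda>h. (u (x - h *\<^sub>R b) - u x) / h) \<longlongrightarrow> - ?du x) (at 0)"
        using d[of x 0] by (simp add: DERIV_def)
      moreover have "filterlim t (at 0) sequentially"
        using t0 t(1) by (auto simp: filterlim_at less_imp_neq[symmetric])
      ultimately show ?thesis by (rule filterlim_compose)
    qed
    have "(\<lambda>m. \<integral>x. f x * ((u (x - t m *\<^sub>R b) - u x) / t m) \<partial>lborel) \<longlonglongrightarrow> (\<integral>x. f x * (- ?du x) \<partial>lborel)"
    proof (rule integral_dominated_convergence[where w="\<lambda>x. \<bar>f x * (B * indicator (cball 0 (R + 1)) x)\<bar>"])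
      show "integrable lborel (\<lambda>x. \<bar>f x * (B * indicator (cball 0 (R + 1)) x)\<bar>)"
        by (intro integrable_abs int_ind[OF li(1), where K=B and r="R + 1"])
           (use B0 in \<open>auto split: split_indicator\<close>)
      show "AE x in lborel. (\<lambda>m. f x * ((u (x - t m *\<^sub>R b) - u x) / t m)) \<longlonglongrightarrow> f x * (- ?du x)"
        by (intro AE_I2 tendsto_intros lim)
      show "AE x in lborel. norm (f x * ((u (x - t m *\<^sub>R b) - u x) / t m)) \<le> \<bar>f x * (B * indicator (cball 0 (R + 1)) x)\<bar>" for m
      proof (rule AE_I2)
        fix x
        show "norm (f x * ((u (x - t m *\<^sub>R b) - u x) / t m)) \<le> \<bar>f x * (B * indicator (cball 0 (R + 1)) x)\<bar>"
        proof (cases "norm x > R + 1")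
          case False
          then show ?thesis using ut[of x m] B0 unfolding real_norm_def abs_mult by (intro mult_mono) auto
        qed (simp add: ut0)
      qed
    qed measurable
    then have A: "(\<lambda>m. \<integral>x. f x * ((u (x - t m *\<^sub>R b) - u x) / t m) \<partial>lborel) \<longlonglongrightarrow> - (\<integral>x. f x * ?du x \<partial>lborel)"
      by simp
    have sh0: "u (x - t m *\<^sub>R b) = 0" if "norm x > R + 1" for x m
      using ut0[OF that, of m] RB(2)[of x] that t(1)[of m] by simp
    have i1: "integrable lborel (\<lambda>x. f x * u (x - t m *\<^sub>R b))" for m
      using RB(3) sh0 by (intro int_ind[OF li(1), where K=B and r="R + 1"]) auto
    have i2: "integrable lborel (\<lambda>x. f x * u x)"
      using RB by (intro int_ind[OF li(1), where K=B and r=R]) auto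
    have i3: "integrable lborel (\<lambda>x. f (x + t m *\<^sub>R b) * u x)" for m
    proof -
      have "integrable (distr lborel borel ((+) (t m *\<^sub>R b))) (\<lambda>x. f x * u (x - t m *\<^sub>R b))"
        using i1[of m] by (simp add: lborel_distr_plus)
      then show ?thesis by (subst (asm) integrable_distr_eq) (auto simp: add.commute)
    qed
    have Dint: "integrable lborel (\<lambda>x. D m x * u x)" for m
    proof -
      have "integrable lborel (\<lambda>x. (f (x + t m *\<^sub>R b) * u x - f x * u x) / t m)" using i2 i3 by auto
      then show ?thesis by (simp add: D_def left_diff_distrib)
    qed
    \<comment> \<open>Translation invariance moves the difference quotient from \<open>f\<close> to \<open>u\<close>.\<close>
    have Deq: "(\<integral>x. D m x * u x \<partial>lborel) = (\<integral>x. f x * ((u (x - t m *\<^sub>R b) - u x) / t m) \<partial>lborel)" for m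
    proof -
      have tr: "(\<integral>x. f (x + t m *\<^sub>R b) * u x \<partial>lborel) = (\<integral>x. f x * u (x - t m *\<^sub>R b) \<partial>lborel)"
        using integral_translate[of "\<lambda>x. f x * u (x - t m *\<^sub>R b)" "t m *\<^sub>R b"] by simp
      have "(\<integral>x. D m x * u x \<partial>lborel) = (\<integral>x. (f (x + t m *\<^sub>R b) * u x - f x * u x) / t m \<partial>lborel)"
        by (simp add: D_def left_diff_distrib)
      also have "\<dots> = ((\<integral>x. f x * u (x - t m *\<^sub>R b) \<partial>lborel) - (\<integral>x. f x * u x \<partial>lborel)) / t m"
        using i2 i3[of m] tr by simp
      also have "\<dots> = (\<integral>x. (f x * u (x - t m *\<^sub>R b) - f x * u x) / t m \<partial>lborel)"
        using i2 i1[of m] by simp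
      finally show ?thesis by (simp add: right_diff_distrib)
    qed
    have wint: "integrable lborel (\<lambda>x. w m x * (2 * g x * u x))" for m
    proof (rule Bochner_Integration.integrable_bound[OF gu])
      show "AE x in lborel. norm (w m x * (2 * g x * u x)) \<le> norm (2 * g x * u x)"
        unfolding real_norm_def abs_mult[of "w m _"] by (intro AE_I2 mult_left_le_one_le) (auto simp: w_def)
    qed measurable
    let ?E = "\<lambda>m. (\<integral>x. D m x * u x \<partial>lborel) - (\<integral>x. w m x * (2 * g x * u x) \<partial>lborel)"
    let ?S = "\<lambda>m. \<integral>\<^sup>+x. ennreal \<bar>g (x + t m *\<^sub>R b) - g x\<bar> * indicator (cball 0 R) x \<partial>lborel"
    have "(\<lambda>m. ?E m) \<longlonglongrightarrow> 0"
    proof -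
      have le: "ennreal \<bar>?E m\<bar>
        \<le> ennreal B * ?S m" for m
      proof -
        have "?E m
          = (\<integral>x. D m x * u x - w m x * (2 * g x * u x) \<partial>lborel)"
          by (rule Bochner_Integration.integral_diff[symmetric, OF Dint wint])
        then have "ennreal \<bar>?E m\<bar>
          = ennreal (norm (\<integral>x. D m x * u x - w m x * (2 * g x * u x) \<partial>lborel))" by simp
        also have "\<dots> \<le> (\<integral>\<^sup>+x. ennreal (norm (D m x * u x - w m x * (2 * g x * u x))) \<partial>lborel)"
          using Dint wint by (intro integral_norm_bound_ennreal) auto
        also have "\<dots> \<le> (\<integral>\<^sup>+x. ennreal B * (ennreal \<bar>g (x + t m *\<^sub>R b) - g x\<bar> * indicator (cball 0 R) x) \<partial>lborel)"
        proof (rule nn_integral_mono_AE)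
          show "AE x in lborel. ennreal (norm (D m x * u x - w m x * (2 * g x * u x)))
            \<le> ennreal B * (ennreal \<bar>g (x + t m *\<^sub>R b) - g x\<bar> * indicator (cball 0 R) x)"
            using AE_D[of m]
          proof eventually_elim
            case (elim x)
            show ?case
            proof (cases "norm x > R")
              case False
              have "norm (D m x * u x - w m x * (2 * g x * u x)) = \<bar>u x\<bar> * \<bar>D m x - w m x * (2 * g x)\<bar>"
                by (simp add: abs_mult[symmetric] algebra_simps)
              also have "\<dots> \<le> B * \<bar>g (x + t m *\<^sub>R b) - g x\<bar>" using elim RB(3)[of x] B0 by (intro mult_mono) auto
              finally show ?thesis using False B0 by (simp add: ennreal_mult[symmetric] ennreal_leI)
            qed (simp add: RB(2))
          qed
        qed
        also have "\<dots> = ennreal B * ?S m"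
          by (rule nn_integral_cmult) measurable
        finally show ?thesis .
      qed
      have lim0: "(\<lambda>m. ennreal B * ?S m) \<longlonglongrightarrow> ennreal B * 0"
      proof (rule ennreal_tendsto_cmult)
        have "(\<lambda>m. t m *\<^sub>R b) \<longlonglongrightarrow> 0 *\<^sub>R b" by (intro tendsto_intros t0)
        then show "(\<lambda>m. ?S m) \<longlonglongrightarrow> 0"
          using t nb less_imp_le[OF t(1)] by (intro translation_continuous_L1 li) auto
      qed simp
      have "(\<lambda>m. ennreal \<bar>?E m\<bar>) \<longlonglongrightarrow> 0"
        by (rule tendsto_sandwich[OF _ _ tendsto_const lim0[unfolded mult_zero_right]]) (use le in auto)
      then show ?thesis by (rule tendsto_0_if_ennreal_abs)
    qed
    from tendsto_diff[OF A[folded Deq] this]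
    show "(\<lambda>m. \<integral>x. w m x * (2 * g x * u x) \<partial>lborel) \<longlonglongrightarrow> - (\<integral>x. f x * ?du x \<partial>lborel)"
      by simp
  qed
  then show ?thesis using v by (intro bexI[of _ v]) auto
qed

section \<open>Lebesgue spaces with variable exponent\<close>

text \<open>
  The norm is an infimum over the admissible \<open>c\<close>, so it is finite as soon as there is one.
\<close>
lemma Lp_var_iff:
  assumes "\<And>x. 1 \<le> p x"
  shows "f \<in> Lp_var p \<longleftrightarrow> f \<in> borel_measurable lebesgue \<and>
    (\<exists>c>0. (\<integral>\<^sup>+x. phi_recip (enn2real (1 / p x)) (\<bar>f x\<bar> / c) \<partial>lebesgue) \<le> 1)"
  unfolding Lp_var_def Lp_var_norm_def using phi_eq_phi_recip[OF assms]
  by (auto simp: Inf_less_iff)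

lemma enn2real_inverse_le:
  assumes "0 < a" "ennreal a \<le> p"
  shows "enn2real (1 / p) \<le> 1 / a"
proof (cases p)
  case (real r)
  then have r: "a \<le> r" "0 < r" using assms by auto
  then have "1 / p = ennreal (1 / r)" using real by (simp add: divide_ennreal[symmetric])
  moreover have "1 / r \<le> 1 / a" using r assms(1) by (intro divide_left_mono) auto
  ultimately show ?thesis using r by simp
qed (use assms in simp)

lemma enn2real_inverse_bounds:
  assumes "1 \<le> p"
  shows "0 \<le> enn2real (1 / p)" "enn2real (1 / p) \<le> 1"
  using enn2real_inverse_le[of 1 p] assms by simp_all

lemma Lp_var_dominated:
  assumes p: "\<And>x. 1 \<le> p x" and f: "f \<in> Lp_var p"
    and h: "h \<in> borel_measurable lebesgue" "AE x in lebesgue. \<bar>h x\<bar> \<le> a * \<bar>f x\<bar>"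
  shows "h \<in> Lp_var p"
proof -
  obtain c where c: "c > 0" "(\<integral>\<^sup>+x. phi_recip (enn2real (1 / p x)) (\<bar>f x\<bar> / c) \<partial>lebesgue) \<le> 1"
    using f unfolding Lp_var_iff[OF p] by blast
  have "(\<integral>\<^sup>+x. phi_recip (enn2real (1 / p x)) (\<bar>h x\<bar> / (c * (\<bar>a\<bar> + 1))) \<partial>lebesgue)
    \<le> (\<integral>\<^sup>+x. phi_recip (enn2real (1 / p x)) (\<bar>f x\<bar> / c) \<partial>lebesgue)"
    using h(2)
  proof (intro nn_integral_mono_AE, eventually_elim)
    case (elim x)
    have "a * \<bar>f x\<bar> \<le> (\<bar>a\<bar> + 1) * \<bar>f x\<bar>" by (intro mult_right_mono) auto
    with elim have "\<bar>h x\<bar> \<le> (\<bar>a\<bar> + 1) * \<bar>f x\<bar>" by linarith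
    then have "\<bar>h x\<bar> / (\<bar>a\<bar> + 1) \<le> \<bar>f x\<bar>" by (simp add: divide_le_eq mult.commute)
    then have "\<bar>h x\<bar> / (\<bar>a\<bar> + 1) / c \<le> \<bar>f x\<bar> / c" using c by (intro divide_right_mono) auto
    then show ?case using c by (intro phi_recip_mono) (auto simp: mult.commute)
  qed
  then show ?thesis unfolding Lp_var_iff[OF p] using c h(1)
    by (intro conjI exI[of _ "c * (\<bar>a\<bar> + 1)"]) (auto intro: order_trans)
qed

lemma Lp_var_cmult:
  assumes p: "\<And>x. 1 \<le> p x" and f: "f \<in> Lp_var p"
  shows "(\<lambda>x. a * f x) \<in> Lp_var p"
proof (rule Lp_var_dominated[OF p f])
  show "(\<lambda>x. a * f x) \<in> borel_measurable lebesgue" using f by (auto simp: Lp_var_def)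
  show "AE x in lebesgue. \<bar>a * f x\<bar> \<le> \<bar>a\<bar> * \<bar>f x\<bar>" by (simp add: abs_mult)
qed

text \<open>
  At each point, the larger of \<open>\<bar>f x\<bar> / c\<close> and \<open>\<bar>g x\<bar> / d\<close> bounds the sum divided by
  \<open>2 * max c d\<close>. This gives modular at most \<open>2\<close>, and another factor \<open>2\<close> in the denominator halves it.
\<close>
lemma Lp_var_add:
  assumes p: "\<And>x. 1 \<le> p x" and [measurable]: "p \<in> borel_measurable lebesgue"
    and f: "f \<in> Lp_var p" and g: "g \<in> Lp_var p"
  shows "(\<lambda>x. f x + g x) \<in> Lp_var p"
proof -
  let ?\<alpha> = "\<lambda>x. enn2real (1 / p x)"
  let ?f = "\<lambda>c x. phi_recip (?\<alpha> x) (\<bar>f x\<bar> / c)" and ?g = "\<lambda>d x. phi_recip (?\<alpha> x) (\<bar>g x\<bar> / d)"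
  obtain c where c: "c > 0" "(\<integral>\<^sup>+x. ?f c x \<partial>lebesgue) \<le> 1"
    and [measurable]: "f \<in> borel_measurable lebesgue"
    using f unfolding Lp_var_iff[OF p] by blast
  obtain d where d: "d > 0" "(\<integral>\<^sup>+x. ?g d x \<partial>lebesgue) \<le> 1"
    and [measurable]: "g \<in> borel_measurable lebesgue"
    using g unfolding Lp_var_iff[OF p] by blast
  define e where "e = 2 * max c d"
  have e: "e > 0" using c by (simp add: e_def)
  have "(\<integral>\<^sup>+x. phi_recip (?\<alpha> x) (\<bar>f x + g x\<bar> / (e * 2)) \<partial>lebesgue)
    \<le> (\<integral>\<^sup>+x. ennreal (1/2) * (?f c x + ?g d x) \<partial>lebesgue)"
  proof (rule nn_integral_mono)
    fix x
    note \<alpha> = enn2real_inverse_bounds[OF p[of x]]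
    define t where "t = max (\<bar>f x\<bar> / c) (\<bar>g x\<bar> / d)"
    have "\<bar>f x + g x\<bar> / e \<le> t"
    proof -
      have "\<bar>f x\<bar> / e \<le> \<bar>f x\<bar> / (2 * c)" "\<bar>g x\<bar> / e \<le> \<bar>g x\<bar> / (2 * d)"
        using c(1) d(1) by (auto simp: e_def intro!: divide_left_mono)
      moreover have "\<bar>f x + g x\<bar> / e \<le> \<bar>f x\<bar> / e + \<bar>g x\<bar> / e"
        using e by (simp add: add_divide_distrib[symmetric] divide_right_mono)
      moreover have "\<bar>f x\<bar> / (2 * c) \<le> t / 2" "\<bar>g x\<bar> / (2 * d) \<le> t / 2" by (simp_all add: t_def)
      ultimately show ?thesis by linarith
    qed
    have "phi_recip (?\<alpha> x) (\<bar>f x + g x\<bar> / (e * 2)) \<le> ennreal (1/2) * phi_recip (?\<alpha> x) (\<bar>f x + g x\<bar> / e)"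
      using phi_recip_divide_le[OF \<alpha>, of "\<bar>f x + g x\<bar> / e" 2] e by simp
    also have "\<dots> \<le> ennreal (1/2) * phi_recip (?\<alpha> x) t"
      using \<open>\<bar>f x + g x\<bar> / e \<le> t\<close> \<alpha> e by (intro mult_left_mono phi_recip_mono) auto
    also have "phi_recip (?\<alpha> x) t \<le> ?f c x + ?g d x"
      by (cases "\<bar>f x\<bar> / c \<le> \<bar>g x\<bar> / d") (auto simp: t_def max_def add_increasing add_increasing2)
    finally show "phi_recip (?\<alpha> x) (\<bar>f x + g x\<bar> / (e * 2))
      \<le> ennreal (1/2) * (?f c x + ?g d x)"
      by (simp add: mult_left_mono)
  qed
  also have "\<dots> = ennreal (1/2) * ((\<integral>\<^sup>+x. ?f c x \<partial>lebesgue) + (\<integral>\<^sup>+x. ?g d x \<partial>lebesgue))"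
    by (subst nn_integral_cmult, measurable, subst nn_integral_add, measurable)
  also have "\<dots> \<le> ennreal (1/2) * ennreal 2"
    using add_mono[OF c(2) d(2)] by (intro mult_left_mono) auto
  also have "\<dots> = 1" by (subst ennreal_mult[symmetric]) auto
  finally show ?thesis unfolding Lp_var_iff[OF p] using e by (intro conjI exI[of _ "e * 2"]) auto
qed

text \<open>
  Since exponents are at least \<open>1\<close>, any \<open>t \<ge> 0\<close> is at most \<open>1\<close> plus its modular.
\<close>
lemma Lp_var_locally_integrable:
  fixes f :: "'a::euclidean_space \<Rightarrow> real"
  assumes p: "\<And>x. 1 \<le> p x" and f: "f \<in> Lp_var p" and pm: "p \<in> borel_measurable lebesgue"
  shows "locally_integrable f"
  unfolding locally_integrable_def set_integrable_def
proof (intro allI impI)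
  fix K :: "'a set" assume K: "compact K"
  have [measurable]: "K \<in> sets lebesgue" using borel_compact[OF K] by simp
  have [measurable]: "p \<in> borel_measurable lebesgue" by (rule pm)
  let ?\<alpha> = "\<lambda>x. enn2real (1 / p x)"
  obtain c where c: "c > 0" "(\<integral>\<^sup>+x. phi_recip (?\<alpha> x) (\<bar>f x\<bar> / c) \<partial>lebesgue) \<le> 1"
    and [measurable]: "f \<in> borel_measurable lebesgue"
    using f unfolding Lp_var_iff[OF p] by blast
  show "integrable lebesgue (\<lambda>x. indicator K x *\<^sub>R f x)"
  proof (rule integrableI_bounded)
    have "(\<integral>\<^sup>+x. ennreal (norm (indicator K x *\<^sub>R f x)) \<partial>lebesgue)
      \<le> (\<integral>\<^sup>+x. ennreal c * (indicator K x + phi_recip (?\<alpha> x) (\<bar>f x\<bar> / c)) \<partial>lebesgue)"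
    proof (rule nn_integral_mono)
      fix x
      have "ennreal (\<bar>f x\<bar> / c) \<le> 1 + phi_recip (?\<alpha> x) (\<bar>f x\<bar> / c)"
        using phi_recip_level_bound[OF enn2real_inverse_bounds[OF p[of x]], of "\<bar>f x\<bar> / c" 1 1] c(1) by simp
      then have "ennreal c * ennreal (\<bar>f x\<bar> / c) \<le> ennreal c * (1 + phi_recip (?\<alpha> x) (\<bar>f x\<bar> / c))"
        by (intro mult_left_mono) auto
      moreover have "ennreal c * ennreal (\<bar>f x\<bar> / c) = ennreal \<bar>f x\<bar>"
        using c(1) by (simp add: ennreal_mult[symmetric])
      ultimately show "ennreal (norm (indicator K x *\<^sub>R f x)) \<le> ennreal c * (indicator K x + phi_recip (?\<alpha> x) (\<bar>f x\<bar> / c))"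
        by (auto split: split_indicator)
    qed
    also have "\<dots> = ennreal c * (emeasure lebesgue K + (\<integral>\<^sup>+x. phi_recip (?\<alpha> x) (\<bar>f x\<bar> / c) \<partial>lebesgue))"
      by (subst nn_integral_cmult, measurable, subst nn_integral_add, measurable)
    also have "\<dots> < \<infinity>"
    proof -
      have "emeasure lebesgue K < \<infinity>"
        using emeasure_bounded_finite[OF compact_imp_bounded[OF K]] borel_compact[OF K] by simp
      then show ?thesis using c(2) by (auto simp: ennreal_mult_less_top intro: le_less_trans)
    qed
    finally show "(\<integral>\<^sup>+x. ennreal (norm (indicator K x *\<^sub>R f x)) \<partial>lebesgue) < \<infinity>" .
  qed measurable
qed

section \<open>The pointwise characterisation\<close>

text \<open>
  The bound on \<open>p\<close> holds almost everywhere. The reciprocal of \<open>p\<close> is continuous, so the exceptional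
  set is open; being a null set, it is empty.
\<close>
lemma ess_inf_gt_1_imp:
  fixes p :: "'a::euclidean_space \<Rightarrow> ennreal"
  assumes p: "\<And>x. 1 \<le> p x" and ess: "ess_inf lebesgue p > 1"
    and lh: "globally_log_holder (\<lambda>x. enn2real (1 / p x))"
  obtains a where "a > 1" "\<And>x. a * enn2real (1 / p x) \<le> 1"
proof -
  obtain a0 where a0: "AE x in lebesgue. a0 \<le> p x" "1 < a0"
    using ess unfolding ess_inf_def less_Sup_iff by auto
  define a where "a = (if a0 = \<infinity> then 2 else enn2real a0)"
  have a: "a > 1" "ennreal a \<le> a0"
  proof -
    show "a > 1"
    proof (cases "a0 = \<infinity>")
      case False
      then have "ennreal 1 < ennreal (enn2real a0)" using a0(2) by (simp add: less_top)
      then have "1 < enn2real a0" by (subst (asm) ennreal_less_iff) auto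
      then show ?thesis using False by (simp add: a_def)
    qed (simp add: a_def)
    show "ennreal a \<le> a0" by (auto simp: a_def less_top)
  qed
  let ?\<alpha> = "\<lambda>x. enn2real (1 / p x)"
  have le: "a * ?\<alpha> x \<le> 1" if "a0 \<le> p x" for x
  proof -
    have "?\<alpha> x \<le> 1 / a" using a that by (intro enn2real_inverse_le) auto
    then show ?thesis using a by (simp add: field_simps)
  qed
  have "continuous_on UNIV ?\<alpha>" by (rule globally_log_holder_continuous[OF lh])
  then have o: "open {x. 1 < a * ?\<alpha> x}" by (intro open_Collect_less continuous_intros)
  have "AE x in lebesgue. \<not> 1 < a * ?\<alpha> x" using a0(1) by eventually_elim (use le in \<open>auto simp: not_less\<close>)
  then have "{x. 1 < a * ?\<alpha> x} \<in> null_sets lebesgue"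
    using o by (subst AE_iff_null_sets) (auto intro: borel_open)
  then have "{x. 1 < a * ?\<alpha> x} = {}" using open_not_negligible[OF o] by (auto simp: negligible_iff_null_sets)
  then show ?thesis using that[OF a(1)] by (auto simp: not_less)
qed

text \<open>
  Used to pass between a function and a Borel representative.
\<close>
lemma weak_gradient_cong_AE:
  fixes f f' :: "'a::euclidean_space \<Rightarrow> real"
  assumes wg: "weak_gradient f G" and eq: "AE x in lebesgue. f x = f' x"
    and f: "f \<in> borel_measurable lebesgue" "f' \<in> borel_measurable lebesgue"
  shows "weak_gradient f' G"
  unfolding weak_gradient_def
proof (intro conjI allI impI ballI)
  show "locally_integrable G" using wg by (simp add: weak_gradient_def)
  show "locally_integrable f'"
    unfolding locally_integrable_def set_integrable_def
  proof (intro allI impI)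
    fix K :: "'a set" assume K: "compact K"
    have [measurable]: "K \<in> sets lebesgue" using borel_compact[OF K] by simp
    note [measurable] = f
    have "integrable lebesgue (\<lambda>x. indicator K x *\<^sub>R f x)"
      using wg K by (simp add: weak_gradient_def locally_integrable_def set_integrable_def)
    then show "integrable lebesgue (\<lambda>x. indicator K x *\<^sub>R f' x)"
      by (rule integrable_cong_AE_imp) (measurable, use eq in eventually_elim, simp)
  qed
  fix u :: "'a \<Rightarrow> real" and b :: 'a assume u: "test_function u" and b: "b \<in> Basis"
  obtain R B where "continuous_on UNIV (\<lambda>x. frechet_derivative u (at x) b)"
    using test_function_bounds[OF u b] by metis
  then have "(\<lambda>x. frechet_derivative u (at x) b) \<in> borel_measurable borel"
    by (rule borel_measurable_continuous_onI)
  then have [measurable]: "(\<lambda>x. frechet_derivative u (at x) b) \<in> borel_measurable lebesgue"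
    by (simp add: measurable_completion)
  note [measurable] = f
  have "(\<integral>x. f' x * frechet_derivative u (at x) b \<partial>lebesgue) = (\<integral>x. f x * frechet_derivative u (at x) b \<partial>lebesgue)"
    by (rule integral_cong_AE) (measurable, use eq in eventually_elim, simp)
  then show "(\<integral>x. f' x * frechet_derivative u (at x) b \<partial>lebesgue) = - (\<integral>x. (G x \<bullet> b) * u x \<partial>lebesgue)"
    using wg u b by (simp add: weak_gradient_def)
qed

lemma W1p_var_imp_pointwise:
  fixes f :: "'a::euclidean_space \<Rightarrow> real"
  assumes pm: "p \<in> borel_measurable lebesgue" and p: "\<And>x. 1 \<le> p x" and ess: "ess_inf lebesgue p > 1"
    and lh: "globally_log_holder (\<lambda>x. enn2real (1 / p x))"
    and f: "f \<in> W1p_var p"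
  shows "\<exists>g \<in> Lp_var p. (\<forall>x. 0 \<le> g x) \<and>
      (\<exists>S \<in> null_sets lebesgue. \<forall>x y. x \<notin> S \<longrightarrow> y \<notin> S \<longrightarrow>
         \<bar>f x - f y\<bar> \<le> norm (x - y) * (g x + g y))"
proof -
  let ?\<alpha> = "\<lambda>x. enn2real (1 / p x)"
  have [measurable]: "?\<alpha> \<in> borel_measurable borel"
    using globally_log_holder_continuous[OF lh] by (rule borel_measurable_continuous_onI)
  obtain G where fL: "f \<in> Lp_var p" and wg: "weak_gradient f G" and GL: "(\<lambda>x. norm (G x)) \<in> Lp_var p"
    using f by (auto simp: W1p_var_def)
  have fm: "f \<in> borel_measurable lebesgue" using fL unfolding Lp_var_iff[OF p] by blast
  obtain c where c: "c > 0" "(\<integral>\<^sup>+x. phi_recip (?\<alpha> x) (\<bar>norm (G x)\<bar> / c) \<partial>lebesgue) \<le> 1"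
    and Gm: "(\<lambda>x. norm (G x)) \<in> borel_measurable lebesgue"
    using GL unfolding Lp_var_iff[OF p] by blast
  obtain f' where [measurable]: "f' \<in> borel_measurable lborel" and f': "AE x in lborel. f x = f' x"
    using completion_ex_borel_measurable_real[OF fm] by auto
  obtain F0 where [measurable]: "F0 \<in> borel_measurable lborel" and F0: "AE x in lborel. norm (G x) = F0 x"
    using completion_ex_borel_measurable_real[OF Gm] by auto
  define F where "F x = \<bar>F0 x\<bar> / c" for x
  have [measurable]: "F \<in> borel_measurable borel" unfolding F_def[abs_def] by measurable
  have F: "F x \<ge> 0" for x using c by (simp add: F_def)
  have GF: "AE x in lborel. norm (G x) = c * F x"
    using F0
  proof eventually_elim
    case (elim x)
    then have "F0 x \<ge> 0" by (metis norm_ge_zero)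
    then show ?case using c elim by (simp add: F_def)
  qed
  obtain a where a: "a > 1" "\<And>x. a * ?\<alpha> x \<le> 1" using ess_inf_gt_1_imp[OF p ess lh] by blast
  have mod: "(\<integral>\<^sup>+x. phi_recip (?\<alpha> x) (F x) \<partial>lborel) \<le> 1"
  proof -
    have "(\<integral>\<^sup>+x. phi_recip (?\<alpha> x) (F x) \<partial>lborel) = (\<integral>\<^sup>+x. phi_recip (?\<alpha> x) (\<bar>norm (G x)\<bar> / c) \<partial>lborel)"
      by (rule nn_integral_cong_AE) (use GF in eventually_elim, use c F in simp)
    then show ?thesis using c(2) by (simp add: nn_integral_completion)
  qed
  let ?M = "dyadic_maximal (\<lambda>y. ennreal (F y))"
  have fin: "AE x in lborel. ?M x < \<infinity>"
    by (rule dyadic_maximal_modular(1)[OF lh a(1) _ a(2) _ F mod]) auto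
  obtain c2 where c2: "c2 > 0" "(\<integral>\<^sup>+x. phi_recip (?\<alpha> x) (enn2real (?M x) / c2) \<partial>lborel) \<le> 1"
    using dyadic_maximal_modular(2)[OF lh a(1) _ a(2) _ F mod] by auto
  have M_scale: "dyadic_maximal (\<lambda>y. ennreal (c * F y)) x = ennreal c * ?M x" for x
    using c dyadic_maximal_cmult[of "\<lambda>y. ennreal (F y)" "ennreal c" x] by (simp add: ennreal_mult')
  define m where "m x = enn2real (?M x)" for x
  have [measurable]: "m \<in> borel_measurable borel" unfolding m_def[abs_def] by measurable
  have mL: "m \<in> Lp_var p"
    unfolding Lp_var_iff[OF p]
    using c2 by (auto simp: nn_integral_completion m_def intro!: exI[of _ c2] measurable_completion)
  have wg': "weak_gradient f' G"
    using wg AE_completion[OF f'] fm by (rule weak_gradient_cong_AE) (simp add: measurable_completion)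
  have fin': "AE x in lborel. dyadic_maximal (\<lambda>y. ennreal (c * F y)) x < \<infinity>"
    using fin by eventually_elim (auto simp: M_scale ennreal_mult_less_top)
  obtain C S where C: "C > 0" and S: "S \<in> null_sets lborel"
    and le: "\<And>x y. x \<notin> S \<Longrightarrow> y \<notin> S \<Longrightarrow> \<bar>f' x - f' y\<bar> \<le> norm (x - y) *
      (C * (c * m x + \<bar>f' x\<bar>) + C * (c * m y + \<bar>f' y\<bar>))"
    using weak_gradient_pointwise_estimate[OF wg' _ _ GF fin'] c(1)
    by (auto simp: M_scale enn2real_mult m_def)
  \<comment> \<open>The maximal function was taken of \<open>F = \<bar>G\<bar> / c\<close>; the factor \<open>c\<close> undoes the scaling.\<close>
  define g where "g x = C * (c * m x + \<bar>f' x\<bar>)" for x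
  have f'L: "(\<lambda>x. \<bar>f' x\<bar>) \<in> Lp_var p"
    by (rule Lp_var_dominated[OF p fL, where a=1])
       (use f' in \<open>auto intro!: measurable_completion AE_completion elim: eventually_mono\<close>)
  have gL: "g \<in> Lp_var p"
    unfolding g_def[abs_def] by (intro Lp_var_cmult Lp_var_add p pm mL f'L)
  have g0: "g x \<ge> 0" for x using C c by (simp add: g_def m_def)
  obtain N where N: "N \<in> null_sets lborel" "{x. f x \<noteq> f' x} \<subseteq> N"
    using f' unfolding eventually_ae_filter by auto
  have "S \<union> N \<in> null_sets lebesgue" using S N by (intro null_sets_completionI) auto
  moreover have "\<bar>f x - f y\<bar> \<le> norm (x - y) * (g x + g y)" if "x \<notin> S \<union> N" "y \<notin> S \<union> N" for x y
  proof -
    have "f x = f' x" "f y = f' y" using that N(2) by auto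
    then show ?thesis using le[of x y] that by (simp add: g_def)
  qed
  ultimately show ?thesis using gL g0
    by (intro bexI[of _ g] conjI bexI[of _ "S \<union> N"]) auto
qed

lemma pointwise_imp_W1p_var:
  fixes f g :: "'a::euclidean_space \<Rightarrow> real"
  assumes pm: "p \<in> borel_measurable lebesgue" and p: "\<And>x. 1 \<le> p x"
    and fL: "f \<in> Lp_var p" and gL: "g \<in> Lp_var p" and g0: "\<And>x. 0 \<le> g x"
    and S: "S \<in> null_sets lebesgue"
    and le: "\<And>x y. x \<notin> S \<Longrightarrow> y \<notin> S \<Longrightarrow> \<bar>f x - f y\<bar> \<le> norm (x - y) * (g x + g y)"
  shows "f \<in> W1p_var p"
proof -
  have fm: "f \<in> borel_measurable lebesgue" and gm: "g \<in> borel_measurable lebesgue"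
    using fL gL unfolding Lp_var_iff[OF p] by blast+
  obtain f' where [measurable]: "f' \<in> borel_measurable lborel" and f': "AE x in lborel. f x = f' x"
    using completion_ex_borel_measurable_real[OF fm] by auto
  obtain h where [measurable]: "h \<in> borel_measurable lborel" and h: "AE x in lborel. g x = h x"
    using completion_ex_borel_measurable_real[OF gm] by auto
  define g' where "g' x = \<bar>h x\<bar>" for x
  have [measurable]: "g' \<in> borel_measurable borel" unfolding g'_def[abs_def] by measurable
  have g': "AE x in lborel. g x = g' x"
    using h by eventually_elim (metis g'_def g0 abs_of_nonneg)
  have g'0: "g' x \<ge> 0" for x by (simp add: g'_def)
  obtain N where N: "N \<in> null_sets lborel" "{x. \<not> (f x = f' x \<and> g x = g' x)} \<subseteq> N"
    using eventually_conj[OF f' g'] unfolding eventually_ae_filter by auto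
  obtain S' where S': "S' \<in> null_sets lborel" "S \<subseteq> S'" using S unfolding null_sets_completion_iff2 by blast
  have SN: "S' \<union> N \<in> null_sets lborel" using S' N by auto
  have le': "\<bar>f' x - f' y\<bar> \<le> norm (x - y) * (g' x + g' y)" if "x \<notin> S' \<union> N" "y \<notin> S' \<union> N" for x y
  proof -
    have "f x = f' x" "f y = f' y" "g x = g' x" "g y = g' y" "x \<notin> S" "y \<notin> S" using that N(2) S'(2) by auto
    then show ?thesis using le[of x y] by simp
  qed
  have f'L: "f' \<in> Lp_var p"
    by (rule Lp_var_dominated[OF p fL, where a=1])
       (use f' in \<open>auto intro!: measurable_completion AE_completion elim: eventually_mono\<close>)
  have g'L: "g' \<in> Lp_var p"
    by (rule Lp_var_dominated[OF p gL, where a=1])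
       (use g' in \<open>auto intro!: measurable_completion AE_completion elim: eventually_mono\<close>)
  have lif: "locally_integrable f'" by (rule Lp_var_locally_integrable[OF p f'L pm])
  have lig: "locally_integrable g'" by (rule Lp_var_locally_integrable[OF p g'L pm])
  have "\<forall>b\<in>Basis. \<exists>v. v \<in> borel_measurable borel \<and> (\<forall>x. \<bar>v x\<bar> \<le> 1) \<and>
    (\<forall>u. test_function u \<longrightarrow>
      (\<integral>x. f' x * frechet_derivative u (at x) b \<partial>lborel) = - (\<integral>x. v x * (2 * g' x * u x) \<partial>lborel))"
  proof
    fix b :: 'a assume "b \<in> Basis"
    from weak_partial_derivative_exists[OF _ _ lif lig g'0 SN le' this]
    show "\<exists>v. v \<in> borel_measurable borel \<and> (\<forall>x. \<bar>v x\<bar> \<le> 1) \<and>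
      (\<forall>u. test_function u \<longrightarrow>
        (\<integral>x. f' x * frechet_derivative u (at x) b \<partial>lborel) = - (\<integral>x. v x * (2 * g' x * u x) \<partial>lborel))"
      unfolding Bex_def by simp
  qed
  from bchoice[OF this] obtain v where v_all: "\<forall>b\<in>Basis. v b \<in> borel_measurable borel \<and> (\<forall>x. \<bar>v b x\<bar> \<le> 1) \<and>
    (\<forall>u. test_function u \<longrightarrow>
      (\<integral>x. f' x * frechet_derivative u (at x) b \<partial>lborel) = - (\<integral>x. v b x * (2 * g' x * u x) \<partial>lborel))" ..
  have v: "v b \<in> borel_measurable borel" "\<bar>v b x\<bar> \<le> 1" if "b \<in> Basis" for b x
    using bspec[OF v_all that] by simp_all
  have v_weak: "(\<integral>x. f' x * frechet_derivative u (at x) b \<partial>lborel) = - (\<integral>x. v b x * (2 * g' x * u x) \<partial>lborel)"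
    if "b \<in> Basis" "test_function u" for b u
    using bspec[OF v_all that(1)] that(2) by simp
  define G where "G x = (\<Sum>b\<in>Basis. (v b x * (2 * g' x)) *\<^sub>R b)" for x
  have Gb: "G x \<bullet> b = v b x * (2 * g' x)" if "b \<in> Basis" for x b
    unfolding G_def using that by simp
  have [measurable]: "G \<in> borel_measurable borel"
    unfolding G_def[abs_def] using v(1) by (intro borel_measurable_sum borel_measurable_scaleR borel_measurable_times) auto
  have G_le: "norm (G x) \<le> real DIM('a) * (2 * g' x)" for x
  proof -
    have "norm (G x) \<le> (\<Sum>b\<in>Basis. \<bar>G x \<bullet> b\<bar>)" by (rule norm_le_l1)
    also have "\<dots> \<le> (\<Sum>b\<in>(Basis::'a set). 2 * g' x)"
      using v(2) g'0[of x] by (intro sum_mono) (auto simp: Gb abs_mult intro!: mult_left_le_one_le)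
    finally show ?thesis by simp
  qed
  have GL: "(\<lambda>x. norm (G x)) \<in> Lp_var p"
  proof (rule Lp_var_dominated[OF p g'L])
    show "AE x in lebesgue. \<bar>norm (G x)\<bar> \<le> (2 * real DIM('a)) * \<bar>g' x\<bar>"
      using G_le g'0 by (auto simp: mult_ac)
  qed (intro measurable_completion, measurable)
  have liG: "locally_integrable G"
    unfolding locally_integrable_def set_integrable_def
  proof (intro allI impI)
    fix K :: "'a set" assume K: "compact K"
    have [measurable]: "K \<in> sets borel" using borel_compact[OF K] by simp
    show "integrable lebesgue (\<lambda>x. indicator K x *\<^sub>R G x)"
    proof (rule Bochner_Integration.integrable_bound)
      show "integrable lebesgue (\<lambda>x. indicator K x *\<^sub>R norm (G x))"
        using Lp_var_locally_integrable[OF p GL pm] K by (simp add: locally_integrable_def set_integrable_def)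
      show "(\<lambda>x. indicator K x *\<^sub>R G x) \<in> borel_measurable lebesgue"
        by (intro measurable_completion) measurable
    qed auto
  qed
  have "weak_gradient f' G"
    unfolding weak_gradient_def
  proof (intro conjI lif liG allI impI ballI)
    fix u :: "'a \<Rightarrow> real" and b :: 'a assume u: "test_function u" and b: "b \<in> Basis"
    obtain R B where "continuous_on UNIV u" "continuous_on UNIV (\<lambda>x. frechet_derivative u (at x) b)"
      using test_function_bounds[OF u b] by metis
    then have [measurable]: "u \<in> borel_measurable borel" "(\<lambda>x. frechet_derivative u (at x) b) \<in> borel_measurable borel"
      by (auto intro: borel_measurable_continuous_onI)
    have "(\<integral>x. f' x * frechet_derivative u (at x) b \<partial>lebesgue) = (\<integral>x. f' x * frechet_derivative u (at x) b \<partial>lborel)"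
      by (rule integral_completion) measurable
    also have "\<dots> = - (\<integral>x. (G x \<bullet> b) * u x \<partial>lborel)"
      using v_weak[OF b u] by (simp add: Gb[OF b] mult.assoc)
    also have "(\<integral>x. (G x \<bullet> b) * u x \<partial>lborel) = (\<integral>x. (G x \<bullet> b) * u x \<partial>lebesgue)"
      by (rule integral_completion[symmetric]) measurable
    finally show "(\<integral>x. f' x * frechet_derivative u (at x) b \<partial>lebesgue) = - (\<integral>x. (G x \<bullet> b) * u x \<partial>lebesgue)" .
  qed
  moreover have "AE x in lebesgue. f' x = f x"
    using AE_completion[OF f'] by eventually_elim simp
  ultimately have "weak_gradient f G"
    by (rule weak_gradient_cong_AE) (use fm in \<open>auto intro: measurable_completion\<close>)
  then show ?thesis using fL GL by (auto simp: W1p_var_def)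
qed

theorem corollary3p7:
  fixes p :: "real ^ 'n \<Rightarrow> ennreal" and f :: "real ^ 'n \<Rightarrow> real"
  assumes "p \<in> borel_measurable lebesgue"
    and "\<And>x. 1 \<le> p x"
    and "ess_inf lebesgue p > 1"
    and "globally_log_holder (\<lambda>x. enn2real (1 / p x))"
  shows "f \<in> W1p_var p \<longleftrightarrow>
    f \<in> Lp_var p \<and>
    (\<exists>g \<in> Lp_var p. (\<forall>x. 0 \<le> g x) \<and>
      (\<exists>S \<in> null_sets lebesgue. \<forall>x y. x \<notin> S \<longrightarrow> y \<notin> S \<longrightarrow>
         \<bar>f x - f y\<bar> \<le> norm (x - y) * (g x + g y)))"
proof -
  have "f \<in> W1p_var p \<Longrightarrow> f \<in> Lp_var p" by (simp add: W1p_var_def)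
  then show ?thesis
    using W1p_var_imp_pointwise[OF assms] pointwise_imp_W1p_var[OF assms(1,2)] by blast
qed

end
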